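(* Let $S:\mathbb{D}^2\to\mathbb{C}^{M\times N}$ be a rational matrix-valued function with no poles in $\mathbb{D}^2$ such that $S(z)^*S(z)=I_N$ for all $z\in\mathbb{T}^2$ outside the zero set of the denominator of $S$. Then there exist an integer $r\ge 0$, an isometric matrix $U=\begin{pmatrix}A&B\\ C&D\end{pmatrix}$ of size $(M+r)\times(N+r)$ (with $A\in\mathbb{C}^{M\times N}$, $B\in\mathbb{C}^{M\times r}$, $C\in\mathbb{C}^{r\times N}$, $D\in\mathbb{C}^{r\times r}$, and $U^*U=I$), and orthogonal projections $P_1,P_2\in\mathbb{C}^{r\times r}$ with $P_1+P_2=I_r$, such that, with $\Delta(z_1,z_2)=z_1P_1+z_2P_2$, $$S(z)=A+B\Delta(z)(I-D\Delta(z))^{-1}C\qquad (z\in\mathbb{D}^2).$$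
   Context: $\mathbb{D}^2=\{(z_1,z_2)\in\mathbb{C}^2:|z_1|,|z_2|<1\}$ is the unit bidisk and $\mathbb{T}^2=\{(z_1,z_2)\in\mathbb{C}^2:|z_1|=|z_2|=1\}$ is the two-torus. A rational matrix-valued function is one of the form $S=Q/p$ with $Q$ a matrix polynomial in $z_1,z_2$ and $p$ a nonzero scalar polynomial (the denominator). *)

theory Defs
  imports
    "HOL-Analysis.Analysis"
    "HOL-Computational_Algebra.Computational_Algebra"
    "Jordan_Normal_Form.Gauss_Jordan_Elimination"
    "Jordan_Normal_Form.Schur_Decomposition"
begin

definition bidisk :: "(complex \<times> complex) set" where
  "bidisk = {(z1, z2). norm z1 < 1 \<and> norm z2 < 1}"

definition two_torus :: "(complex \<times> complex) set" where
  "two_torus = {(z1, z2). norm z1 = 1 \<and> norm z2 = 1}"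

text \<open>A polynomial in \<open>z1, z2\<close> is an element of \<open>\<complex>[z1][z2]\<close>: the outer variable is \<open>z2\<close> and
  the coefficients are polynomials in \<open>z1\<close>.\<close>

definition eval2 :: "complex poly poly \<Rightarrow> complex \<times> complex \<Rightarrow> complex" where
  "eval2 q z = poly (poly q [:snd z:]) (fst z)"

definition quotient_at ::
    "complex poly poly mat \<Rightarrow> complex poly poly \<Rightarrow> complex \<times> complex \<Rightarrow> complex mat" where
  "quotient_at Q p z = inverse (eval2 p z) \<cdot>\<^sub>m map_mat (\<lambda>q. eval2 q z) Q"

text \<open>Equality \<open>Q/p = Q'/p'\<close> in the field of rational functions, for nonzero denominators.\<close>

definition same_fraction ::
    "complex poly poly mat \<Rightarrow> complex poly poly \<Rightarrow>
     complex poly poly mat \<Rightarrow> complex poly poly \<Rightarrow> bool" where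
  "same_fraction Q p Q' p' \<longleftrightarrow> p' \<cdot>\<^sub>m Q = p \<cdot>\<^sub>m Q'"

text \<open>The numerator and denominator are not assumed to be in lowest terms, so a zero of \<open>p\<close> need
  not be a pole of \<open>Q/p\<close>: a pole is a point at which every way of writing the rational function as
  a fraction has a vanishing denominator.\<close>

definition poles :: "complex poly poly mat \<Rightarrow> complex poly poly \<Rightarrow> (complex \<times> complex) set" where
  "poles Q p = {z. \<not> (\<exists>Q' p'. same_fraction Q p Q' p' \<and> eval2 p' z \<noteq> 0)}"

text \<open>The function \<open>S\<close> is given by \<open>Q/p\<close> at all points that are not poles, including those zeros
  of \<open>p\<close> that are cancelled by \<open>Q\<close>. Its values at the poles are unconstrained. When \<open>p \<noteq> 0\<close>, the
  value prescribed at a point does not depend on the chosen fraction.\<close>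

definition rational_mat_function ::
    "nat \<Rightarrow> nat \<Rightarrow> complex poly poly mat \<Rightarrow> complex poly poly \<Rightarrow>
     (complex \<times> complex \<Rightarrow> complex mat) \<Rightarrow> bool" where
  "rational_mat_function M N Q p S \<longleftrightarrow>
     Q \<in> carrier_mat M N \<and> p \<noteq> 0 \<and>
     (\<forall>Q' p' z. same_fraction Q p Q' p' \<and> eval2 p' z \<noteq> 0 \<longrightarrow> S z = quotient_at Q' p' z)"

definition isometric_mat :: "complex mat \<Rightarrow> bool" where
  "isometric_mat U \<longleftrightarrow> mat_adjoint U * U = 1\<^sub>m (dim_col U)"

definition orthogonal_projection :: "nat \<Rightarrow> complex mat \<Rightarrow> bool" where
  "orthogonal_projection r P \<longleftrightarrow> P \<in> carrier_mat r r \<and> P * P = P \<and> mat_adjoint P = P"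

end

theory Submission
  imports
    Defs
    "HOL-Complex_Analysis.Great_Picard"
    "HOL-Computational_Algebra.Field_as_Ring"
    "HOL-Real_Asymp.Real_Asymp"
begin

text \<open>
  After cancelling common factors, \<open>S = Q/p\<close> with \<open>p\<close> free of zeros in the bidisk. Following
  Kummert, one finds vector polynomials \<open>F1\<close>, \<open>F2\<close> with
  \<open>cnj (p(w)) p(z) - Q(w)\<^sup>* Q(z) = (1 - cnj w1 z1) F1(w)\<^sup>* F1(z) + (1 - cnj w2 z2) F2(w)\<^sup>* F2(z)\<close>;
  then \<open>(p, z1 F1, z2 F2) \<mapsto> (Q, F1, F2)\<close> preserves norms, and an isometric extension \<open>U\<close> of it is the
  required matrix.

  All kernels are encoded as Hermitian forms on finitely supported coefficient sequences \<open>c\<close>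
  indexed by the integers: a matrix polynomial \<open>X\<close> acts by correlation, a form \<open>D\<close> such as
  \<open>\<parallel>X c\<parallel>\<^sup>2 - \<parallel>Y c\<parallel>\<^sup>2\<close> looks at a finite window, and \<open>energy D UNIV c\<close>, the sum of \<open>D\<close> over all
  translates, is the integral of \<open>c\<^sup>* (X\<^sup>* X - Y\<^sup>* Y) c\<close> over the unit circle. If this integral
  vanishes for all \<open>c\<close>, then \<open>D c = K c - K (shift 1 c)\<close> for the form \<open>K\<close> that sums \<open>D\<close> over the
  translates to the right of the origin. If in addition \<open>X\<close> is outer, any \<open>c\<close> can be continued to
  the left so that \<open>X c\<close> is negligible there, which makes \<open>K\<close> nonnegative.

  This is used twice. On almost every slice \<open>\<bar>z2\<bar> = 1\<close> the polynomial \<open>p(\<cdot>, z2)\<close> has no zeros in the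
  disk (Hurwitz), hence is outer, and \<open>K\<close> is a positive semidefinite trigonometric polynomial in
  \<open>z2\<close>. Its outer Fejer--Riesz factor \<open>E\<close>, obtained from the Schur complement (the infimum of the
  energy over all continuations to the left), gives \<open>F1\<close>. The remainder, now in the variable \<open>z2\<close>,
  is again of the form treated above, with \<open>X\<close> block triangular with outer diagonal blocks
  \<open>p(0, z2)\<close> and \<open>E\<close>; its form \<open>K\<close> gives \<open>F2\<close>.
\<close>

section \<open>Hermitian forms in finitely many coordinates\<close>

text \<open>The kernel is hidden and only asked to give real values, which makes it Hermitian on
  \<open>I\<close>. Vectors are total functions, so forms with different windows can be added and
  compared without a change of type.\<close>

definition hform :: "'i set \<Rightarrow> (('i \<Rightarrow> complex) \<Rightarrow> real) \<Rightarrow> bool" where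
  "hform I q \<longleftrightarrow> (\<exists>k. \<forall>c. complex_of_real (q c) = (\<Sum>i\<in>I. \<Sum>j\<in>I. cnj (c i) * k i j * c j))"

lemma hformI:
  assumes "\<And>c. complex_of_real (q c) = (\<Sum>i\<in>I. \<Sum>j\<in>I. cnj (c i) * k i j * c j)"
  shows "hform I q"
  using assms unfolding hform_def by blast

lemma hform_cong_vec:
  assumes "hform I q" "\<And>i. i \<in> I \<Longrightarrow> c i = c' i"
  shows "q c = q c'"
proof -
  obtain k where k: "\<And>c. complex_of_real (q c) = (\<Sum>i\<in>I. \<Sum>j\<in>I. cnj (c i) * k i j * c j)"
    using assms(1) unfolding hform_def by blast
  have "complex_of_real (q c) = complex_of_real (q c')"
    unfolding k using assms(2) by (intro sum.cong refl) auto
  then show ?thesis by simp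
qed

lemma hform_zero_vec:
  assumes "hform I q" "\<And>i. i \<in> I \<Longrightarrow> c i = 0"
  shows "q c = 0"
proof -
  obtain k where k: "\<And>c. complex_of_real (q c) = (\<Sum>i\<in>I. \<Sum>j\<in>I. cnj (c i) * k i j * c j)"
    using assms(1) unfolding hform_def by blast
  have "complex_of_real (q c) = 0"
    unfolding k using assms(2) by (simp add: sum.neutral)
  then show ?thesis by simp
qed

lemma hform_zero [simp]: "hform I (\<lambda>c. 0)"
  by (rule hformI[where k = "\<lambda>i j. 0"]) simp

lemma hform_add:
  assumes "hform I q" "hform I q'"
  shows "hform I (\<lambda>c. q c + q' c)"
proof -
  obtain k k' where
    "\<And>c. complex_of_real (q c) = (\<Sum>i\<in>I. \<Sum>j\<in>I. cnj (c i) * k i j * c j)"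
    "\<And>c. complex_of_real (q' c) = (\<Sum>i\<in>I. \<Sum>j\<in>I. cnj (c i) * k' i j * c j)"
    using assms unfolding hform_def by blast
  then show ?thesis
    by (intro hformI[where k = "\<lambda>i j. k i j + k' i j"]) (simp add: algebra_simps sum.distrib)
qed

lemma hform_uminus:
  assumes "hform I q"
  shows "hform I (\<lambda>c. - q c)"
proof -
  obtain k where
    "\<And>c. complex_of_real (q c) = (\<Sum>i\<in>I. \<Sum>j\<in>I. cnj (c i) * k i j * c j)"
    using assms unfolding hform_def by blast
  then show ?thesis
    by (intro hformI[where k = "\<lambda>i j. - k i j"]) (simp add: sum_negf)
qed

lemma hform_diff:
  assumes "hform I q" "hform I q'"
  shows "hform I (\<lambda>c. q c - q' c)"
  using hform_add[OF assms(1) hform_uminus[OF assms(2)]] by simp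

lemma hform_sum:
  assumes "\<And>s. s \<in> S \<Longrightarrow> hform I (q s)"
  shows "hform I (\<lambda>c. \<Sum>s\<in>S. q s c)"
  using assms by (induction S rule: infinite_finite_induct) (auto intro: hform_add)

lemma hform_mono:
  assumes "hform I q" "I \<subseteq> J" "finite J"
  shows "hform J q"
proof -
  obtain k where k: "\<And>c. complex_of_real (q c) = (\<Sum>i\<in>I. \<Sum>j\<in>I. cnj (c i) * k i j * c j)"
    using assms(1) unfolding hform_def by blast
  show ?thesis
  proof (rule hformI[where k = "\<lambda>i j. if i \<in> I \<and> j \<in> I then k i j else 0"])
    fix c
    have "(\<Sum>i\<in>J. \<Sum>j\<in>J. cnj (c i) * (if i \<in> I \<and> j \<in> I then k i j else 0) * c j)
        = (\<Sum>i\<in>I. \<Sum>j\<in>J. cnj (c i) * (if i \<in> I \<and> j \<in> I then k i j else 0) * c j)"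
      using assms by (intro sum.mono_neutral_right) auto
    also have "\<dots> = (\<Sum>i\<in>I. \<Sum>j\<in>I. cnj (c i) * (if i \<in> I \<and> j \<in> I then k i j else 0) * c j)"
      using assms by (intro sum.cong refl sum.mono_neutral_right) auto
    also have "\<dots> = (\<Sum>i\<in>I. \<Sum>j\<in>I. cnj (c i) * k i j * c j)"
      by (intro sum.cong refl) auto
    finally show "complex_of_real (q c)
        = (\<Sum>i\<in>J. \<Sum>j\<in>J. cnj (c i) * (if i \<in> I \<and> j \<in> I then k i j else 0) * c j)"
      using k by simp
  qed
qed

lemma hform_norm2: "hform I (\<lambda>c. (cmod (\<Sum>i\<in>I. f i * c i))\<^sup>2)"
proof (rule hformI[where k = "\<lambda>i j. cnj (f i) * f j"])
  fix c
  have "complex_of_real ((cmod (\<Sum>i\<in>I. f i * c i))\<^sup>2) = cnj (\<Sum>i\<in>I. f i * c i) * (\<Sum>i\<in>I. f i * c i)"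
    by (metis complex_norm_square mult.commute)
  also have "\<dots> = (\<Sum>i\<in>I. \<Sum>j\<in>I. cnj (c i) * (cnj (f i) * f j) * c j)"
    unfolding cnj_sum sum_product by (intro sum.cong refl) simp
  finally show "complex_of_real ((cmod (\<Sum>i\<in>I. f i * c i))\<^sup>2)
      = (\<Sum>i\<in>I. \<Sum>j\<in>I. cnj (c i) * (cnj (f i) * f j) * c j)" .
qed

text \<open>Pulling back along a partial relabelling of coordinates, with zeros where
  \<open>P\<close> fails, covers shifts, restrictions and the translation in the first variable
  alike.\<close>

lemma hform_reindex:
  assumes "hform I q" "inj_on \<pi> {i \<in> I. P i}" "\<pi> ` {i \<in> I. P i} \<subseteq> J" "finite I" "finite J"
  shows "hform J (\<lambda>c. q (\<lambda>i. if P i then c (\<pi> i) else 0))"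
proof -
  obtain k where k: "\<And>c. complex_of_real (q c) = (\<Sum>i\<in>I. \<Sum>j\<in>I. cnj (c i) * k i j * c j)"
    using assms(1) unfolding hform_def by blast
  let ?I = "{i \<in> I. P i}"
  let ?k = "\<lambda>i j. k (the_inv_into ?I \<pi> i) (the_inv_into ?I \<pi> j)"
  have "hform (\<pi> ` ?I) (\<lambda>c. q (\<lambda>i. if P i then c (\<pi> i) else 0))"
  proof (rule hformI[where k = ?k])
    fix c
    have "complex_of_real (q (\<lambda>i. if P i then c (\<pi> i) else 0))
        = (\<Sum>i\<in>I. \<Sum>j\<in>I. if P i \<and> P j then cnj (c (\<pi> i)) * k i j * c (\<pi> j) else 0)"
      unfolding k by (intro sum.cong refl) auto
    also have "\<dots> = (\<Sum>i\<in>?I. \<Sum>j\<in>?I. cnj (c (\<pi> i)) * k i j * c (\<pi> j))"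
    proof -
      have "(\<Sum>j\<in>I. if P i \<and> P j then cnj (c (\<pi> i)) * k i j * c (\<pi> j) else 0)
          = (if P i then \<Sum>j\<in>?I. cnj (c (\<pi> i)) * k i j * c (\<pi> j) else 0)" for i
        using assms(4) by (simp add: sum.inter_filter)
      then show ?thesis using assms(4) by (simp add: sum.inter_filter[symmetric])
    qed
    also have "\<dots> = (\<Sum>i\<in>\<pi> ` ?I. \<Sum>j\<in>\<pi> ` ?I. cnj (c i) * ?k i j * c j)"
      using assms(2) by (simp add: sum.reindex the_inv_into_f_f)
    finally show "complex_of_real (q (\<lambda>i. if P i then c (\<pi> i) else 0))
        = (\<Sum>i\<in>\<pi> ` ?I. \<Sum>j\<in>\<pi> ` ?I. cnj (c i) * ?k i j * c j)" .
  qed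
  then show ?thesis using assms by (meson hform_mono)
qed

section \<open>Polarization and limits of forms\<close>

text \<open>Polarization at the vectors \<open>e_i + s e_j\<close> expresses each kernel entry
  through four values of the form. Hence pointwise convergence of forms implies convergence of their
  kernels, which is what \<open>hform_limit\<close> needs.\<close>

definition polar :: "(('i \<Rightarrow> complex) \<Rightarrow> real) \<Rightarrow> 'i \<Rightarrow> 'i \<Rightarrow> complex" where
  "polar q i j = (let Q = (\<lambda>s. complex_of_real (q (\<lambda>x. of_bool (x = i) + s * of_bool (x = j))))
     in (Q 1 - Q (-1) - \<i> * Q \<i> + \<i> * Q (- \<i>)) / 4)"

lemma sum_kernel_delta:
  fixes k :: "'i \<Rightarrow> 'i \<Rightarrow> complex"
  assumes "finite I" "i \<in> I" "j \<in> I"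
  shows "(\<Sum>x\<in>I. \<Sum>y\<in>I. cnj (of_bool (x = i) + s * of_bool (x = j)) * k x y
      * (of_bool (y = i) + s * of_bool (y = j)))
    = k i i + s * k i j + cnj s * k j i + cnj s * s * k j j"
proof -
  have inner: "(\<Sum>y\<in>I. a * k x y * (of_bool (y = i) + s * of_bool (y = j)))
      = a * (k x i + s * k x j)" for a x
  proof -
    have "(\<Sum>y\<in>I. a * k x y * (of_bool (y = i) + s * of_bool (y = j)))
        = (\<Sum>y\<in>I. (if y = i then a * k x y else 0) + (if y = j then a * s * k x y else 0))"
      by (intro sum.cong refl) (auto simp: algebra_simps)
    also have "\<dots> = a * k x i + a * s * k x j"
      using assms by (simp add: sum.distrib)
    finally show ?thesis by (simp add: algebra_simps)
  qed
  have "(\<Sum>x\<in>I. cnj (of_bool (x = i) + s * of_bool (x = j)) * (k x i + s * k x j))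
      = (\<Sum>x\<in>I. (if x = i then k x i + s * k x j else 0)
          + (if x = j then cnj s * (k x i + s * k x j) else 0))"
    by (intro sum.cong refl) (auto simp: algebra_simps)
  also have "\<dots> = (k i i + s * k i j) + cnj s * (k j i + s * k j j)"
    using assms by (simp add: sum.distrib)
  finally show ?thesis
    unfolding inner by (simp add: algebra_simps)
qed

lemma hform_polar:
  assumes "hform I q" "finite I"
  shows "complex_of_real (q c) = (\<Sum>i\<in>I. \<Sum>j\<in>I. cnj (c i) * polar q i j * c j)"
proof -
  obtain k where k: "\<And>c. complex_of_real (q c) = (\<Sum>i\<in>I. \<Sum>j\<in>I. cnj (c i) * k i j * c j)"
    using assms(1) unfolding hform_def by blast
  have "polar q i j = k i j" if "i \<in> I" "j \<in> I" for i j
  proof -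
    have "complex_of_real (q (\<lambda>x. of_bool (x = i) + s * of_bool (x = j)))
        = k i i + s * k i j + cnj s * k j i + cnj s * s * k j j" for s
      unfolding k using sum_kernel_delta[OF assms(2) that] .
    then show ?thesis
      unfolding polar_def Let_def by (simp only:) (simp add: algebra_simps)
  qed
  then show ?thesis unfolding k by (intro sum.cong refl) auto
qed

lemma hform_limit:
  assumes "finite I" "\<And>n. hform I (Q n)" "\<And>c. (\<lambda>n. Q n c) \<longlonglongrightarrow> q c"
  shows "hform I q"
proof (rule hformI[where k = "polar q"])
  fix c
  have "(\<lambda>n. polar (Q n) i j) \<longlonglongrightarrow> polar q i j" for i j
    unfolding polar_def Let_def by (intro tendsto_intros assms(3)) auto
  then have "(\<lambda>n. \<Sum>i\<in>I. \<Sum>j\<in>I. cnj (c i) * polar (Q n) i j * c j)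
      \<longlonglongrightarrow> (\<Sum>i\<in>I. \<Sum>j\<in>I. cnj (c i) * polar q i j * c j)"
    by (intro tendsto_intros)
  then have "(\<lambda>n. complex_of_real (Q n c)) \<longlonglongrightarrow> (\<Sum>i\<in>I. \<Sum>j\<in>I. cnj (c i) * polar q i j * c j)"
    using hform_polar[OF assms(2,1)] by simp
  moreover have "(\<lambda>n. complex_of_real (Q n c)) \<longlonglongrightarrow> complex_of_real (q c)"
    by (intro tendsto_of_real assms(3))
  ultimately show "complex_of_real (q c) = (\<Sum>i\<in>I. \<Sum>j\<in>I. cnj (c i) * polar q i j * c j)"
    using LIMSEQ_unique by blast
qed

section \<open>Completing squares, Schur complements and infima\<close>

text \<open>If the diagonal entry at \<open>a\<close> vanishes, nonnegativity forces its whole row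
  to vanish. Otherwise the row divided by the square root of that entry gives \<open>f\<close>, and
  the remainder no longer involves \<open>a\<close>. The last clause guarantees that a nontrivial
  square can always be made zero by solving for coordinate \<open>a\<close>.\<close>

lemma hform_complete_square:
  assumes "hform (insert a I) q" "finite I" "a \<notin> I" "\<And>c. 0 \<le> q c"
  shows "\<exists>q' f. hform I q' \<and> (\<forall>c. 0 \<le> q' c)
    \<and> (\<forall>c. q c = q' c + (cmod (\<Sum>i\<in>insert a I. f i * c i))\<^sup>2)
    \<and> (f a = 0 \<longrightarrow> f = (\<lambda>_. 0))"
proof -
  let ?J = "insert a I"
  have finJ: "finite ?J" using assms(2) by simp
  obtain k where k: "\<And>c. complex_of_real (q c) = (\<Sum>i\<in>?J. \<Sum>j\<in>?J. cnj (c i) * k i j * c j)"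
    using assms(1) unfolding hform_def by blast
  have two: "complex_of_real (q (\<lambda>x. of_bool (x = i) + s * of_bool (x = j)))
      = k i i + s * k i j + cnj s * k j i + cnj s * s * k j j" if "i \<in> ?J" "j \<in> ?J" for i j s
    unfolding k using sum_kernel_delta[OF finJ that] .
  have diag: "k i i = complex_of_real (q (\<lambda>x. of_bool (x = i)))" if "i \<in> ?J" for i
    using two[OF that that, of 0] by simp
  have herm: "k j i = cnj (k i j)" if "i \<in> ?J" "j \<in> ?J" for i j
  proof -
    have 1: "Im (k i i + s * k i j + cnj s * k j i + cnj s * s * k j j) = 0" for s
      using two[OF that] by (metis Im_complex_of_real)
    show ?thesis
      using 1[of 1] 1[of \<i>] diag[OF that(1)] diag[OF that(2)] by (simp add: complex_eq_iff)
  qed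
  define \<alpha> where "\<alpha> = q (\<lambda>x. of_bool (x = a))"
  have ka: "k a a = complex_of_real \<alpha>" using diag \<alpha>_def by simp
  have "0 \<le> \<alpha>" unfolding \<alpha>_def by (rule assms(4))
  show ?thesis
  proof (cases "\<alpha> = 0")
    case True
    have kz: "k a i = 0" if "i \<in> I" for i
    proof (rule ccontr)
      assume nz: "k a i \<noteq> 0"
      define r where "r = (cmod (k a i))\<^sup>2"
      have "0 < r" using nz by (simp add: r_def)
      define b where "b = q (\<lambda>x. of_bool (x = i))"
      \<comment> \<open>With a zero diagonal entry the form is affine in \<open>t\<close>, with
        value \<open>b - 2 * t * r\<close>; this \<open>t\<close> makes it
        \<open>- b - 2 < 0\<close>.\<close>
      define t where "t = (b + 1) / r"
      have cc: "cnj (k a i) * k a i = complex_of_real r"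
        by (metis complex_norm_square mult.commute r_def)
      have "complex_of_real (q (\<lambda>x. of_bool (x = i) + (- complex_of_real t * k a i) * of_bool (x = a)))
          = complex_of_real (b - 2 * t * r)"
        using two[of i a "- complex_of_real t * k a i"] that diag[of i] herm[of a i] ka True cc
        by (simp add: b_def algebra_simps)
      then have "q (\<lambda>x. of_bool (x = i) + (- complex_of_real t * k a i) * of_bool (x = a)) = b - 2 * t * r"
        by (simp only: of_real_eq_iff)
      then have "0 \<le> b - 2 * t * r" using assms(4) by metis
      moreover have "t * r = b + 1" using \<open>0 < r\<close> by (simp add: t_def)
      moreover have "0 \<le> b" unfolding b_def by (rule assms(4))
      ultimately show False by simp
    qed
    have kz': "k i a = 0" if "i \<in> I" for i
      using kz[OF that] herm[of a i] that by simp
    have "hform I q"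
    proof (rule hformI[where k = k])
      fix c
      show "complex_of_real (q c) = (\<Sum>i\<in>I. \<Sum>j\<in>I. cnj (c i) * k i j * c j)"
        unfolding k using assms(2,3) kz kz' ka True by (simp add: sum.distrib)
    qed
    then show ?thesis using assms(4) by (intro exI[of _ q] exI[of _ "\<lambda>_. 0"]) simp
  next
    case False
    then have "0 < \<alpha>" using \<open>0 \<le> \<alpha>\<close> by simp
    define f where "f i = k a i / complex_of_real (sqrt \<alpha>)" for i
    have sq: "complex_of_real (sqrt \<alpha>) * complex_of_real (sqrt \<alpha>) = complex_of_real \<alpha>"
      using \<open>0 < \<alpha>\<close> by (simp flip: of_real_mult)
    have sn: "complex_of_real (sqrt \<alpha>) \<noteq> 0" using \<open>0 < \<alpha>\<close> by simp
    have fa: "f a = complex_of_real (sqrt \<alpha>)"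
      unfolding f_def ka using sq sn by (metis nonzero_mult_div_cancel_right)
    define q' where "q' c = q c - (cmod (\<Sum>i\<in>?J. f i * c i))\<^sup>2" for c
    have rep: "complex_of_real (q' c) = (\<Sum>i\<in>?J. \<Sum>j\<in>?J. cnj (c i) * (k i j - cnj (f i) * f j) * c j)" for c
    proof -
      have "complex_of_real ((cmod (\<Sum>i\<in>?J. f i * c i))\<^sup>2)
          = cnj (\<Sum>i\<in>?J. f i * c i) * (\<Sum>i\<in>?J. f i * c i)"
        by (metis complex_norm_square mult.commute)
      also have "\<dots> = (\<Sum>i\<in>?J. \<Sum>j\<in>?J. cnj (c i) * (cnj (f i) * f j) * c j)"
        unfolding cnj_sum sum_product by (intro sum.cong refl) simp
      finally have "complex_of_real (q' c) = (\<Sum>i\<in>?J. \<Sum>j\<in>?J. cnj (c i) * k i j * c j)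
          - (\<Sum>i\<in>?J. \<Sum>j\<in>?J. cnj (c i) * (cnj (f i) * f j) * c j)"
        unfolding q'_def of_real_diff k by simp
      then show ?thesis
        by (simp only: sum_subtractf[symmetric] right_diff_distrib left_diff_distrib)
    qed
    have z1: "k a j - cnj (f a) * f j = 0" for j
      using sn by (simp add: fa) (simp add: f_def)
    have z2: "k i a - cnj (f i) * f a = 0" if "i \<in> ?J" for i
      using sn herm[of a i] that by (simp add: fa) (simp add: f_def)
    have hq': "hform I q'"
    proof (rule hformI[where k = "\<lambda>i j. k i j - cnj (f i) * f j"])
      fix c
      show "complex_of_real (q' c) = (\<Sum>i\<in>I. \<Sum>j\<in>I. cnj (c i) * (k i j - cnj (f i) * f j) * c j)"
        unfolding rep using assms(2,3) z1 z2 by (simp add: sum.distrib)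
    qed
    have "0 \<le> q' c" for c
    proof -
      \<comment> \<open>\<open>q'\<close> does not see coordinate \<open>a\<close>, which may
        therefore be chosen so that the square vanishes and \<open>q'\<close> agrees with the
        nonnegative \<open>q\<close>.\<close>
      define c' where "c' = c(a := - (\<Sum>i\<in>I. f i * c i) / f a)"
      have "q' c = q' c'"
        using assms(3) by (intro hform_cong_vec[OF hq']) (auto simp: c'_def)
      also have "(\<Sum>i\<in>?J. f i * c' i) = f a * c' a + (\<Sum>i\<in>I. f i * c i)"
        using assms(2,3) by (simp add: c'_def) (intro sum.cong refl, auto)
      then have "q' c' = q c'"
        using sn by (simp add: q'_def fa c'_def)
      finally show ?thesis using assms(4) by simp
    qed
    moreover have "q c = q' c + (cmod (\<Sum>i\<in>?J. f i * c i))\<^sup>2" for c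
      by (simp add: q'_def)
    moreover have "f a \<noteq> 0" using fa sn by simp
    ultimately show ?thesis using hq' by (intro exI[of _ q'] exI[of _ f]) simp
  qed
qed

text \<open>The dual vectors \<open>e s\<close> make any realization of \<open>q\<close> as a squared norm send them to an
  orthonormal family.\<close>

lemma hform_factor:
  fixes q :: "('i \<Rightarrow> complex) \<Rightarrow> real"
  assumes "finite I" "hform I q" "\<And>c. 0 \<le> q c"
  shows "\<exists>(r::nat) f e. (\<forall>c. q c = (\<Sum>s<r. (cmod (\<Sum>i\<in>I. f s i * c i))\<^sup>2))
    \<and> (\<forall>s<r. \<forall>t<r. (\<Sum>i\<in>I. f s i * e t i) = of_bool (s = t))"
  using assms
proof (induction I arbitrary: q rule: finite_induct)
  case empty
  have "q c = 0" for c using hform_zero_vec[OF empty.prems(1)] by simp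
  then show ?case by (intro exI[of _ 0]) simp
next
  case (insert a I)
  obtain q' g where q': "hform I q'" "\<forall>c. 0 \<le> q' c"
    "\<forall>c. q c = q' c + (cmod (\<Sum>i\<in>insert a I. g i * c i))\<^sup>2" "g a = 0 \<longrightarrow> g = (\<lambda>_. 0)"
    using hform_complete_square[OF insert.prems(1) insert.hyps insert.prems(2)] by (elim exE conjE) (rule that; assumption)
  obtain r :: nat and f e where fe: "\<forall>c. q' c = (\<Sum>s<r. (cmod (\<Sum>i\<in>I. f s i * c i))\<^sup>2)"
    "\<forall>s<r. \<forall>t<r. (\<Sum>i\<in>I. f s i * e t i) = of_bool (s = t)"
    using insert.IH[OF q'(1) q'(2)[rule_format]] by (elim exE conjE) (rule that; assumption)
  define f' where "f' = (\<lambda>s i. if i = a then 0 else f s i)"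
  have f': "(\<Sum>i\<in>insert a I. f' s i * c i) = (\<Sum>i\<in>I. f s i * c i)" for s c
    using insert.hyps by (simp add: f'_def) (intro sum.cong refl, auto)
  show ?case
  proof (cases "g a = 0")
    case True
    then have 1: "\<forall>c. q c = (\<Sum>s<r. (cmod (\<Sum>i\<in>insert a I. f' s i * c i))\<^sup>2)"
      using q'(3,4) fe(1) f' by simp
    have 2: "\<forall>s<r. \<forall>t<r. (\<Sum>i\<in>insert a I. f' s i * e t i) = of_bool (s = t)"
      using fe(2) f' by simp
    show ?thesis
      by (rule exI[of _ r], rule exI[of _ f'], rule exI[of _ e], rule conjI) (rule 1, rule 2)
  next
    case False
    define G where "G c = (\<Sum>i\<in>insert a I. g i * c i)" for c
    define F where "F = (\<lambda>s. if s < r then f' s else g)"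
    \<comment> \<open>Coordinate \<open>a\<close> is invisible to the old functionals and is used to
      make \<open>g\<close> annihilate the old dual vectors. The new dual vector is concentrated at
      \<open>a\<close>.\<close>
    define e0 where "e0 t = (e t)(a := - (\<Sum>i\<in>I. g i * e t i) / g a)" for t
    define E where "E = (\<lambda>s. if s < r then e0 s else (\<lambda>i. if i = a then 1 / g a else 0))"
    have 1: "q c = (\<Sum>s<Suc r. (cmod (\<Sum>i\<in>insert a I. F s i * c i))\<^sup>2)" for c
      using q'(3) fe(1) f' by (simp add: F_def)
    have "(\<Sum>i\<in>insert a I. F s i * E t i) = of_bool (s = t)" if st: "s < Suc r" "t < Suc r" for s t
    proof -
      have I0: "(\<Sum>i\<in>I. h i * e0 t i) = (\<Sum>i\<in>I. h i * e t i)" for h :: "'i \<Rightarrow> complex"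
        using insert.hyps by (intro sum.cong refl) (auto simp: e0_def)
      have I1: "(\<Sum>i\<in>I. h i * (if i = a then 1 / g a else 0)) = 0" for h :: "'i \<Rightarrow> complex"
        using insert.hyps by (intro sum.neutral) auto
      consider "s < r" "t < r" | "s < r" "t = r" | "s = r" "t < r" | "s = r" "t = r"
        using st by linarith
      then show ?thesis
      proof cases
        case 1 then show ?thesis by (simp add: F_def E_def f' I0 fe(2))
      next
        case 2 then show ?thesis by (simp add: F_def E_def f' I1)
      next
        case 3 then show ?thesis
          using insert.hyps False by (simp add: F_def E_def I0) (simp add: e0_def)
      next
        case 4 then show ?thesis
          using insert.hyps False by (simp add: F_def E_def I1)
      qed
    qed
    then have 2: "\<forall>s<Suc r. \<forall>t<Suc r. (\<Sum>i\<in>insert a I. F s i * E t i) = of_bool (s = t)"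
      by blast
    show ?thesis
      by (rule exI[of _ "Suc r"], rule exI[of _ F], rule exI[of _ E], rule conjI) (rule allI, rule 1, rule 2)
  qed
qed

text \<open>Partial minimization by removing the coordinates of \<open>J\<close> one at a time: each
  step drops a completed square. The minimum is attained because every dropped square can be made
  zero by its leading coordinate.\<close>

lemma hform_eliminate:
  assumes "finite J" "finite I" "I \<inter> J = {}" "hform (I \<union> J) q" "\<And>c. 0 \<le> q c"
  shows "\<exists>q'. hform I q' \<and> (\<forall>c. 0 \<le> q' c) \<and> (\<forall>c. q' c \<le> q c)
    \<and> (\<forall>c. \<exists>e. (\<forall>i. i \<notin> J \<longrightarrow> e i = c i) \<and> q e = q' c)"
  using assms
proof (induction J arbitrary: q rule: finite_induct)
  case empty
  then have "hform I q" by simp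
  then show ?case using empty.prems(4) by blast
next
  case (insert a J)
  have h: "hform (insert a (I \<union> J)) q" "finite (I \<union> J)" "a \<notin> I \<union> J"
    using insert by auto
  obtain q1 g where q1: "hform (I \<union> J) q1" "\<forall>c. 0 \<le> q1 c"
    "\<forall>c. q c = q1 c + (cmod (\<Sum>i\<in>insert a (I \<union> J). g i * c i))\<^sup>2" "g a = 0 \<longrightarrow> g = (\<lambda>_. 0)"
    using hform_complete_square[OF h insert.prems(4)] by (elim exE conjE) (rule that; assumption)
  have IJ: "I \<inter> J = {}" using insert.prems by auto
  obtain q' where q': "hform I q'" "\<And>c. 0 \<le> q' c" "\<And>c. q' c \<le> q1 c"
    "\<And>c. \<exists>e. (\<forall>i. i \<notin> J \<longrightarrow> e i = c i) \<and> q1 e = q' c"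
    using insert.IH[OF insert.prems(1) IJ q1(1) q1(2)[rule_format]] by blast
  have "\<exists>e. (\<forall>i. i \<notin> insert a J \<longrightarrow> e i = c i) \<and> q e = q' c" for c
  proof -
    obtain e where e: "\<forall>i. i \<notin> J \<longrightarrow> e i = c i" "q1 e = q' c" using q'(4) by blast
    \<comment> \<open>If \<open>g a = 0\<close>, the quotient is 0 by convention; then
      \<open>g\<close> vanishes identically and any value would do.\<close>
    define e' where "e' = e(a := - (\<Sum>i\<in>I \<union> J. g i * e i) / g a)"
    have "q1 e' = q1 e"
      using h(3) by (intro hform_cong_vec[OF q1(1)]) (auto simp: e'_def)
    moreover have "(\<Sum>i\<in>insert a (I \<union> J). g i * e' i) = 0"
    proof (cases "g a = 0")
      case True
      then show ?thesis using q1(4) by simp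
    next
      case False
      have "(\<Sum>i\<in>I \<union> J. g i * e' i) = (\<Sum>i\<in>I \<union> J. g i * e i)"
        using h(3) by (intro sum.cong refl) (auto simp: e'_def)
      then show ?thesis
        using False h(3) h(2) by (simp add: e'_def)
    qed
    ultimately have "q e' = q' c" using q1(3) e(2) by simp
    then show ?thesis using e(1) by (intro exI[of _ e']) (auto simp: e'_def)
  qed
  moreover have "q' c \<le> q c" for c using q'(3)[of c] q1(3) by (smt (verit) zero_le_power2)
  ultimately show ?case using q'(1,2) by blast
qed

text \<open>The infimum over all coordinates outside \<open>A 0\<close> is the decreasing limit of the Schur complements
  obtained by minimizing over \<open>A n - A 0\<close>.\<close>

lemma hform_infimum:
  assumes "\<And>n. finite (A n)" "\<And>n. A n \<subseteq> A (Suc n)"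
    and "\<And>n. hform (A n) (Q n)" "\<And>n c. 0 \<le> Q n c"
    and "\<And>n c. (\<And>i. i \<notin> A n \<Longrightarrow> c i = 0) \<Longrightarrow> Q (Suc n) c = Q n c"
  shows "\<exists>q. hform (A 0) q \<and> (\<forall>n c. q c \<le> Q n c)
    \<and> (\<forall>c. \<forall>\<epsilon>>0. \<exists>n e. (\<forall>i\<in>A 0. e i = c i) \<and> Q n e \<le> q c + \<epsilon>)"
proof -
  have sub: "A 0 \<subseteq> A n" for n using assms(2) by (induction n) auto
  have "\<exists>q'. hform (A 0) q' \<and> (\<forall>c. 0 \<le> q' c) \<and> (\<forall>c. q' c \<le> Q n c)
      \<and> (\<forall>c. \<exists>e. (\<forall>i. i \<notin> A n - A 0 \<longrightarrow> e i = c i) \<and> Q n e = q' c)" for n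
  proof -
    have "A 0 \<union> (A n - A 0) = A n" using sub by blast
    then have 1: "hform (A 0 \<union> (A n - A 0)) (Q n)" using assms(3) by simp
    have 2: "finite (A n - A 0)" using assms(1) by simp
    show ?thesis
      using hform_eliminate[OF 2 assms(1) Diff_disjoint 1 assms(4)] .
  qed
  then obtain p where p: "\<And>n. hform (A 0) (p n)" "\<And>n c. 0 \<le> p n c" "\<And>n c. p n c \<le> Q n c"
    "\<And>n c. \<exists>e. (\<forall>i. i \<notin> A n - A 0 \<longrightarrow> e i = c i) \<and> Q n e = p n c"
    by metis
  have dec: "p (Suc n) c \<le> p n c" for n c
  proof -
    obtain e where e: "\<forall>i. i \<notin> A n - A 0 \<longrightarrow> e i = c i" "Q n e = p n c" using p(4) by blast
    \<comment> \<open>Cut off outside \<open>A n\<close>, the minimizer of stage \<open>n\<close>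
      competes in stage \<open>n + 1\<close> with the same value.\<close>
    define e' where "e' i = (if i \<in> A n then e i else 0)" for i
    have "p (Suc n) c = p (Suc n) e'"
      using e(1) sub by (intro hform_cong_vec[OF p(1)]) (auto simp: e'_def)
    also have "\<dots> \<le> Q (Suc n) e'" by (rule p(3))
    also have "\<dots> = Q n e'" by (rule assms(5)) (auto simp: e'_def)
    also have "\<dots> = Q n e" by (intro hform_cong_vec[OF assms(3)]) (auto simp: e'_def)
    finally show ?thesis using e(2) by simp
  qed
  define q where "q c = lim (\<lambda>n. p n c)" for c
  have lim: "(\<lambda>n. p n c) \<longlonglongrightarrow> q c" for c
  proof -
    have "decseq (\<lambda>n. p n c)" using dec by (simp add: decseq_Suc_iff)
    then show ?thesis
      using decseq_convergent[of "\<lambda>n. p n c" 0] p(2) unfolding q_def by (metis limI)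
  qed
  have le: "q c \<le> p n c" for n c
    using decseq_ge[OF _ lim] dec by (simp add: decseq_Suc_iff)
  have "\<exists>n e. (\<forall>i\<in>A 0. e i = c i) \<and> Q n e \<le> q c + \<epsilon>" if "0 < \<epsilon>" for c \<epsilon>
  proof -
    have "eventually (\<lambda>n. p n c < q c + \<epsilon>) sequentially"
      using order_tendstoD(2)[OF lim] that by simp
    then obtain n where n: "p n c < q c + \<epsilon>" by (auto simp: eventually_sequentially)
    obtain e where "\<forall>i. i \<notin> A n - A 0 \<longrightarrow> e i = c i" "Q n e = p n c" using p(4) by blast
    then show ?thesis
      using n by (intro exI[of _ n] exI[of _ e]) auto
  qed
  moreover have "hform (A 0) q" using hform_limit[OF assms(1) p(1) lim] .
  moreover have "q c \<le> Q n c" for n c using le p(3) order_trans by blast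
  ultimately show ?thesis by blast
qed

section \<open>Toeplitz forms and outer factors\<close>

definition shift :: "int \<Rightarrow> (int \<times> 'h \<Rightarrow> complex) \<Rightarrow> int \<times> 'h \<Rightarrow> complex" where
  "shift b c = (\<lambda>(j, x). c (j + b, x))"

definition fsupp :: "('i \<Rightarrow> complex) \<Rightarrow> bool" where
  "fsupp c \<longleftrightarrow> finite {i. c i \<noteq> 0}"

definition restr :: "'i set \<Rightarrow> ('i \<Rightarrow> complex) \<Rightarrow> 'i \<Rightarrow> complex" where
  "restr A c = (\<lambda>i. if i \<in> A then c i else 0)"

text \<open>The infinite sum allows half-lines and \<open>UNIV\<close> as index sets without naming
  a range. When \<open>D\<close> sees a finite window and \<open>c\<close> is finitely supported,
  only finitely many terms are nonzero.\<close>

definition energy :: "((int \<times> 'h \<Rightarrow> complex) \<Rightarrow> real) \<Rightarrow> int set \<Rightarrow> (int \<times> 'h \<Rightarrow> complex) \<Rightarrow> real" where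
  "energy D B c = (\<Sum>\<^sub>\<infinity>b\<in>B. D (shift b c))"

lemma shift_apply [simp]: "shift b c (j, x) = c (j + b, x)"
  by (simp add: shift_def)

lemma shift_shift [simp]: "shift a (shift b c) = shift (a + b) c"
  by (auto simp: shift_def add_ac)

lemma shift_0 [simp]: "shift 0 c = c"
  by (auto simp: shift_def)

lemma fsupp_shift: "fsupp c \<Longrightarrow> fsupp (shift b c)"
proof -
  assume "fsupp c"
  have "{i. shift b c i \<noteq> 0} \<subseteq> (\<lambda>(j, x). (j - b, x)) ` {i. c i \<noteq> 0}"
    by (force simp: shift_def image_iff)
  then show ?thesis
    using \<open>fsupp c\<close> unfolding fsupp_def by (meson finite_imageI finite_subset)
qed

lemma fsupp_restr: "finite A \<Longrightarrow> fsupp (restr A c)"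
  unfolding fsupp_def restr_def by (rule finite_subset[of _ A]) auto

lemma fsupp_restr': "fsupp c \<Longrightarrow> fsupp (restr A c)"
  unfolding fsupp_def restr_def by (erule finite_subset[rotated]) auto

lemma finite_shift_nonzero:
  assumes "hform ({m..n} \<times> H) D" "fsupp c"
  shows "finite {b. D (shift b c) \<noteq> 0}"
proof (rule finite_subset)
  show "{b. D (shift b c) \<noteq> 0} \<subseteq> (\<lambda>(i, j). fst i - j) ` ({i. c i \<noteq> 0} \<times> {m..n})"
  proof
    fix b
    assume "b \<in> {b. D (shift b c) \<noteq> 0}"
    then obtain i where "i \<in> {m..n} \<times> H" "shift b c i \<noteq> 0"
      using hform_zero_vec[OF assms(1), of "shift b c"] by blast
    then obtain j x where "j \<in> {m..n}" "c (j + b, x) \<noteq> 0"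
      by (cases i) auto
    then show "b \<in> (\<lambda>(i, j). fst i - j) ` ({i. c i \<noteq> 0} \<times> {m..n})"
      by (intro image_eqI[of _ _ "((j + b, x), j)"]) auto
  qed
  show "finite ((\<lambda>(i, j). fst i - j) ` ({i. c i \<noteq> 0} \<times> {m..n}))"
    using assms(2) by (auto simp: fsupp_def)
qed

lemma energy_summable:
  assumes "hform ({m..n} \<times> H) D" "fsupp c"
  shows "(\<lambda>b. D (shift b c)) summable_on B"
  using finite_shift_nonzero[OF assms] by (intro finite_nonzero_values_imp_summable_on) (auto elim: finite_subset[rotated])

lemma energy_Un:
  assumes "hform ({m..n} \<times> H) D" "fsupp c" "B \<inter> C = {}"
  shows "energy D (B \<union> C) c = energy D B c + energy D C c"
  unfolding energy_def using assms by (intro infsum_Un_disjoint energy_summable) auto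

lemma energy_finite: "finite F \<Longrightarrow> energy D F c = (\<Sum>b\<in>F. D (shift b c))"
  by (simp add: energy_def)

lemma energy_neutral:
  assumes "F \<subseteq> B" "\<And>b. b \<in> B - F \<Longrightarrow> D (shift b c) = 0"
  shows "energy D B c = energy D F c"
  unfolding energy_def using assms by (intro infsum_cong_neutral) auto

lemma energy_shift: "energy D B (shift a c) = energy D ((\<lambda>b. b + a) ` B) c"
proof -
  have "inj_on (\<lambda>b. b + a) B" by (auto simp: inj_on_def)
  then show ?thesis
    unfolding energy_def by (subst infsum_reindex) (auto simp: o_def)
qed

lemma energy_cong:
  assumes "\<And>b. b \<in> B \<Longrightarrow> D (shift b c) = D' (shift b c')"
  shows "energy D B c = energy D' B c'"
  unfolding energy_def using assms by (rule infsum_cong)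

lemma energy_add:
  assumes "hform ({m..n} \<times> H) D" "hform ({m'..n'} \<times> H') D'" "fsupp c"
  shows "energy (\<lambda>c. D c + D' c) B c = energy D B c + energy D' B c"
  unfolding energy_def using assms by (intro infsum_add energy_summable)

lemma energy_uminus: "energy (\<lambda>c. - D c) B c = - energy D B c"
  unfolding energy_def by (rule infsum_uminus)

lemma energy_diff:
  assumes "hform ({m..n} \<times> H) D" "hform ({m'..n'} \<times> H') D'" "fsupp c"
  shows "energy (\<lambda>c. D c - D' c) B c = energy D B c - energy D' B c"
  using energy_add[OF assms(1) hform_uminus[OF assms(2)] assms(3)] by (simp add: energy_uminus)

lemma energy_mono:
  assumes "hform ({m..n} \<times> H) D" "hform ({m'..n'} \<times> H') D'" "fsupp c" "\<And>c. D c \<le> D' c"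
  shows "energy D B c \<le> energy D' B c"
  unfolding energy_def using assms by (intro infsum_mono energy_summable)

lemma energy_split:
  assumes "hform ({m..n} \<times> H) D" "fsupp c"
  shows "energy D UNIV c = energy D {..<0} c + energy D {0..} c"
proof -
  have "(UNIV :: int set) = {..<0} \<union> {0..}" "{..<0::int} \<inter> {0..} = {}" by auto
  then show ?thesis using energy_Un[OF assms] by metis
qed

text \<open>The shift moves the single term of index 0 across the cut between past and
  future.\<close>

lemma energy_step:
  assumes "hform ({m..n} \<times> H) D" "fsupp c"
  shows "energy D {..<0} (shift 1 c) = energy D {..<0} c + D c"
    and "energy D {0..} c = D c + energy D {0..} (shift 1 c)"
    and "energy D UNIV (shift 1 c) = energy D UNIV c"
proof -
  have "(\<lambda>b. b + 1) ` {..<0} = {..<0} \<union> {0::int}"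
    by (simp add: set_eq_iff image_iff Bex_def) presburger
  then show "energy D {..<0} (shift 1 c) = energy D {..<0} c + D c"
    using energy_Un[OF assms, of "{..<0}" "{0}"] by (simp add: energy_shift energy_finite)
  have "(\<lambda>b. b + 1) ` {0..} = {1::int..}"
    by (simp add: set_eq_iff image_iff Bex_def) presburger
  moreover have "{0::int..} = {0} \<union> {1..}" by auto
  ultimately show "energy D {0..} c = D c + energy D {0..} (shift 1 c)"
    using energy_Un[OF assms, of "{0}" "{1..}"] by (simp add: energy_shift energy_finite)
  have "range (\<lambda>b. b + 1) = (UNIV :: int set)" by (metis diff_add_cancel surjI)
  then show "energy D UNIV (shift 1 c) = energy D UNIV c"
    by (simp add: energy_shift)
qed

lemma hform_shift1:
  assumes "hform ({0..<d} \<times> H) q" "finite H"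
  shows "hform ({0..d} \<times> H) (\<lambda>c. q (shift 1 c))"
proof -
  have "hform ({0..d} \<times> H) (\<lambda>c. q (\<lambda>i. if True then c ((\<lambda>(j, x). (j + 1, x)) i) else 0))"
    using assms by (intro hform_reindex[OF assms(1)]) (auto simp: inj_on_def)
  moreover have "(\<lambda>i. if True then c ((\<lambda>(j, x). (j + 1, x)) i) else 0) = shift 1 c" for c :: "int \<times> 'a \<Rightarrow> complex"
    by (auto simp: shift_def)
  ultimately show ?thesis by simp
qed

lemma hform_shift_restr:
  assumes "hform ({0..d} \<times> H) D" "finite H" "finite A"
  shows "hform A (\<lambda>c. D (shift b (restr A c)))"
proof -
  have "hform A (\<lambda>c. D (\<lambda>i. if (\<lambda>(j, x). (j + b, x) \<in> A) i then c ((\<lambda>(j, x). (j + b, x)) i) else 0))"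
    using assms by (intro hform_reindex[OF assms(1)]) (auto simp: inj_on_def)
  moreover have "(\<lambda>i. if (\<lambda>(j, x). (j + b, x) \<in> A) i then c ((\<lambda>(j, x). (j + b, x)) i) else 0)
      = shift b (restr A c)" for c :: "int \<times> 'a \<Rightarrow> complex"
    by (auto simp: shift_def restr_def)
  ultimately show ?thesis by simp
qed

section \<open>Cutting the energy at the origin\<close>

text \<open>This is the form \<open>K\<close> of the introduction. After the restriction to
  \<open>{0..<d}\<close>, the translates by \<open>d\<close> or more see only zeros, so the finite
  sum is the whole energy of the future (\<open>tail_form_energy\<close>); being finite, it is a
  Hermitian form for every \<open>c\<close>.\<close>

definition tail_form :: "int \<Rightarrow> 'h set \<Rightarrow> ((int \<times> 'h \<Rightarrow> complex) \<Rightarrow> real) \<Rightarrow> (int \<times> 'h \<Rightarrow> complex) \<Rightarrow> real" where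
  "tail_form d H D c = (\<Sum>b\<in>{0..<d}. D (shift b (restr ({0..<d} \<times> H) c)))"

lemma hform_tail_form:
  assumes "hform ({0..d} \<times> H) D" "finite H"
  shows "hform ({0..<d} \<times> H) (tail_form d H D)"
proof -
  have "hform ({0..<d} \<times> H) (\<lambda>c. \<Sum>b\<in>{0..<d}. D (shift b (restr ({0..<d} \<times> H) c)))"
    using assms by (intro hform_sum hform_shift_restr) auto
  then show ?thesis unfolding tail_form_def .
qed

lemma tail_form_energy:
  assumes "hform ({0..d} \<times> H) D"
  shows "tail_form d H D c = energy D {0..} (restr ({0..<d} \<times> H) c)"
proof -
  have "energy D {0..} (restr ({0..<d} \<times> H) c) = energy D {0..<d} (restr ({0..<d} \<times> H) c)"
    by (intro energy_neutral hform_zero_vec[OF assms]) (auto simp: restr_def)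
  then show ?thesis by (simp add: energy_finite tail_form_def)
qed

text \<open>A window \<open>{0..d}\<close> translated by at most \<open>- 1\<close> reaches up to
  \<open>d - 1\<close>. The coordinates in \<open>{0..<d}\<close> are thus seen from the past and
  from the future, and they carry all interaction between the two.\<close>

lemma energy_past_cong:
  assumes "hform ({0..d} \<times> H) D" "\<And>j x. j < d \<Longrightarrow> x \<in> H \<Longrightarrow> c (j, x) = c' (j, x)"
  shows "energy D {..<0} c = energy D {..<0} c'"
  by (intro energy_cong hform_cong_vec[OF assms(1)]) (auto intro!: assms(2))

lemma energy_future_cong:
  assumes "hform ({0..d} \<times> H) D" "\<And>j x. 0 \<le> j \<Longrightarrow> x \<in> H \<Longrightarrow> c (j, x) = c' (j, x)"
  shows "energy D {0..} c = energy D {0..} c'"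
  by (intro energy_cong hform_cong_vec[OF assms(1)]) (auto intro!: assms(2))

lemma hform_energy_restr:
  assumes "hform ({0..d} \<times> H) D" "finite H"
  shows "hform ({m..<n} \<times> H) (\<lambda>c. energy D UNIV (restr ({m..<n} \<times> H) c))"
proof -
  have "energy D UNIV (restr ({m..<n} \<times> H) c)
      = (\<Sum>b\<in>{m - d..<n}. D (shift b (restr ({m..<n} \<times> H) c)))" for c
  proof -
    have "energy D UNIV (restr ({m..<n} \<times> H) c) = energy D {m - d..<n} (restr ({m..<n} \<times> H) c)"
      by (intro energy_neutral hform_zero_vec[OF assms(1)]) (auto simp: restr_def)
    then show ?thesis by (simp add: energy_finite)
  qed
  moreover have "hform ({m..<n} \<times> H) (\<lambda>c. \<Sum>b\<in>{m - d..<n}. D (shift b (restr ({m..<n} \<times> H) c)))"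
    using assms by (intro hform_sum hform_shift_restr) auto
  ultimately show ?thesis by simp
qed

text \<open>Minimal energy of the past, given the future: the Schur complement of a nonnegative
  Toeplitz form.\<close>

lemma minimal_past_energy:
  assumes "finite H" "hform ({0..d} \<times> H) D" "\<And>c. fsupp c \<Longrightarrow> 0 \<le> energy D UNIV c"
  shows "\<exists>q. hform ({0..<d} \<times> H) q \<and> (\<forall>c. fsupp c \<longrightarrow> q c \<le> energy D {..<0} c)
    \<and> (\<forall>c. \<forall>\<epsilon>>0. fsupp c \<longrightarrow> (\<exists>e. fsupp e \<and> (\<forall>j\<ge>0. \<forall>x. e (j, x) = c (j, x))
          \<and> energy D {..<0} e \<le> q c + \<epsilon>))"
proof -
  define A where "A n = {- int n..<d} \<times> H" for n
  \<comment> \<open>The total energy is used because it is nonnegative by assumption, as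
    \<open>hform_infimum\<close> requires; the energy of the past alone need not be.\<close>
  define Q where "Q n c = energy D UNIV (restr (A n) c)" for n c
  have finA: "finite (A n)" for n using assms(1) by (simp add: A_def)
  have "hform (A n) (Q n)" for n
    unfolding Q_def A_def by (rule hform_energy_restr[OF assms(2,1)])
  moreover have "0 \<le> Q n c" for n c
    unfolding Q_def by (intro assms(3) fsupp_restr finA)
  moreover have "Q (Suc n) c = Q n c" if "\<And>i. i \<notin> A n \<Longrightarrow> c i = 0" for n c
  proof -
    have "restr (A (Suc n)) c = c" "restr (A n) c = c"
      using that by (auto simp: restr_def A_def fun_eq_iff)
    then show ?thesis by (simp add: Q_def)
  qed
  moreover have "A n \<subseteq> A (Suc n)" for n by (auto simp: A_def)
  ultimately obtain q where q: "hform (A 0) q" "\<And>n c. q c \<le> Q n c"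
    "\<And>c \<epsilon>. 0 < \<epsilon> \<Longrightarrow> \<exists>n e. (\<forall>i\<in>A 0. e i = c i) \<and> Q n e \<le> q c + \<epsilon>"
    using hform_infimum[of A Q, OF finA] by blast
  have A0: "A 0 = {0..<d} \<times> H" by (simp add: A_def)
  have split: "Q n c = energy D {..<0} (restr (A n) c) + tail_form d H D c" for n c
  proof -
    have "energy D {0..} (restr (A n) c) = energy D {0..} (restr (A 0) c)"
      by (intro energy_future_cong[OF assms(2)]) (auto simp: restr_def A_def)
    then show ?thesis
      unfolding Q_def using energy_split[OF assms(2) fsupp_restr[OF finA]] tail_form_energy[OF assms(2)]
      by (simp add: A0)
  qed
  \<comment> \<open>The future contributes a term that depends only on the coordinates held fixed,
    so subtracting it turns the infimum of the total energy into that of the past energy.\<close>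
  define q' where "q' c = q c - tail_form d H D c" for c
  have "hform ({0..<d} \<times> H) q'"
    unfolding q'_def using q(1) A0 by (intro hform_diff hform_tail_form assms) simp
  moreover have "q' c \<le> energy D {..<0} c" if "fsupp c" for c
  proof -
    have "finite (fst ` {i. c i \<noteq> 0})" using that by (simp add: fsupp_def)
    then obtain m where m: "\<And>j x. c (j, x) \<noteq> 0 \<Longrightarrow> m \<le> j"
      by (metis (mono_tags, lifting) Min_le fst_conv image_eqI mem_Collect_eq)
    have "energy D {..<0} (restr (A (nat (- m))) c) = energy D {..<0} c"
    proof (rule energy_past_cong[OF assms(2)])
      fix j x assume "j < d" "x \<in> H"
      then show "restr (A (nat (- m))) c (j, x) = c (j, x)"
        using m[of j x] by (cases "c (j, x) = 0") (auto simp: restr_def A_def)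
    qed
    then show ?thesis using q(2)[of c "nat (- m)"] split by (simp add: q'_def)
  qed
  moreover have "\<exists>e. fsupp e \<and> (\<forall>j\<ge>0. \<forall>x. e (j, x) = c (j, x)) \<and> energy D {..<0} e \<le> q' c + \<epsilon>"
    if eps: "0 < \<epsilon>" and "fsupp c" for c \<epsilon>
  proof -
    obtain n e where e: "\<forall>i\<in>A 0. e i = c i" "Q n e \<le> q c + \<epsilon>" using q(3)[OF eps] by blast
    define e2 where "e2 = (\<lambda>(j, x). if j < 0 then restr (A n) e (j, x) else c (j, x))"
    have "{i. e2 i \<noteq> 0} \<subseteq> {i. restr (A n) e i \<noteq> 0} \<union> {i. c i \<noteq> 0}"
      by (auto simp: e2_def split: if_splits)
    then have "fsupp e2"
      using fsupp_restr[OF finA, of n e] \<open>fsupp c\<close> unfolding fsupp_def by (meson finite_UnI finite_subset)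
    moreover have "energy D {..<0} e2 = energy D {..<0} (restr (A n) e)"
    proof (rule energy_past_cong[OF assms(2)])
      fix j x assume "j < d" "x \<in> H"
      then show "e2 (j, x) = restr (A n) e (j, x)"
        using e(1) by (auto simp: e2_def restr_def A_def)
    qed
    moreover have "tail_form d H D e = tail_form d H D c"
      using e(1) A0 by (intro hform_cong_vec[OF hform_tail_form[OF assms(2,1)]]) auto
    ultimately show ?thesis
      using e(2) split[of n e] by (intro exI[of _ e2]) (auto simp: q'_def e2_def)
  qed
  ultimately show ?thesis by blast
qed

section \<open>Outer forms, factorization and telescoping\<close>

definition outer :: "((int \<times> 'h \<Rightarrow> complex) \<Rightarrow> real) \<Rightarrow> bool" where
  "outer D \<longleftrightarrow> (\<forall>c. \<forall>\<epsilon>>0. fsupp c \<longrightarrow>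
     (\<exists>e. fsupp e \<and> (\<forall>j\<ge>0. \<forall>x. e (j, x) = c (j, x)) \<and> energy D {..<0} e \<le> \<epsilon>))"

text \<open>Fejer--Riesz: the sum of squares \<open>E\<close> is the squared modulus of the outer factor of the
  nonnegative trigonometric polynomial encoded by \<open>D\<close>.\<close>

lemma fejer_riesz:
  assumes "finite H" "hform ({0..d} \<times> H) D" "\<And>c. fsupp c \<Longrightarrow> 0 \<le> energy D UNIV c"
  shows "\<exists>E. hform ({0..d} \<times> H) E \<and> (\<forall>c. 0 \<le> E c) \<and> outer E
    \<and> (\<forall>c. fsupp c \<longrightarrow> energy E UNIV c = energy D UNIV c)"
proof -
  obtain q where q: "hform ({0..<d} \<times> H) q" "\<And>c. fsupp c \<Longrightarrow> q c \<le> energy D {..<0} c"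
    "\<And>c \<epsilon>. 0 < \<epsilon> \<Longrightarrow> fsupp c \<Longrightarrow> \<exists>e. fsupp e \<and> (\<forall>j\<ge>0. \<forall>x. e (j, x) = c (j, x))
          \<and> energy D {..<0} e \<le> q c + \<epsilon>"
    using minimal_past_energy[OF assms] by blast
  \<comment> \<open>The added difference telescopes: it does not change the energy over all integers
    and lowers the past energy of \<open>c\<close> by exactly \<open>q c\<close>, so the infimum
    becomes zero.\<close>
  define E where "E c = D c + (q c - q (shift 1 c))" for c
  have hq: "hform ({0..d} \<times> H) q"
    using assms(1) by (intro hform_mono[OF q(1)]) auto
  have hq1: "hform ({0..d} \<times> H) (\<lambda>c. q (shift 1 c))"
    by (rule hform_shift1[OF q(1) assms(1)])
  have hE: "hform ({0..d} \<times> H) E"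
    unfolding E_def by (intro hform_add hform_diff assms hq hq1)
  have E: "energy E B c = energy D B c + (energy q B c - energy q B (shift 1 c))" if "fsupp c" for B c
  proof -
    have "energy (\<lambda>c. q (shift 1 c)) B c = energy q B (shift 1 c)"
      by (simp add: energy_def add_ac)
    then show ?thesis
      unfolding E_def using that
      by (simp add: energy_add[OF assms(2) hform_diff[OF hq hq1]] energy_diff[OF hq hq1])
  qed
  have "0 \<le> E c" for c
  proof -
    have fs: "0 \<le> E c" if c: "fsupp c" for c
    proof (rule field_le_epsilon)
      fix \<epsilon> :: real assume "0 < \<epsilon>"
      obtain e where e: "fsupp e" "\<forall>j\<ge>0. \<forall>x. e (j, x) = c (j, x)" "energy D {..<0} e \<le> q c + \<epsilon>"
        using q(3)[OF \<open>0 < \<epsilon>\<close> c] by blast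
      have "q (shift 1 c) = q (shift 1 e)"
        using e(2) by (intro hform_cong_vec[OF q(1)]) auto
      \<comment> \<open>A nearly optimal past for \<open>c\<close> becomes, after the shift, a
        candidate past for \<open>shift 1 c\<close>, at the additional cost
        \<open>D c\<close>.\<close>
      also have "\<dots> \<le> energy D {..<0} (shift 1 e)" by (intro q(2) fsupp_shift e(1))
      also have "\<dots> = energy D {..<0} e + D e" by (rule energy_step(1)[OF assms(2) e(1)])
      also have "D e = D c" using e(2) by (intro hform_cong_vec[OF assms(2)]) auto
      finally show "0 \<le> E c + \<epsilon>" using e(3) by (simp add: E_def)
    qed
    have "E c = E (restr ({0..d} \<times> H) c)"
      by (intro hform_cong_vec[OF hE]) (auto simp: restr_def)
    then show ?thesis using fs[OF fsupp_restr] assms(1) by simp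
  qed
  moreover have "outer E"
    unfolding outer_def
  proof (intro allI impI)
    fix c :: "int \<times> 'a \<Rightarrow> complex" and \<epsilon> :: real
    assume "0 < \<epsilon>" "fsupp c"
    then obtain e where e: "fsupp e" "\<forall>j\<ge>0. \<forall>x. e (j, x) = c (j, x)" "energy D {..<0} e \<le> q c + \<epsilon>"
      using q(3) by blast
    have "q e = q c" using e(2) by (intro hform_cong_vec[OF q(1)]) auto
    then have "energy E {..<0} e \<le> \<epsilon>"
      using E[OF e(1)] energy_step(1)[OF hq e(1)] e(3) by simp
    then show "\<exists>e. fsupp e \<and> (\<forall>j\<ge>0. \<forall>x. e (j, x) = c (j, x)) \<and> energy E {..<0} e \<le> \<epsilon>"
      using e by blast
  qed
  moreover have "energy E UNIV c = energy D UNIV c" if "fsupp c" for c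
    using E[OF that] energy_step(3)[OF hq that] by simp
  ultimately show ?thesis using hE by blast
qed

text \<open>With total energy zero, the energy of the future is minus that of the past. The one sees
  only indices from 0 on, the other only indices below \<open>d\<close>, so the common value depends
  on \<open>{0..<d}\<close> alone and is the tail form. The second claim is then
  \<open>energy_step\<close>, applied to a truncation of \<open>c\<close> that no term
  notices.\<close>

lemma tail_form_telescope:
  assumes "finite H" "hform ({0..d} \<times> H) D" "\<And>c. fsupp c \<Longrightarrow> energy D UNIV c = 0"
  shows "fsupp c \<Longrightarrow> energy D {0..} c = tail_form d H D c"
    and "0 \<le> d \<Longrightarrow> D c = tail_form d H D c - tail_form d H D (shift 1 c)"
proof -
  have fs: "energy D {0..} c = tail_form d H D c" if c: "fsupp c" for c
  proof -
    define c' where "c' = restr ({..<d} \<times> H) c"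
    have c': "fsupp c'" unfolding c'_def by (rule fsupp_restr'[OF c])
    have "energy D {0..} c = - energy D {..<0} c"
      using assms(3)[OF c] energy_split[OF assms(2) c] by simp
    also have "energy D {..<0} c = energy D {..<0} c'"
      by (intro energy_past_cong[OF assms(2)]) (auto simp: c'_def restr_def)
    also have "- energy D {..<0} c' = energy D {0..} c'"
      using assms(3)[OF c'] energy_split[OF assms(2) c'] by simp
    also have "\<dots> = energy D {0..} (restr ({0..<d} \<times> H) c)"
      by (intro energy_future_cong[OF assms(2)]) (auto simp: c'_def restr_def)
    finally show ?thesis using tail_form_energy[OF assms(2)] by simp
  qed
  then show "fsupp c \<Longrightarrow> energy D {0..} c = tail_form d H D c" .
  assume "0 \<le> d"
  let ?c = "restr ({0..d} \<times> H) c"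
  have c: "fsupp ?c" using assms(1) by (intro fsupp_restr) auto
  have "D ?c = tail_form d H D ?c - tail_form d H D (shift 1 ?c)"
    using energy_step(2)[OF assms(2) c] fs[OF c] fs[OF fsupp_shift[OF c]] by simp
  moreover have "D ?c = D c"
    by (intro hform_cong_vec[OF assms(2)]) (auto simp: restr_def)
  moreover have "tail_form d H D ?c = tail_form d H D c"
    by (intro hform_cong_vec[OF hform_tail_form[OF assms(2,1)]]) (auto simp: restr_def)
  moreover have "tail_form d H D (shift 1 ?c) = tail_form d H D (shift 1 c)"
    by (intro hform_cong_vec[OF hform_tail_form[OF assms(2,1)]]) (auto simp: restr_def)
  ultimately show "D c = tail_form d H D c - tail_form d H D (shift 1 c)" by simp
qed

text \<open>The tail form is the energy of the future, hence minus the energy of the past of any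
  continuation to the left, and outerness makes the latter at most
  \<open>\<epsilon>\<close>.\<close>

lemma tail_form_nonneg:
  assumes "finite H" "hform ({0..d} \<times> H) D" "\<And>c. fsupp c \<Longrightarrow> energy D UNIV c = 0" "outer D"
  shows "0 \<le> tail_form d H D c"
proof (rule field_le_epsilon)
  fix \<epsilon> :: real assume "0 < \<epsilon>"
  let ?c = "restr ({0..<d} \<times> H) c"
  have "fsupp ?c" using assms(1) by (intro fsupp_restr) auto
  then obtain e where e: "fsupp e" "\<forall>j\<ge>0. \<forall>x. e (j, x) = ?c (j, x)" "energy D {..<0} e \<le> \<epsilon>"
    using assms(4) \<open>0 < \<epsilon>\<close> unfolding outer_def by blast
  have "tail_form d H D c = energy D {0..} ?c" by (rule tail_form_energy[OF assms(2)])
  also have "\<dots> = energy D {0..} e"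
    using e(2) by (intro energy_future_cong[OF assms(2)]) auto
  also have "\<dots> = - energy D {..<0} e"
    using assms(3)[OF e(1)] energy_split[OF assms(2) e(1)] by simp
  finally show "0 \<le> tail_form d H D c + \<epsilon>" using e(3) by simp
qed

section \<open>Positivity from plane waves\<close>

text \<open>At negative indices \<open>nat\<close> makes the wave constant, which is harmless
  because the forms evaluated on waves have windows starting at 0. Iterating with \<open>'h\<close>
  itself a product gives plane waves in two variables.\<close>

definition wave :: "complex \<Rightarrow> ('h \<Rightarrow> complex) \<Rightarrow> int \<times> 'h \<Rightarrow> complex" where
  "wave w v = (\<lambda>(j, x). w ^ nat j * v x)"

text \<open>Orthogonality of the characters of the cyclic group of order \<open>m\<close>; the bound
  on \<open>l\<close> excludes nonzero multiples of \<open>m\<close>.\<close>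

lemma sum_cis_multiples:
  fixes l :: int
  assumes "0 < m" "\<bar>l\<bar> < int m"
  shows "(\<Sum>s<m. cis (2 * pi * real s * of_int l / real m)) = (if l = 0 then of_nat m else 0)"
proof (cases "l = 0")
  case False
  define z where "z = cis (2 * pi * of_int l / real m)"
  have pow: "cis (2 * pi * real s * of_int l / real m) = z ^ s" for s
    unfolding z_def Complex.DeMoivre by (rule arg_cong[of _ _ cis]) simp
  have "z ^ m = cis (2 * pi * of_int l)"
    unfolding z_def Complex.DeMoivre using assms(1) by simp
  also have "\<dots> = 1" by (simp add: cis.ctr complex_eq_iff)
  finally have "z ^ m = 1" .
  have "z \<noteq> 1"
  proof
    assume "z = 1"
    then have "cos (2 * pi * of_int l / real m) = 1" by (simp add: z_def complex_eq_iff)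
    then obtain n :: int where "2 * pi * of_int l / real m = of_int n * 2 * pi"
      using cos_one_2pi_int by blast
    then have "real_of_int l = of_int n * real m"
      using assms(1) by (simp add: field_simps)
    then have "l = n * int m" by (metis of_int_eq_iff of_int_mult of_int_of_nat_eq)
    then have "int m dvd l" by simp
    then show False using assms False dvd_imp_le_int[of l "int m"] by simp
  qed
  then have "(\<Sum>s<m. z ^ s) = 0" using \<open>z ^ m = 1\<close> by (simp add: geometric_sum)
  then show ?thesis using False pow by simp
qed simp

text \<open>Parseval's identity for the discrete Fourier transform with \<open>m\<close> points. The
  indices in \<open>B\<close> are distinct modulo \<open>m\<close>, so this finite sum replaces the
  integral over the circle without error.\<close>

lemma hform_parseval:
  fixes B :: "int set" and v :: "int \<Rightarrow> 'i \<Rightarrow> complex"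
  assumes "hform I q" "0 < m" "finite B" "\<And>b b'. b \<in> B \<Longrightarrow> b' \<in> B \<Longrightarrow> \<bar>b - b'\<bar> < int m"
  shows "(\<Sum>s<m. q (\<lambda>i. \<Sum>b\<in>B. cis (- (2 * pi * real s * of_int b / real m)) * v b i)) = real m * (\<Sum>b\<in>B. q (v b))"
proof -
  obtain k where k: "\<And>c. complex_of_real (q c) = (\<Sum>i\<in>I. \<Sum>j\<in>I. cnj (c i) * k i j * c j)"
    using assms(1) unfolding hform_def by blast
  define e where "e b s = cis (- (2 * pi * real s * of_int b / real m))" for b :: int and s :: nat
  have orth: "(\<Sum>s<m. cnj (e b s) * e b' s) = (if b = b' then of_nat m else 0)" if "b \<in> B" "b' \<in> B" for b b'
  proof -
    have "cnj (e b s) * e b' s = cis (2 * pi * real s * of_int (b - b') / real m)" for s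
      unfolding e_def cis_cnj cis_mult by (simp add: diff_divide_distrib algebra_simps)
    then show ?thesis
      using sum_cis_multiples[OF assms(2) assms(4)[OF that]] by simp
  qed
  have "complex_of_real (\<Sum>s<m. q (\<lambda>i. \<Sum>b\<in>B. e b s * v b i))
      = (\<Sum>s<m. \<Sum>i\<in>I. \<Sum>j\<in>I. cnj (\<Sum>b\<in>B. e b s * v b i) * k i j * (\<Sum>b\<in>B. e b s * v b j))"
    by (simp only: of_real_sum k)
  also have "\<dots> = (\<Sum>s<m. \<Sum>i\<in>I. \<Sum>j\<in>I. \<Sum>b\<in>B. \<Sum>b'\<in>B.
      (cnj (e b s) * e b' s) * (cnj (v b i) * k i j * v b' j))"
    by (intro sum.cong refl) (simp add: cnj_sum sum_distrib_left sum_distrib_right mult_ac)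
  also have "\<dots> = (\<Sum>i\<in>I. \<Sum>j\<in>I. \<Sum>b\<in>B. \<Sum>b'\<in>B. \<Sum>s<m.
      (cnj (e b s) * e b' s) * (cnj (v b i) * k i j * v b' j))"
    by (simp only: sum.swap[of _ _ "{..<m}"])
  also have "\<dots> = (\<Sum>i\<in>I. \<Sum>j\<in>I. \<Sum>b\<in>B. \<Sum>b'\<in>B.
      (if b = b' then of_nat m else 0) * (cnj (v b i) * k i j * v b' j))"
    by (intro sum.cong refl) (simp only: sum_distrib_right[symmetric] orth)
  also have "\<dots> = (\<Sum>i\<in>I. \<Sum>j\<in>I. \<Sum>b\<in>B. of_nat m * (cnj (v b i) * k i j * v b j))"
    using assms(3) by (intro sum.cong refl) (simp add: if_distrib if_distribR cong: if_cong)
  also have "\<dots> = (\<Sum>b\<in>B. \<Sum>i\<in>I. \<Sum>j\<in>I. of_nat m * (cnj (v b i) * k i j * v b j))"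
    by (simp only: sum.swap[of _ _ B])
  also have "\<dots> = complex_of_real (real m * (\<Sum>b\<in>B. q (v b)))"
    by (simp only: of_real_mult of_real_sum k sum_distrib_left of_real_of_nat_eq)
  finally show ?thesis unfolding e_def by (simp only: of_real_eq_iff)
qed

text \<open>The transform at a root of unity \<open>w\<close> of the translates of \<open>c\<close> is a plane wave on the window
  seen by \<open>D\<close>.\<close>

lemma energy_nonneg_of_waves:
  assumes "hform ({0..d} \<times> H) D" "\<And>w v. cmod w = 1 \<Longrightarrow> 0 \<le> D (wave w v)" "fsupp c"
  shows "0 \<le> energy D UNIV c"
proof -
  have "finite ((\<lambda>i. \<bar>fst i\<bar>) ` {i. c i \<noteq> 0})" using assms(3) by (simp add: fsupp_def)
  then obtain n where n: "\<And>j x. c (j, x) \<noteq> 0 \<Longrightarrow> \<bar>j\<bar> \<le> n"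
    by (metis (mono_tags, lifting) Max_ge fst_conv image_eqI mem_Collect_eq)
  \<comment> \<open>Since \<open>c\<close> lives on indices of modulus at most \<open>n\<close>,
    only translates in \<open>B\<close> can bring it into the window, and \<open>m\<close> exceeds
    the diameter of \<open>B\<close> by one. A negative \<open>n\<close> occurs only for
    \<open>c = 0\<close> and is treated separately.\<close>
  define B where "B = {- n - \<bar>d\<bar>..n}"
  define m where "m = nat (2 * n + \<bar>d\<bar> + 1)"
  have en: "energy D UNIV c = (\<Sum>b\<in>B. D (shift b c))"
  proof -
    have "energy D UNIV c = energy D B c"
    proof (intro energy_neutral hform_zero_vec[OF assms(1)])
      fix b i assume "b \<in> UNIV - B" "i \<in> {0..d} \<times> H"
      then show "shift b c i = 0"
        using n[of "fst i + b" "snd i"] by (cases i) (force simp: B_def)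
    qed simp
    then show ?thesis by (simp add: energy_finite B_def)
  qed
  show ?thesis
  proof (cases "n < 0")
    case True
    then have "shift b c = (\<lambda>i. 0)" for b using n by (fastforce simp: shift_def)
    then show ?thesis using hform_zero_vec[OF assms(1)] en by simp
  next
    case False
    then have "0 < m" by (simp add: m_def)
    have width: "\<bar>b - b'\<bar> < int m" if "b \<in> B" "b' \<in> B" for b b'
      using that False by (auto simp: B_def m_def)
    have "real m * energy D UNIV c
        = (\<Sum>s<m. D (\<lambda>i. \<Sum>b\<in>B. cis (- (2 * pi * real s * of_int b / real m)) * shift b c i))"
      unfolding en by (rule hform_parseval[OF assms(1) \<open>0 < m\<close> _ width, symmetric]) (simp add: B_def)
    also have "\<dots> \<ge> 0"
    proof (rule sum_nonneg)
      fix s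
      define \<theta> where "\<theta> = 2 * pi * real s / real m"
      define v where "v x = (\<Sum>t\<in>{- n..n}. cis (- (\<theta> * of_int t)) * c (t, x))" for x
      have "(\<Sum>b\<in>B. cis (- (\<theta> * of_int b)) * shift b c (j, x)) = wave (cis \<theta>) v (j, x)"
        if j: "j \<in> {0..d}" for j x
      proof -
        have "(\<Sum>b\<in>B. cis (- (\<theta> * of_int b)) * shift b c (j, x))
            = (\<Sum>b\<in>{- n - j..n - j}. cis (- (\<theta> * of_int b)) * c (j + b, x))"
        proof (intro sum.mono_neutral_cong_right ballI)
          fix b assume "b \<in> B - {- n - j..n - j}"
          then have "\<not> \<bar>j + b\<bar> \<le> n" by auto
          then show "cis (- (\<theta> * of_int b)) * shift b c (j, x) = 0" using n[of "j + b" x] by auto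
        qed (use j in \<open>auto simp: B_def\<close>)
        also have "\<dots> = (\<Sum>t\<in>{- n..n}. cis (- (\<theta> * of_int (t - j))) * c (t, x))"
          by (rule sum.reindex_bij_witness[of _ "\<lambda>t. t - j" "\<lambda>b. b + j"]) (auto simp: add_ac)
        also have "\<dots> = (\<Sum>t\<in>{- n..n}. cis \<theta> ^ nat j * (cis (- (\<theta> * of_int t)) * c (t, x)))"
        proof (rule sum.cong[OF refl])
          fix t
          have "cis (- (\<theta> * of_int (t - j))) = cis \<theta> ^ nat j * cis (- (\<theta> * of_int t))"
            using j unfolding Complex.DeMoivre cis_mult by (simp add: algebra_simps)
          then show "cis (- (\<theta> * of_int (t - j))) * c (t, x) = cis \<theta> ^ nat j * (cis (- (\<theta> * of_int t)) * c (t, x))"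
            by simp
        qed
        finally show ?thesis by (simp add: wave_def v_def sum_distrib_left)
      qed
      then have "D (\<lambda>i. \<Sum>b\<in>B. cis (- (\<theta> * of_int b)) * shift b c i) = D (wave (cis \<theta>) v)"
        by (intro hform_cong_vec[OF assms(1)]) auto
      then have "0 \<le> D (\<lambda>i. \<Sum>b\<in>B. cis (- (\<theta> * of_int b)) * shift b c i)"
        using assms(2)[of "cis \<theta>" v] by simp
      then show "0 \<le> D (\<lambda>i. \<Sum>b\<in>B. cis (- (2 * pi * real s * of_int b / real m)) * shift b c i)"
        by (simp add: \<theta>_def)
    qed
    finally show ?thesis using \<open>0 < m\<close> by (simp add: zero_le_mult_iff)
  qed
qed

lemma energy_zero_of_waves:
  assumes "hform ({0..d} \<times> H) D" "\<And>w v. cmod w = 1 \<Longrightarrow> D (wave w v) = 0" "fsupp c"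
  shows "energy D UNIV c = 0"
  using energy_nonneg_of_waves[OF assms(1) _ assms(3)]
    energy_nonneg_of_waves[OF hform_uminus[OF assms(1)] _ assms(3)] assms(2)
  by (simp add: energy_uminus order.antisym)

section \<open>Polynomials without zeros in the disk are outer\<close>

text \<open>This is \<open>p\<close> evaluated at the translation
  \<open>u \<mapsto> (\<lambda>x. u (x + 1))\<close>. Hence products of polynomials become
  compositions (\<open>correl_mult\<close>), and the value at \<open>x\<close> depends only on
  \<open>u\<close> from \<open>x\<close> onwards.\<close>

definition correl :: "complex poly \<Rightarrow> (int \<Rightarrow> complex) \<Rightarrow> int \<Rightarrow> complex" where
  "correl p u x = (\<Sum>i\<le>degree p. coeff p i * u (x + int i))"

lemma correl_eq:
  assumes "degree p \<le> n"
  shows "correl p u x = (\<Sum>i\<le>n. coeff p i * u (x + int i))"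
  unfolding correl_def using assms by (intro sum.mono_neutral_left) (auto simp: coeff_eq_0)

lemma correl_add: "correl (p + q) u x = correl p u x + correl q u x"
proof -
  let ?n = "max (degree p) (degree q)"
  show ?thesis
    using correl_eq[of p ?n u x] correl_eq[of q ?n u x] correl_eq[of "p + q" ?n u x]
    by (simp add: degree_add_le sum.distrib algebra_simps)
qed

lemma correl_smult: "correl (Polynomial.smult a p) u x = a * correl p u x"
  using correl_eq[OF degree_smult_le, of a p u x]
  by (simp add: correl_def sum_distrib_left mult_ac)

lemma correl_pCons: "correl (pCons a p) u x = a * u x + correl p u (x + 1)"
proof -
  have "correl (pCons a p) u x = (\<Sum>i\<le>Suc (degree p). coeff (pCons a p) i * u (x + int i))"
    by (rule correl_eq) (simp add: degree_pCons_le)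
  also have "\<dots> = a * u x + correl p u (x + 1)"
    unfolding sum.atMost_Suc_shift correl_def by (simp add: algebra_simps)
  finally show ?thesis .
qed

lemma correl_0 [simp]: "correl 0 u x = 0"
  by (simp add: correl_def)

lemma correl_mult: "correl (p * q) u x = correl p (correl q u) x"
proof (induction p arbitrary: x)
  case (pCons a p)
  show ?case
    by (simp add: correl_add correl_smult correl_pCons pCons.IH)
qed simp

lemma correl_cong: "(\<And>y. x \<le> y \<Longrightarrow> u y = v y) \<Longrightarrow> correl p u x = correl p v x"
  unfolding correl_def by (intro sum.cong refl) auto

lemma fsupp_correl:
  assumes "fsupp u"
  shows "fsupp (correl p u)"
proof (induction p)
  case 0
  then show ?case by (simp add: fsupp_def)
next
  case (pCons a p)
  have "finite ((\<lambda>x. x - 1) ` {x. correl p u x \<noteq> 0})" "finite {x. u x \<noteq> 0}"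
    using pCons assms by (simp_all add: fsupp_def)
  moreover have "{x. correl (pCons a p) u x \<noteq> 0} \<subseteq> {x. u x \<noteq> 0} \<union> (\<lambda>x. x - 1) ` {x. correl p u x \<noteq> 0}"
    by (auto simp: correl_pCons image_iff) (metis add_diff_cancel)
  ultimately show ?case unfolding fsupp_def by (meson finite_UnI finite_subset)
qed

section \<open>Prescribing the past of a correlation\<close>

text \<open>Bounding all finite partial sums expresses a bound on the square sum without a
  summability condition.\<close>

definition past_le :: "(int \<Rightarrow> complex) \<Rightarrow> real \<Rightarrow> bool" where
  "past_le f \<epsilon> \<longleftrightarrow> (\<forall>A. finite A \<longrightarrow> A \<subseteq> {..<0} \<longrightarrow> (\<Sum>a\<in>A. (cmod (f a))\<^sup>2) \<le> \<epsilon>)"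

lemma cmod_add_power2_le: "(cmod (x + y))\<^sup>2 \<le> 2 * (cmod x)\<^sup>2 + 2 * (cmod y)\<^sup>2"
proof -
  have "(cmod (x + y))\<^sup>2 \<le> (cmod x + cmod y)\<^sup>2"
    by (intro power_mono norm_triangle_ineq) simp
  also have "\<dots> \<le> 2 * (cmod x)\<^sup>2 + 2 * (cmod y)\<^sup>2"
    using sum_squares_bound[of "cmod x" "cmod y"] by (simp add: power2_sum)
  finally show ?thesis .
qed

lemma past_le_add:
  assumes "past_le f a" "past_le g b"
  shows "past_le (\<lambda>x. f x + g x) (2 * a + 2 * b)"
  unfolding past_le_def
proof (intro allI impI)
  fix A :: "int set" assume A: "finite A" "A \<subseteq> {..<0}"
  have "(\<Sum>x\<in>A. (cmod (f x + g x))\<^sup>2) \<le> (\<Sum>x\<in>A. 2 * (cmod (f x))\<^sup>2 + 2 * (cmod (g x))\<^sup>2)"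
    by (intro sum_mono cmod_add_power2_le)
  also have "\<dots> = 2 * (\<Sum>x\<in>A. (cmod (f x))\<^sup>2) + 2 * (\<Sum>x\<in>A. (cmod (g x))\<^sup>2)"
    by (simp add: sum.distrib sum_distrib_left)
  also have "\<dots> \<le> 2 * a + 2 * b"
    using assms A unfolding past_le_def by (intro add_mono mult_left_mono) auto
  finally show "(\<Sum>x\<in>A. (cmod (f x + g x))\<^sup>2) \<le> 2 * a + 2 * b" .
qed

lemma past_le_scale:
  assumes "past_le f b"
  shows "past_le (\<lambda>x. a * f x) ((cmod a)\<^sup>2 * b)"
  unfolding past_le_def
proof (intro allI impI)
  fix A :: "int set" assume A: "finite A" "A \<subseteq> {..<0}"
  have "(\<Sum>x\<in>A. (cmod (a * f x))\<^sup>2) = (cmod a)\<^sup>2 * (\<Sum>x\<in>A. (cmod (f x))\<^sup>2)"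
    by (simp add: norm_mult power_mult_distrib sum_distrib_left)
  also have "\<dots> \<le> (cmod a)\<^sup>2 * b"
    using assms A unfolding past_le_def by (intro mult_left_mono) auto
  finally show "(\<Sum>x\<in>A. (cmod (a * f x))\<^sup>2) \<le> (cmod a)\<^sup>2 * b" .
qed

text \<open>The translation brings index 0 into the past, which costs nothing because
  \<open>f\<close> vanishes there.\<close>

lemma past_le_shift:
  assumes "past_le f b" "f 0 = 0"
  shows "past_le (\<lambda>x. f (x + 1)) b"
  unfolding past_le_def
proof (intro allI impI)
  fix A :: "int set" assume A: "finite A" "A \<subseteq> {..<0}"
  have "(\<Sum>x\<in>A. (cmod (f (x + 1)))\<^sup>2) = (\<Sum>x\<in>(\<lambda>x. x + 1) ` A. (cmod (f x))\<^sup>2)"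
    by (subst sum.reindex) (auto simp: inj_on_def)
  also have "\<dots> = (\<Sum>x\<in>(\<lambda>x. x + 1) ` A - {0}. (cmod (f x))\<^sup>2)"
    using A assms(2) by (intro sum.mono_neutral_right) auto
  also have "\<dots> \<le> b"
    using A assms(1) unfolding past_le_def by (auto elim!: allE[where x = "(\<lambda>x. x + 1) ` A - {0}"])
  finally show "(\<Sum>x\<in>A. (cmod (f (x + 1)))\<^sup>2) \<le> b" .
qed

text \<open>After an exact backward solution on the support of \<open>w\<close>, the solution is damped linearly to
  zero over \<open>m\<close> steps, which costs at most \<open>O(1/m)\<close> in the squared norm.\<close>

lemma outer_linear:
  assumes "1 \<le> cmod a" "fsupp u" "fsupp w" "0 < \<epsilon>"
  shows "\<exists>u'. fsupp u' \<and> (\<forall>x\<ge>0. u' x = u x) \<and> past_le (\<lambda>x. correl [:- a, 1:] u' x - w x) \<epsilon>"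
proof -
  have a: "a \<noteq> 0" using assms(1) by auto
  have cl: "correl [:- a, 1:] v x = v (x + 1) - a * v x" for v x
    by (simp add: correl_pCons)
  have ex: "\<exists>v. fsupp v \<and> (\<forall>x\<ge>0. v x = u x) \<and> (\<forall>x. - int n \<le> x \<and> x < 0 \<longrightarrow> v (x + 1) - a * v x = w x)" for n
  proof (induction n)
    case 0
    then show ?case using assms(2) by auto
  next
    case (Suc n)
    then obtain v where v: "fsupp v" "\<forall>x\<ge>0. v x = u x"
      "\<forall>x. - int n \<le> x \<and> x < 0 \<longrightarrow> v (x + 1) - a * v x = w x" by blast
    define v' where "v' = v(- int (Suc n) := (v (- int n) - w (- int (Suc n))) / a)"
    have "{x. v' x \<noteq> 0} \<subseteq> insert (- int (Suc n)) {x. v x \<noteq> 0}" by (auto simp: v'_def)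
    then have "fsupp v'" using v(1) unfolding fsupp_def by (meson finite_insert finite_subset)
    moreover have "v' (x + 1) - a * v' x = w x" if "- int (Suc n) \<le> x" "x < 0" for x
    proof (cases "x = - int (Suc n)")
      case True
      then show ?thesis using a by (simp add: v'_def)
    next
      case False
      then have "x \<noteq> - int (Suc n)" "x + 1 \<noteq> - int (Suc n)" "- int n \<le> x" using that by auto
      then show ?thesis using v(3) that by (simp add: v'_def)
    qed
    moreover have "\<forall>x\<ge>0. v' x = u x" using v(2) by (auto simp: v'_def)
    ultimately show ?case by blast
  qed
  have "finite (uminus ` {x. w x \<noteq> 0})" using assms(3) by (simp add: fsupp_def)
  then obtain n0 where n0: "\<And>x. w x \<noteq> 0 \<Longrightarrow> - x \<le> n0"
    by (metis (mono_tags, lifting) Max_ge image_eqI mem_Collect_eq)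
  define n where "n = nat n0"
  have wz: "w x = 0" if "x < - int n" for x using n0[of x] that by (cases "w x = 0") (auto simp: n_def split: if_splits)
  obtain v where v: "fsupp v" "\<forall>x\<ge>0. v x = u x"
    "\<forall>x. - int n \<le> x \<and> x < 0 \<longrightarrow> v (x + 1) - a * v x = w x" using ex by blast
  define \<beta> where "\<beta> = v (- int n)"
  \<comment> \<open>Each of the \<open>m\<close> damped steps will leave a residual of modulus at
    most \<open>cmod \<beta> / m\<close>, so the squares add up to at most
    \<open>(cmod \<beta>)\<^sup>2 / m\<close>.\<close>
  obtain m0 :: nat where m0: "(cmod \<beta>)\<^sup>2 / \<epsilon> < real m0" using reals_Archimedean2 by blast
  define m where "m = Suc m0"
  have m: "(cmod \<beta>)\<^sup>2 / real m \<le> \<epsilon>"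
  proof -
    have "(cmod \<beta>)\<^sup>2 < real m0 * \<epsilon>" using m0 assms(4) by (simp add: field_simps)
    also have "\<dots> \<le> real m * \<epsilon>" using assms(4) by (simp add: m_def)
    finally show ?thesis using assms(4) by (simp add: m_def field_simps)
  qed
  \<comment> \<open>The powers of \<open>1 / a\<close> solve the homogeneous equation and stay
    bounded. They do not decay if \<open>cmod a = 1\<close>, hence the linear ramp down to zero at
    \<open>k = m\<close>.\<close>
  define g where "g k = \<beta> * (1 / a) ^ k * complex_of_real (1 - real k / real m)" for k
  define u' where "u' x = (if - int n \<le> x then v x else if - int n - int m \<le> x then g (nat (- int n - x)) else 0)" for x
  have gm: "g m = 0" by (simp add: g_def m_def)
  have g0: "g 0 = v (- int n)" by (simp add: g_def \<beta>_def)
  have "{x. u' x \<noteq> 0} \<subseteq> {x. v x \<noteq> 0} \<union> {- int n - int m..- int n}"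
    by (auto simp: u'_def split: if_splits)
  then have fs: "fsupp u'" using v(1) unfolding fsupp_def by (meson finite_UnI finite_subset finite_atLeastAtMost_int)
  have res0: "correl [:- a, 1:] u' x - w x = 0" if "x < - int n - int m \<or> - int n \<le> x" "x < 0" for x
  proof (cases "- int n \<le> x")
    case True
    then show ?thesis using v(3) that by (simp add: cl u'_def)
  next
    case False
    then have x: "x < - int n - int m" using that by auto
    have "u' x = 0" using x by (simp add: u'_def)
    moreover have "u' (x + 1) = 0"
    proof (cases "x + 1 = - int n - int m")
      case True
      have "0 < m" by (simp add: m_def)
      then have "u' (x + 1) = g m" unfolding True by (simp add: u'_def)
      then show ?thesis using gm by simp
    next
      case False
      then have "x + 1 < - int n - int m" using x by linarith
      then show ?thesis by (simp add: u'_def)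
    qed
    ultimately show ?thesis using wz[of x] x by (simp add: cl)
  qed
  have res: "cmod (correl [:- a, 1:] u' x - w x) \<le> cmod \<beta> / real m" if x: "- int n - int m \<le> x" "x < - int n" for x
  proof -
    define k where "k = nat (- int n - x - 1)"
    have k: "x = - int n - int (Suc k)" "Suc k \<le> m" using x by (auto simp: k_def)
    have "u' x = g (Suc k)" using x k by (auto simp: u'_def nat_add_distrib)
    moreover have "u' (x + 1) = g k"
    proof (cases k)
      case 0
      then show ?thesis using k g0 by (simp add: u'_def)
    next
      case (Suc k')
      then show ?thesis using k by (simp add: u'_def nat_add_distrib)
    qed
    moreover have "w x = 0" using wz x by simp
    ultimately have "correl [:- a, 1:] u' x - w x = g k - a * g (Suc k)" by (simp add: cl)
    also have "\<dots> = \<beta> * (1 / a) ^ k * complex_of_real (1 / real m)"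
    proof -
      have "a * g (Suc k) = \<beta> * (1 / a) ^ k * complex_of_real (1 - real (Suc k) / real m)"
        using a by (simp add: g_def)
      moreover have "1 - real k / real m - (1 - real (Suc k) / real m) = 1 / real m"
        by (simp add: m_def field_simps)
      ultimately show ?thesis
        unfolding g_def by (metis of_real_diff right_diff_distrib)
    qed
    also have "cmod \<dots> \<le> cmod \<beta> * 1 * (1 / real m)"
    proof -
      have "cmod ((1 / a) ^ k) \<le> 1"
        using assms(1) unfolding norm_power norm_divide by (intro power_le_one) (auto simp: divide_le_eq)
      then show ?thesis
        unfolding norm_mult norm_of_real by (intro mult_mono) auto
    qed
    finally show ?thesis by simp
  qed
  have "past_le (\<lambda>x. correl [:- a, 1:] u' x - w x) \<epsilon>"
    unfolding past_le_def
  proof (intro allI impI)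
    fix A :: "int set" assume A: "finite A" "A \<subseteq> {..<0}"
    let ?I = "{- int n - int m..<- int n}"
    have "(\<Sum>x\<in>A. (cmod (correl [:- a, 1:] u' x - w x))\<^sup>2) = (\<Sum>x\<in>A \<inter> ?I. (cmod (correl [:- a, 1:] u' x - w x))\<^sup>2)"
    proof (intro sum.mono_neutral_right ballI)
      fix i assume "i \<in> A - A \<inter> ?I"
      then have "i < - int n - int m \<or> - int n \<le> i" "i < 0" using A by auto
      then show "(cmod (correl [:- a, 1:] u' i - w i))\<^sup>2 = 0" by (simp only: res0) simp
    qed (use A in auto)
    also have "\<dots> \<le> (\<Sum>x\<in>A \<inter> ?I. (cmod \<beta> / real m)\<^sup>2)"
      by (intro sum_mono power_mono res) auto
    also have "\<dots> \<le> (\<Sum>x\<in>?I. (cmod \<beta> / real m)\<^sup>2)"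
      by (intro sum_mono2) auto
    also have "\<dots> = (cmod \<beta>)\<^sup>2 / real m"
      by (simp add: m_def power_divide power2_eq_square)
    finally show "(\<Sum>x\<in>A. (cmod (correl [:- a, 1:] u' x - w x))\<^sup>2) \<le> \<epsilon>" using m by simp
  qed
  moreover have "\<forall>x\<ge>0. u' x = u x" using v(2) by (auto simp: u'_def)
  ultimately show ?thesis using fs by blast
qed

text \<open>Induction on the degree, splitting off a root \<open>a\<close>, which satisfies
  \<open>1 \<le> cmod a\<close>. The linear factor is treated first and yields an intermediate
  sequence \<open>v'\<close>; the cofactor is then asked to produce \<open>v'\<close>. This is why
  the statement allows a target \<open>w\<close> other than zero.\<close>

lemma outer_poly:
  assumes "\<And>x. cmod x < 1 \<Longrightarrow> poly p x \<noteq> 0" "fsupp u" "fsupp w" "0 < \<epsilon>"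
  shows "\<exists>u'. fsupp u' \<and> (\<forall>x\<ge>0. u' x = u x) \<and> past_le (\<lambda>x. correl p u' x - w x) \<epsilon>"
  using assms
proof (induction "degree p" arbitrary: p u w \<epsilon> rule: less_induct)
  case less
  show ?case
  proof (cases "degree p = 0")
    case True
    then obtain c where c: "p = [:c:]" by (metis degree_eq_zeroE)
    have "c \<noteq> 0" using less.prems(1)[of 0] c by simp
    define u' where "u' x = (if x \<ge> 0 then u x else w x / c)" for x :: int
    have "{x. u' x \<noteq> 0} \<subseteq> {x. u x \<noteq> 0} \<union> {x. w x \<noteq> 0}" by (auto simp: u'_def split: if_splits)
    then have "fsupp u'" using less.prems(2,3) unfolding fsupp_def by (meson finite_UnI finite_subset)
    moreover have "past_le (\<lambda>x. correl p u' x - w x) \<epsilon>"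
      unfolding past_le_def
    proof (intro allI impI)
      fix A :: "int set" assume "finite A" "A \<subseteq> {..<0}"
      then have "(\<Sum>x\<in>A. (cmod (correl p u' x - w x))\<^sup>2) = 0"
        using \<open>c \<noteq> 0\<close> by (intro sum.neutral) (auto simp: c correl_pCons u'_def)
      then show "(\<Sum>x\<in>A. (cmod (correl p u' x - w x))\<^sup>2) \<le> \<epsilon>" using less.prems(4) by simp
    qed
    ultimately show ?thesis by (intro exI[of _ u']) (auto simp: u'_def)
  next
    case False
    then obtain a where a: "poly p a = 0"
      using Fundamental_Theorem_Algebra.fundamental_theorem_of_algebra[of p] by (metis Fundamental_Theorem_Algebra.constant_degree)
    have "1 \<le> cmod a" using less.prems(1)[of a] a by force
    obtain p' where p': "p = [:- a, 1:] * p'" using a by (metis poly_eq_0_iff_dvd dvdE)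
    have "p' \<noteq> 0" using less.prems(1)[of 0] p' by auto
    then have deg: "degree p' < degree p" unfolding p' by (subst degree_mult_eq) auto
    have nz: "\<And>x. cmod x < 1 \<Longrightarrow> poly p' x \<noteq> 0" using less.prems(1) p' by auto
    obtain v' where v': "fsupp v'" "\<forall>x\<ge>0. v' x = correl p' u x"
      "past_le (\<lambda>x. correl [:- a, 1:] v' x - w x) (\<epsilon> / 4)"
      using outer_linear[OF \<open>1 \<le> cmod a\<close> fsupp_correl[OF less.prems(2)] less.prems(3), of "\<epsilon> / 4"] less.prems(4)
      by auto
    \<comment> \<open>The linear factor turns an error \<open>\<delta>\<close> into at most
      \<open>2 * (1 + (cmod a)\<^sup>2) * \<delta>\<close>; adding the error of the first stage
      doubles both, and with this choice each contributes \<open>\<epsilon> / 2\<close>.\<close>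
    define \<delta> where "\<delta> = \<epsilon> / (8 * (1 + (cmod a)\<^sup>2))"
    have pos: "0 < 1 + (cmod a)\<^sup>2" by (simp add: add_pos_nonneg)
    then have "0 < \<delta>" using less.prems(4) by (simp add: \<delta>_def)
    obtain u' where u': "fsupp u'" "\<forall>x\<ge>0. u' x = u x" "past_le (\<lambda>x. correl p' u' x - v' x) \<delta>"
      using less.hyps[OF deg nz less.prems(2) v'(1) \<open>0 < \<delta>\<close>] by blast
    define f where "f x = correl p' u' x - v' x" for x
    \<comment> \<open>The value at 0 uses only nonnegative indices, where \<open>u'\<close> and
      \<open>u\<close> agree; so the error vanishes at 0 and can be shifted.\<close>
    have "correl p' u' 0 = correl p' u 0" using u'(2) by (intro correl_cong) auto
    then have f0: "f 0 = 0" using v'(2) by (simp add: f_def)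
    have "(\<lambda>x. correl p u' x - w x) = (\<lambda>x. (f (x + 1) + (- a) * f x) + (correl [:- a, 1:] v' x - w x))"
      unfolding fun_eq_iff p' correl_mult by (simp add: correl_pCons f_def algebra_simps)
    moreover have "past_le (\<lambda>x. f (x + 1) + (- a) * f x) (2 * \<delta> + 2 * ((cmod (- a))\<^sup>2 * \<delta>))"
      using u'(3) f0 unfolding f_def[symmetric] by (intro past_le_add past_le_shift past_le_scale)
    ultimately have "past_le (\<lambda>x. correl p u' x - w x) (2 * (2 * \<delta> + 2 * ((cmod (- a))\<^sup>2 * \<delta>)) + 2 * (\<epsilon> / 4))"
      by (simp only:) (rule past_le_add[OF _ v'(3)])
    moreover have "2 * (2 * \<delta> + 2 * ((cmod (- a))\<^sup>2 * \<delta>)) + 2 * (\<epsilon> / 4) = \<epsilon>"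
    proof -
      have "2 * (2 * \<delta> + 2 * ((cmod (- a))\<^sup>2 * \<delta>)) = 4 * ((1 + (cmod a)\<^sup>2) * \<delta>)"
        by (simp add: algebra_simps)
      also have "(1 + (cmod a)\<^sup>2) * \<delta> = \<epsilon> / 8"
        using pos by (simp add: \<delta>_def divide_simps)
      finally show ?thesis by simp
    qed
    ultimately show ?thesis using u'(1,2) by auto
  qed
qed

section \<open>Linear forms, and a density argument on the circle\<close>

definition lform :: "'i set \<Rightarrow> (('i \<Rightarrow> complex) \<Rightarrow> complex) \<Rightarrow> bool" where
  "lform I L \<longleftrightarrow> (\<exists>f. \<forall>c. L c = (\<Sum>i\<in>I. f i * c i))"

lemma lform_coord:
  assumes "finite I" "i \<in> I"
  shows "lform I (\<lambda>c. c i)"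
  unfolding lform_def
proof (intro exI allI)
  fix c :: "'a \<Rightarrow> complex"
  have "(\<Sum>j\<in>I. of_bool (j = i) * c j) = (\<Sum>j\<in>I. if j = i then c j else 0)"
    by (intro sum.cong refl) auto
  then show "c i = (\<Sum>j\<in>I. of_bool (j = i) * c j)" using assms by simp
qed

lemma lform_scale:
  assumes "lform I L"
  shows "lform I (\<lambda>c. a * L c)"
proof -
  obtain f where "\<forall>c. L c = (\<Sum>i\<in>I. f i * c i)" using assms lform_def by blast
  then show ?thesis
    unfolding lform_def by (intro exI[of _ "\<lambda>i. a * f i"]) (simp add: sum_distrib_left mult.assoc)
qed

lemma lform_add:
  assumes "lform I L" "lform I L'"
  shows "lform I (\<lambda>c. L c + L' c)"
proof -
  obtain f f' where "\<forall>c. L c = (\<Sum>i\<in>I. f i * c i)" "\<forall>c. L' c = (\<Sum>i\<in>I. f' i * c i)"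
    using assms lform_def by metis
  then show ?thesis
    unfolding lform_def by (intro exI[of _ "\<lambda>i. f i + f' i"]) (simp add: sum.distrib distrib_right)
qed

lemma lform_zero: "lform I (\<lambda>c. 0)"
  unfolding lform_def by (intro exI[of _ "\<lambda>i. 0"]) simp

lemma lform_sum:
  assumes "\<And>s. s \<in> S \<Longrightarrow> lform I (L s)"
  shows "lform I (\<lambda>c. \<Sum>s\<in>S. L s c)"
  using assms by (induction S rule: infinite_finite_induct) (auto intro: lform_add lform_zero)

lemma hform_cmod_lform: "lform I L \<Longrightarrow> hform I (\<lambda>c. (cmod (L c))\<^sup>2)"
  unfolding lform_def using hform_norm2 by auto

lemma fsupp_lform_shift:
  assumes "lform ({m..n} \<times> H) L" "fsupp c"
  shows "fsupp (\<lambda>b. L (shift b c))"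
  using finite_shift_nonzero[OF hform_cmod_lform[OF assms(1)] assms(2)] by (simp add: fsupp_def)

lemma energy_past_le:
  fixes N :: nat
  assumes "\<And>k. k < N \<Longrightarrow> lform ({m..n} \<times> H) (L k)" "fsupp c"
    and "\<And>k. k < N \<Longrightarrow> past_le (\<lambda>b. L k (shift b c)) \<epsilon>"
  shows "energy (\<lambda>c. \<Sum>k<N. (cmod (L k c))\<^sup>2) {..<0} c \<le> real N * \<epsilon>"
proof -
  have "hform ({m..n} \<times> H) (\<lambda>c. \<Sum>k<N. (cmod (L k c))\<^sup>2)"
    using assms(1) by (intro hform_sum hform_cmod_lform) auto
  then have "(\<lambda>b. \<Sum>k<N. (cmod (L k (shift b c)))\<^sup>2) summable_on {..<0}"
    using energy_summable[OF _ assms(2)] by blast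
  then show ?thesis
    unfolding energy_def
  proof (rule infsum_le_finite_sums)
    fix A :: "int set" assume A: "finite A" "A \<subseteq> {..<0}"
    have "(\<Sum>b\<in>A. \<Sum>k<N. (cmod (L k (shift b c)))\<^sup>2) = (\<Sum>k<N. \<Sum>b\<in>A. (cmod (L k (shift b c)))\<^sup>2)"
      by (rule sum.swap)
    also have "\<dots> \<le> (\<Sum>k<N. \<epsilon>)"
      using assms(3) A unfolding past_le_def by (intro sum_mono) auto
    finally show "(\<Sum>b\<in>A. \<Sum>k<N. (cmod (L k (shift b c)))\<^sup>2) \<le> real N * \<epsilon>" by simp
  qed
qed

text \<open>The circle is connected and not a single point, so it has no isolated points and stays
  dense in itself after removal of a finite set; continuity does the rest.\<close>

lemma sphere_finite_exception:
  fixes f :: "complex \<Rightarrow> real"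
  assumes "finite Z" "continuous_on UNIV f" "\<And>z. cmod z = 1 \<Longrightarrow> z \<notin> Z \<Longrightarrow> 0 \<le> f z" "cmod z = 1"
  shows "0 \<le> f z"
proof -
  let ?S = "sphere (0 :: complex) 1"
  have "connected ?S" by (intro connected_sphere) simp
  moreover have "\<not> (\<exists>a. ?S = {a})"
  proof
    assume "\<exists>a. ?S = {a}"
    then obtain a where a: "?S = {a}" by blast
    have "1 \<in> ?S" "- 1 \<in> ?S" by simp_all
    then have "(1::complex) = a" "- 1 = a" unfolding a by simp_all
    then show False by simp
  qed
  moreover have "z \<in> ?S" using assms(4) by simp
  ultimately have "z islimpt ?S" using connected_imp_perfect by blast
  then have "z islimpt (Z \<union> (?S - Z))" by (rule islimpt_subset) auto
  then have "z islimpt (?S - Z)" using islimpt_Un_finite[OF assms(1)] by blast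
  then have cl: "z \<in> closure (?S - Z)" by (simp add: closure_def)
  show ?thesis
    by (rule continuous_ge_on_closure[OF continuous_on_subset[OF assms(2)] cl]) (use assms(3) in auto)
qed

section \<open>The decomposition on the bidisk\<close>

lemma correl_monom: "correl (monom a n) u x = a * u (x + int n)"
proof (induction n arbitrary: x)
  case 0
  then show ?case by (simp add: monom_0 correl_pCons)
next
  case (Suc n)
  then show ?case by (simp add: monom_Suc correl_pCons add_ac)
qed

lemma correl_sum: "correl (\<Sum>s\<in>S. p s) u x = (\<Sum>s\<in>S. correl (p s) u x)"
  by (induction S rule: infinite_finite_induct) (auto simp: correl_add)

text \<open>Translation in the exponent of \<open>z1\<close>, the counterpart of
  \<open>shift 1\<close> for \<open>z2\<close>. On plane waves, at nonnegative exponents, it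
  multiplies by \<open>z1\<close>.\<close>

definition lift_shift :: "(int \<times> int \<times> 'h \<Rightarrow> complex) \<Rightarrow> int \<times> int \<times> 'h \<Rightarrow> complex" where
  "lift_shift c = (\<lambda>(j, i, k). c (j, i + 1, k))"

lemma lift_shift_apply [simp]: "lift_shift c (j, i, k) = c (j, i + 1, k)"
  by (simp add: lift_shift_def)

lemma shift_lift_shift: "shift b (lift_shift c) = lift_shift (shift b c)"
  by (auto simp: shift_def lift_shift_def)

lemma lift_shift_wave: "lift_shift (wave w u) = wave w (shift 1 u)"
  by (auto simp: wave_def lift_shift_def)

lemma fsupp_lift_shift: "fsupp c \<Longrightarrow> fsupp (lift_shift c)"
proof -
  assume "fsupp c"
  have "{i. lift_shift c i \<noteq> 0} \<subseteq> (\<lambda>(j, i, k). (j, i - 1, k)) ` {i. c i \<noteq> 0}"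
    by (force simp: lift_shift_def image_iff)
  then show ?thesis
    using \<open>fsupp c\<close> unfolding fsupp_def by (meson finite_imageI finite_subset)
qed

text \<open>The index \<open>(j, i, k)\<close> stands for the coefficient of \<open>z2 ^ j * z1 ^ i\<close> in the \<open>k\<close>-th
  component; \<open>pc i j\<close> and \<open>qc l k i j\<close> are the coefficients of the denominator and of the
  \<open>(l, k)\<close> entry of the numerator.\<close>

locale torus_isometry =
  fixes M N d1 d2 :: nat and pc :: "nat \<Rightarrow> nat \<Rightarrow> complex" and qc :: "nat \<Rightarrow> nat \<Rightarrow> nat \<Rightarrow> nat \<Rightarrow> complex"
  assumes isometry: "\<And>z w v. cmod z = 1 \<Longrightarrow> cmod w = 1 \<Longrightarrow>
      (\<Sum>l<M. (cmod (\<Sum>k<N. (\<Sum>j\<le>d2. \<Sum>i\<le>d1. qc l k i j * z ^ i * w ^ j) * v k))\<^sup>2)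
      = (cmod (\<Sum>j\<le>d2. \<Sum>i\<le>d1. pc i j * z ^ i * w ^ j))\<^sup>2 * (\<Sum>k<N. (cmod (v k))\<^sup>2)"
    and stable_slice: "\<exists>Z. finite Z \<and> (\<forall>w z. cmod w = 1 \<longrightarrow> w \<notin> Z \<longrightarrow> cmod z < 1 \<longrightarrow>
      (\<Sum>i\<le>d1. (\<Sum>j\<le>d2. pc i j * w ^ j) * z ^ i) \<noteq> 0)"
    and stable_zero: "\<And>w. cmod w < 1 \<Longrightarrow> (\<Sum>j\<le>d2. pc 0 j * w ^ j) \<noteq> 0"
begin

section \<open>Slices with the second variable on the circle\<close>

definition Pf :: "(int \<times> int \<times> nat \<Rightarrow> complex) \<Rightarrow> nat \<Rightarrow> complex" where
  "Pf c k = (\<Sum>j\<le>d2. \<Sum>i\<le>d1. pc i j * c (int j, int i, k))"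

definition Qf :: "(int \<times> int \<times> nat \<Rightarrow> complex) \<Rightarrow> nat \<Rightarrow> complex" where
  "Qf c l = (\<Sum>k<N. \<Sum>j\<le>d2. \<Sum>i\<le>d1. qc l k i j * c (int j, int i, k))"

text \<open>The form of the kernel on the left of Kummert's identity. It is indefinite in general,
  but vanishes on plane waves with frequencies on the torus (\<open>D_wave_wave\<close>).\<close>

definition D :: "(int \<times> int \<times> nat \<Rightarrow> complex) \<Rightarrow> real" where
  "D c = (\<Sum>k<N. (cmod (Pf c k))\<^sup>2) - (\<Sum>l<M. (cmod (Qf c l))\<^sup>2)"

abbreviation "W \<equiv> {0..int d1} \<times> {..<N}"
abbreviation "W' \<equiv> {0..<int d1} \<times> {..<N}"

lemma finite_windows: "finite W" "finite W'"
  by simp_all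

lemma lform_Pf: "k < N \<Longrightarrow> lform ({0..int d2} \<times> W) (\<lambda>c. Pf c k)"
  unfolding Pf_def by (intro lform_sum lform_scale lform_coord) auto

lemma hform_D: "hform ({0..int d2} \<times> W) D"
proof -
  have "hform ({0..int d2} \<times> W) (\<lambda>c. (\<Sum>k<N. (cmod (Pf c k))\<^sup>2) - (\<Sum>l<M. (cmod (Qf c l))\<^sup>2))"
    by (intro hform_diff hform_sum hform_cmod_lform lform_Pf)
      (auto simp: Qf_def intro!: lform_sum lform_scale lform_coord)
  then show ?thesis by (simp add: D_def[abs_def])
qed

lemma hform_D_wave: "hform W (\<lambda>u. D (wave w u))"
proof -
  have "hform W (\<lambda>u. (\<Sum>k<N. (cmod (Pf (wave w u) k))\<^sup>2) - (\<Sum>l<M. (cmod (Qf (wave w u) l))\<^sup>2))"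
    by (intro hform_diff hform_sum hform_cmod_lform)
      (auto simp: Pf_def Qf_def wave_def intro!: lform_sum lform_scale lform_coord)
  then show ?thesis by (simp add: D_def)
qed

lemma D_wave_wave:
  assumes "cmod w = 1" "cmod z = 1"
  shows "D (wave w (wave z v)) = 0"
proof -
  let ?p = "\<Sum>j\<le>d2. \<Sum>i\<le>d1. pc i j * z ^ i * w ^ j"
  have "Pf (wave w (wave z v)) k = ?p * v k" for k
    by (simp add: Pf_def wave_def sum_distrib_left sum_distrib_right mult_ac)
  moreover have "Qf (wave w (wave z v)) l = (\<Sum>k<N. (\<Sum>j\<le>d2. \<Sum>i\<le>d1. qc l k i j * z ^ i * w ^ j) * v k)" for l
    by (simp add: Qf_def wave_def sum_distrib_left sum_distrib_right mult_ac)
  ultimately show ?thesis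
    using isometry[OF assms(2,1), of v]
    by (simp add: D_def norm_mult power_mult_distrib sum_distrib_left)
qed

lemma energy_D_wave:
  assumes "cmod w = 1" "fsupp u"
  shows "energy (\<lambda>u. D (wave w u)) UNIV u = 0"
  using energy_zero_of_waves[OF hform_D_wave _ assms(2)] D_wave_wave[OF assms(1)] by simp

text \<open>The squares of \<open>Qf\<close> enter with a minus sign, so it suffices to make the
  \<open>Pf\<close> part small. That part acts on each component separately as correlation with the
  zero-free polynomial \<open>p(., w)\<close>, and \<open>outer_poly\<close> applies with target
  zero.\<close>

lemma outer_D_wave:
  assumes "\<And>z. cmod z < 1 \<Longrightarrow> (\<Sum>i\<le>d1. (\<Sum>j\<le>d2. pc i j * w ^ j) * z ^ i) \<noteq> 0"
  shows "outer (\<lambda>u. D (wave w u))"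
  unfolding outer_def
proof (intro allI impI)
  fix u :: "int \<times> nat \<Rightarrow> complex" and \<epsilon> :: real
  assume "0 < \<epsilon>" and u: "fsupp u"
  define \<pi> where "\<pi> = (\<Sum>i\<le>d1. monom (\<Sum>j\<le>d2. pc i j * w ^ j) i)"
  have \<pi>: "poly \<pi> z \<noteq> 0" if "cmod z < 1" for z
    using assms[OF that] by (simp add: \<pi>_def poly_sum poly_monom)
  have corr: "correl \<pi> v x = (\<Sum>i\<le>d1. (\<Sum>j\<le>d2. pc i j * w ^ j) * v (x + int i))" for v x
    by (simp add: \<pi>_def correl_sum correl_monom)
  \<comment> \<open>The summand 1 keeps the denominator nonzero when \<open>N = 0\<close>.\<close>
  define \<delta> where "\<delta> = \<epsilon> / (real N + 1)"
  have "0 < \<delta>" using \<open>0 < \<epsilon>\<close> by (simp add: \<delta>_def)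
  have fsuppk: "fsupp (\<lambda>x. u (x, k))" for k
  proof -
    have "{x. u (x, k) \<noteq> 0} \<subseteq> fst ` {i. u i \<noteq> 0}" by force
    then show ?thesis using u unfolding fsupp_def by (meson finite_imageI finite_subset)
  qed
  have "\<forall>k. \<exists>u'. fsupp u' \<and> (\<forall>x\<ge>0. u' x = u (x, k)) \<and> past_le (\<lambda>x. correl \<pi> u' x) \<delta>"
    using outer_poly[OF \<pi> fsuppk _ \<open>0 < \<delta>\<close>, of "\<lambda>x. 0"] by (simp add: fsupp_def)
  then obtain U where U: "\<And>k. fsupp (U k)" "\<And>k x. 0 \<le> x \<Longrightarrow> U k x = u (x, k)"
    "\<And>k. past_le (\<lambda>x. correl \<pi> (U k) x) \<delta>"
    by metis
  define e where "e = (\<lambda>(x, k). if x \<ge> 0 then u (x, k) else if k < N then U k x else 0)"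
  have "{i. e i \<noteq> 0} \<subseteq> {i. u i \<noteq> 0} \<union> (\<Union>k<N. (\<lambda>x. (x, k)) ` {x. U k x \<noteq> 0})"
    by (auto simp: e_def split: if_splits)
  moreover have "finite ({i. u i \<noteq> 0} \<union> (\<Union>k<N. (\<lambda>x. (x, k)) ` {x. U k x \<noteq> 0}))"
    using u U(1) by (auto simp: fsupp_def)
  ultimately have fe: "fsupp e" unfolding fsupp_def by (rule finite_subset)
  have Pe: "Pf (wave w (shift b e)) k = correl \<pi> (U k) b" if "k < N" for b k
  proof -
    have "e (x, k) = U k x" for x using U(2)[of x k] that by (simp add: e_def)
    then have "Pf (wave w (shift b e)) k = (\<Sum>j\<le>d2. \<Sum>i\<le>d1. pc i j * (w ^ j * U k (b + int i)))"
      by (simp add: Pf_def wave_def add.commute)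
    also have "\<dots> = (\<Sum>i\<le>d1. \<Sum>j\<le>d2. pc i j * (w ^ j * U k (b + int i)))"
      by (rule sum.swap)
    finally show ?thesis by (simp add: corr sum_distrib_left sum_distrib_right mult_ac)
  qed
  have lf: "lform W (\<lambda>u. Pf (wave w u) k)" if "k < N" for k
    unfolding Pf_def wave_def using that by (auto intro!: lform_sum lform_scale lform_coord)
  have hf: "hform W (\<lambda>u. \<Sum>k<N. (cmod (Pf (wave w u) k))\<^sup>2)"
    using lf by (intro hform_sum hform_cmod_lform) auto
  have "energy (\<lambda>u. D (wave w u)) {..<0} e \<le> energy (\<lambda>u. \<Sum>k<N. (cmod (Pf (wave w u) k))\<^sup>2) {..<0} e"
    by (rule energy_mono[OF hform_D_wave hf fe]) (simp add: D_def sum_nonneg)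
  also have "\<dots> \<le> real N * \<delta>"
  proof (rule energy_past_le[OF lf fe])
    fix k assume "k < N"
    then show "past_le (\<lambda>b. Pf (wave w (shift b e)) k) \<delta>" using U(3)[of k] Pe by simp
  qed
  also have "\<dots> \<le> \<epsilon>" using \<open>0 < \<epsilon>\<close> by (simp add: \<delta>_def field_simps)
  finally show "\<exists>e. fsupp e \<and> (\<forall>j\<ge>0. \<forall>x. e (j, x) = u (j, x)) \<and> energy (\<lambda>u. D (wave w u)) {..<0} e \<le> \<epsilon>"
    using fe by (intro exI[of _ e]) (simp add: e_def)
qed

abbreviation "T w \<equiv> tail_form (int d1) {..<N} (\<lambda>u. D (wave w u))"

text \<open>Off the finite set of exceptional slices the form is outer with zero energy, so its tail
  form is nonnegative. As \<open>T w u\<close> is continuous in \<open>w\<close>, the exceptions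
  disappear.\<close>

lemma T_nonneg:
  assumes "cmod w = 1"
  shows "0 \<le> T w u"
proof -
  obtain Z where Z: "finite Z" "\<And>w z. cmod w = 1 \<Longrightarrow> w \<notin> Z \<Longrightarrow> cmod z < 1 \<Longrightarrow>
      (\<Sum>i\<le>d1. (\<Sum>j\<le>d2. pc i j * w ^ j) * z ^ i) \<noteq> 0"
    using stable_slice by blast
  have "continuous_on UNIV (\<lambda>w. T w u)"
    unfolding tail_form_def D_def Pf_def Qf_def wave_def by (simp, intro continuous_intros)
  moreover have "0 \<le> T w u" if "cmod w = 1" "w \<notin> Z" for w
    using Z(2)[OF that] energy_D_wave[OF that(1)]
    by (intro tail_form_nonneg[OF _ hform_D_wave _ outer_D_wave]) auto
  ultimately show ?thesis using sphere_finite_exception[OF Z(1)] assms by blast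
qed

lemma D_wave_telescope:
  assumes "cmod w = 1"
  shows "D (wave w u) = T w u - T w (shift 1 u)"
  by (rule tail_form_telescope(2)[where D = "\<lambda>u. D (wave w u)" and c = u and d = "int d1" and H = "{..<N}",
        OF _ hform_D_wave energy_D_wave[OF assms]]) auto

section \<open>Passing to the second variable\<close>

text \<open>The form-valued trigonometric polynomial \<open>w \<mapsto> T w\<close>, written on
  coefficient sequences in the exponent of \<open>z2\<close>; evaluation on waves returns
  \<open>T w\<close>.\<close>

definition DT :: "(int \<times> int \<times> nat \<Rightarrow> complex) \<Rightarrow> real" where
  "DT c = (\<Sum>a\<in>{0..<int d1}. D (\<lambda>(j, h). shift a (restr W' (\<lambda>h. c (j, h))) h))"

lemma DT_wave: "DT (wave w u) = T w u"
proof -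
  have "(\<lambda>(j, h). shift a (restr W' (\<lambda>h. wave w u (j, h))) h) = wave w (shift a (restr W' u))" for a
    by (auto simp: wave_def restr_def)
  then show ?thesis by (simp add: DT_def tail_form_def)
qed

lemma hform_DT: "hform ({0..int d2} \<times> W') DT"
proof -
  have "hform ({0..int d2} \<times> W') (\<lambda>c. D (\<lambda>(j, h). shift a (restr W' (\<lambda>h. c (j, h))) h))" for a
  proof -
    have "hform ({0..int d2} \<times> W') (\<lambda>c. D (\<lambda>x. if (\<lambda>(j, i, k). (i + a, k) \<in> W') x
        then c ((\<lambda>(j, i, k). (j, i + a, k)) x) else 0))"
      by (rule hform_reindex[OF hform_D]) (auto simp: inj_on_def)
    moreover have "(\<lambda>x. if (\<lambda>(j, i, k). (i + a, k) \<in> W') x then c ((\<lambda>(j, i, k). (j, i + a, k)) x) else 0)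
        = (\<lambda>(j, h). shift a (restr W' (\<lambda>h. c (j, h))) h)" for c :: "int \<times> int \<times> nat \<Rightarrow> complex"
      by (auto simp: restr_def)
    ultimately show ?thesis by simp
  qed
  then show ?thesis unfolding DT_def[abs_def] by (intro hform_sum)
qed

lemma hform_lift_shift:
  assumes "hform ({0..int d2} \<times> W') q"
  shows "hform ({0..int d2} \<times> W) (\<lambda>c. q (lift_shift c))"
proof -
  have "hform ({0..int d2} \<times> W) (\<lambda>c. q (\<lambda>x. if True then c ((\<lambda>(j, i, k). (j, i + 1, k)) x) else 0))"
    by (rule hform_reindex[OF assms]) (auto simp: inj_on_def)
  moreover have "(\<lambda>x. if True then c ((\<lambda>(j, i, k). (j, i + 1, k)) x) else 0) = lift_shift c"
    for c :: "int \<times> int \<times> nat \<Rightarrow> complex"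
    by (auto simp: lift_shift_def)
  ultimately show ?thesis by simp
qed

lemma hform_W'_W: "hform ({0..int d2} \<times> W') q \<Longrightarrow> hform ({0..int d2} \<times> W) q"
  by (erule hform_mono) auto

lemma energy_lift_shift: "energy (\<lambda>c. q (lift_shift c)) B c = energy q B (lift_shift c)"
  by (simp add: energy_def shift_lift_shift)

text \<open>The slice identity \<open>D_wave_telescope\<close>, integrated over the circle in the
  second variable: a form vanishing on all waves has zero energy.\<close>

lemma energy_D_DT:
  assumes "fsupp c"
  shows "energy D UNIV c - energy DT UNIV c + energy DT UNIV (lift_shift c) = 0"
proof -
  have "hform ({0..int d2} \<times> W) (\<lambda>c. D c - DT c + DT (lift_shift c))"
    by (intro hform_add hform_diff hform_D hform_W'_W[OF hform_DT] hform_lift_shift[OF hform_DT])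
  then have "energy (\<lambda>c. D c - DT c + DT (lift_shift c)) UNIV c = 0"
  proof (rule energy_zero_of_waves)
    show "D (wave w v) - DT (wave w v) + DT (lift_shift (wave w v)) = 0" if "cmod w = 1" for w v
      using D_wave_telescope[OF that, of v] unfolding DT_wave lift_shift_wave by linarith
  qed (rule assms)
  then show ?thesis
    using energy_add[OF hform_diff[OF hform_D hform_W'_W[OF hform_DT]] hform_lift_shift[OF hform_DT] assms, of UNIV]
      energy_diff[OF hform_D hform_DT assms, of UNIV]
    by (simp add: energy_lift_shift)
qed

text \<open>\<open>E\<close> is the outer factor of \<open>DT\<close>. Having the same energy as
  \<open>DT\<close>, it may replace it in \<open>energy_D_DT\<close>, so the remainder
  \<open>D3\<close> has zero energy and telescopes in the second variable through its tail form
  \<open>K\<close>. The point to prove is that \<open>D3\<close> is outer, which makes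
  \<open>K\<close> nonnegative.\<close>

lemma agler_form_decomposition:
  "\<exists>E K. hform ({0..int d2} \<times> W') E \<and> hform ({0..<int d2} \<times> W) K \<and> (\<forall>c. 0 \<le> E c) \<and> (\<forall>c. 0 \<le> K c)
    \<and> (\<forall>c. D c = E c - E (lift_shift c) + K c - K (shift 1 c))"
proof -
  have "0 \<le> energy DT UNIV c" if "fsupp c" for c
    by (rule energy_nonneg_of_waves[OF hform_DT _ that]) (simp add: DT_wave T_nonneg)
  then obtain E where E: "hform ({0..int d2} \<times> W') E" "\<And>c. 0 \<le> E c" "outer E"
    "\<And>c. fsupp c \<Longrightarrow> energy E UNIV c = energy DT UNIV c"
    using fejer_riesz[OF finite_windows(2) hform_DT] by blast
  define D3 where "D3 c = D c - E c + E (lift_shift c)" for c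
  have hE: "hform ({0..int d2} \<times> W) E" by (rule hform_W'_W[OF E(1)])
  have hE1: "hform ({0..int d2} \<times> W) (\<lambda>c. E (lift_shift c))" by (rule hform_lift_shift[OF E(1)])
  have hD3: "hform ({0..int d2} \<times> W) D3"
    unfolding D3_def by (intro hform_add hform_diff hform_D hE hE1)
  have zero: "energy D3 UNIV c = 0" if "fsupp c" for c
    unfolding D3_def
    using energy_add[OF hform_diff[OF hform_D hE] hE1 that, of UNIV] energy_diff[OF hform_D hE that, of UNIV]
      E(4)[OF that] E(4)[OF fsupp_lift_shift[OF that]] energy_D_DT[OF that]
    by (simp add: energy_lift_shift)
  \<comment> \<open>Up to discarded nonpositive terms, \<open>D3\<close> is the \<open>Pf\<close>
    part plus \<open>E\<close> on the exponents \<open>i \<ge> 1\<close> of \<open>z1\<close>.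
    Outerness of \<open>E\<close> fixes the past of these exponents first; the past at
    \<open>i = 0\<close> is then found with the polynomial \<open>p(0, .)\<close>, its target
    cancelling what the other exponents contribute to \<open>Pf\<close>.\<close>
  have "outer D3"
    unfolding outer_def
  proof (intro allI impI)
    fix c :: "int \<times> int \<times> nat \<Rightarrow> complex" and \<epsilon> :: real
    assume "0 < \<epsilon>" and c: "fsupp c"
    obtain e where e: "fsupp e" "\<forall>j\<ge>0. \<forall>x. e (j, x) = lift_shift c (j, x)" "energy E {..<0} e \<le> \<epsilon> / 2"
      using E(3)[unfolded outer_def, rule_format, of "\<epsilon> / 2", OF _ fsupp_lift_shift[OF c]] \<open>0 < \<epsilon>\<close> by auto
    define \<pi> where "\<pi> = (\<Sum>j\<le>d2. monom (pc 0 j) j)"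
    have \<pi>: "poly \<pi> z \<noteq> 0" if "cmod z < 1" for z
      using stable_zero[OF that] by (simp add: \<pi>_def poly_sum poly_monom)
    have corr: "correl \<pi> v x = (\<Sum>j\<le>d2. pc 0 j * v (x + int j))" for v x
      by (simp add: \<pi>_def correl_sum correl_monom)
    define R where "R k c = (\<Sum>j\<le>d2. \<Sum>i<d1. pc (Suc i) j * c (int j, int i, k))" for k and c :: "int \<times> int \<times> nat \<Rightarrow> complex"
    have Pf_R: "Pf c k = (\<Sum>j\<le>d2. pc 0 j * c (int j, 0, k)) + R k (lift_shift c)" for c k
    proof -
      have "(\<Sum>i\<le>d1. pc i j * c (int j, int i, k))
          = pc 0 j * c (int j, 0, k) + (\<Sum>i<d1. pc (Suc i) j * c (int j, int i + 1, k))" for j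
        by (simp add: sum.atMost_shift add.commute)
      then show ?thesis by (simp add: Pf_def R_def sum.distrib)
    qed
    \<comment> \<open>The \<open>N\<close> components together use half of the allowance; the other
      half goes to \<open>E\<close>.\<close>
    define \<delta> where "\<delta> = \<epsilon> / (2 * (real N + 1))"
    have "0 < \<delta>" using \<open>0 < \<epsilon>\<close> by (simp add: \<delta>_def)
    have fsuppk: "fsupp (\<lambda>x. c (x, 0, k))" for k
    proof -
      have "{x. c (x, 0, k) \<noteq> 0} \<subseteq> fst ` {i. c i \<noteq> 0}" by force
      then show ?thesis using c unfolding fsupp_def by (meson finite_imageI finite_subset)
    qed
    have fsuppR: "fsupp (\<lambda>b. - R k (shift b e))" if "k < N" for k
    proof -
      have "lform ({0..int d2} \<times> W) (R k)"
        unfolding R_def[abs_def] using that by (intro lform_sum lform_scale lform_coord) auto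
      then show ?thesis using fsupp_lform_shift[OF _ e(1)] by (simp add: fsupp_def)
    qed
    have "\<forall>k. \<exists>u. k < N \<longrightarrow> fsupp u \<and> (\<forall>x\<ge>0. u x = c (x, 0, k)) \<and> past_le (\<lambda>b. correl \<pi> u b - - R k (shift b e)) \<delta>"
      using outer_poly[OF \<pi> fsuppk fsuppR \<open>0 < \<delta>\<close>] by blast
    from choice[OF this] obtain U where "\<forall>k. k < N \<longrightarrow> fsupp (U k) \<and> (\<forall>x\<ge>0. U k x = c (x, 0, k))
        \<and> past_le (\<lambda>b. correl \<pi> (U k) b - - R k (shift b e)) \<delta>" ..
    then have U: "\<And>k. k < N \<Longrightarrow> fsupp (U k)" "\<And>k x. k < N \<Longrightarrow> 0 \<le> x \<Longrightarrow> U k x = c (x, 0, k)"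
      "\<And>k. k < N \<Longrightarrow> past_le (\<lambda>b. correl \<pi> (U k) b - - R k (shift b e)) \<delta>"
      by auto
    \<comment> \<open>The past of \<open>c\<close> is replaced: exponent 0 by \<open>U\<close>,
      exponents \<open>i \<ge> 1\<close> by \<open>e\<close>, which was chosen for
      \<open>lift_shift c\<close> and so carries an offset of one.\<close>
    define c' where "c' = (\<lambda>(j, i, k). if 0 \<le> j then c (j, i, k) else if i = 0 \<and> k < N then U k j
        else if 1 \<le> i then e (j, i - 1, k) else 0)"
    have "{x. c' x \<noteq> 0} \<subseteq> {x. c x \<noteq> 0} \<union> (\<Union>k<N. (\<lambda>j. (j, 0, k)) ` {j. U k j \<noteq> 0})
        \<union> (\<lambda>(j, i, k). (j, i + 1, k)) ` {x. e x \<noteq> 0}"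
    proof
      fix x assume "x \<in> {x. c' x \<noteq> 0}"
      moreover obtain j i k where x: "x = (j, i, k)" by (cases x)
      ultimately have nz: "c' (j, i, k) \<noteq> 0" by simp
      consider "0 \<le> j" | "j < 0" "i = 0" "k < N" | "j < 0" "\<not> (i = 0 \<and> k < N)" by linarith
      then show "x \<in> {x. c x \<noteq> 0} \<union> (\<Union>k<N. (\<lambda>j. (j, 0, k)) ` {j. U k j \<noteq> 0})
        \<union> (\<lambda>(j, i, k). (j, i + 1, k)) ` {x. e x \<noteq> 0}"
      proof cases
        case 1
        then show ?thesis using nz x by (simp add: c'_def)
      next
        case 2
        then show ?thesis using nz x by (auto simp: c'_def)
      next
        case 3
        then have "e (j, i - 1, k) \<noteq> 0" using nz by (simp add: c'_def split: if_splits)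
        then have "x \<in> (\<lambda>(j, i, k). (j, i + 1, k)) ` {x. e x \<noteq> 0}"
          unfolding x by (intro image_eqI[of _ _ "(j, i - 1, k)"]) auto
        then show ?thesis by blast
      qed
    qed
    moreover have "finite ({x. c x \<noteq> 0} \<union> (\<Union>k<N. (\<lambda>j. (j, 0, k)) ` {j. U k j \<noteq> 0})
        \<union> (\<lambda>(j, i, k). (j, i + 1, k)) ` {x. e x \<noteq> 0})"
      using c U(1) e(1) by (auto simp: fsupp_def)
    ultimately have fc': "fsupp c'" unfolding fsupp_def by (rule finite_subset)
    have c'e: "c' (j, i + 1, k) = e (j, i, k)" if "0 \<le> i" for i j k
      using e(2) that by (auto simp: c'_def)
    have c'U: "c' (j, 0, k) = U k j" if "k < N" for j k
      using U(2) that by (auto simp: c'_def)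
    have "Pf (shift b c') k = correl \<pi> (U k) b + R k (shift b e)" if "k < N" for b k
      using that c'e[of "int i" for i] by (simp add: Pf_R corr c'U R_def add.commute)
    then have past: "past_le (\<lambda>b. Pf (shift b c') k) \<delta>" if "k < N" for k
      using U(3)[OF that] that by simp
    have eE: "energy (\<lambda>c. E (lift_shift c)) {..<0} c' = energy E {..<0} e"
      by (rule energy_cong, rule hform_cong_vec[OF E(1)]) (auto simp: c'e)
    have hP: "hform ({0..int d2} \<times> W) (\<lambda>c. \<Sum>k<N. (cmod (Pf c k))\<^sup>2)"
      by (intro hform_sum hform_cmod_lform lform_Pf) auto
    have "energy D3 {..<0} c' \<le> energy (\<lambda>c. (\<Sum>k<N. (cmod (Pf c k))\<^sup>2) + E (lift_shift c)) {..<0} c'"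
    proof (rule energy_mono[OF hD3 hform_add[OF hP hE1] fc'])
      show "D3 c \<le> (\<Sum>k<N. (cmod (Pf c k))\<^sup>2) + E (lift_shift c)" for c
        using E(2)[of c] sum_nonneg[of "{..<M}" "\<lambda>l. (cmod (Qf c l))\<^sup>2"] by (simp add: D3_def D_def)
    qed
    also have "\<dots> = energy (\<lambda>c. \<Sum>k<N. (cmod (Pf c k))\<^sup>2) {..<0} c' + energy E {..<0} e"
      by (simp add: energy_add[OF hP hE1 fc'] eE)
    also have "\<dots> \<le> real N * \<delta> + \<epsilon> / 2"
      by (intro add_mono energy_past_le[OF lform_Pf fc' past] e(3)) auto
    also have "\<dots> \<le> \<epsilon>" using \<open>0 < \<epsilon>\<close> by (simp add: \<delta>_def field_simps)
    finally show "\<exists>e. fsupp e \<and> (\<forall>j\<ge>0. \<forall>x. e (j, x) = c (j, x)) \<and> energy D3 {..<0} e \<le> \<epsilon>"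
      using fc' by (intro exI[of _ c']) (auto simp: c'_def)
  qed
  define K where "K = tail_form (int d2) W D3"
  have "0 \<le> K c" for c
    unfolding K_def using zero \<open>outer D3\<close> by (intro tail_form_nonneg[OF finite_windows(1) hD3]) auto
  moreover have "hform ({0..<int d2} \<times> W) K"
    unfolding K_def by (rule hform_tail_form[OF hD3 finite_windows(1)])
  moreover have "D c = E c - E (lift_shift c) + K c - K (shift 1 c)" for c
    using tail_form_telescope(2)[OF finite_windows(1) hD3 zero, of c] by (simp add: K_def D3_def)
  ultimately show ?thesis using E(1,2) by blast
qed

end

section \<open>Extension of isometries\<close>

text \<open>Fewer equations than unknowns: padded with zero rows, the system is square with
  determinant zero.\<close>

lemma exists_null_vector:
  fixes x :: "nat \<Rightarrow> nat \<Rightarrow> complex"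
  assumes "k < n"
  shows "\<exists>y. (\<exists>s<n. y s \<noteq> 0) \<and> (\<forall>l<k. (\<Sum>s<n. x l s * y s) = 0)"
proof -
  define A where "A = mat n n (\<lambda>(l, s). if l < k then x l s else 0)"
  have A: "A \<in> carrier_mat n n" by (simp add: A_def)
  have "A = mat\<^sub>r n n (\<lambda>i. if i = k then 0\<^sub>v n else row A i)"
    by (intro eq_matI) (auto simp: A_def)
  moreover have "row A \<in> {0..<n} \<rightarrow> carrier_vec n" using A by auto
  ultimately have "det A = 0" using det_row_0[OF assms, of "row A"] by simp
  then obtain y where y: "y \<in> carrier_vec n" "y \<noteq> 0\<^sub>v n" "A *\<^sub>v y = 0\<^sub>v n"
    using det_0_iff_vec_prod_zero_field[OF A] by blast
  have "\<exists>s<n. y $ s \<noteq> 0"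
    using y(1,2) by (metis carrier_vecD eq_vecI index_zero_vec(1) index_zero_vec(2))
  moreover have "(\<Sum>s<n. x l s * y $ s) = 0" if "l < k" for l
  proof -
    have "(A *\<^sub>v y) $ l = 0" using y(3) that assms by simp
    then show ?thesis
      using that assms y(1) A by (simp add: A_def scalar_prod_def atLeast0LessThan)
  qed
  ultimately show ?thesis by (intro exI[of _ "\<lambda>s. y $ s"]) blast
qed

definition orthonormal :: "nat \<Rightarrow> nat \<Rightarrow> (nat \<Rightarrow> nat \<Rightarrow> complex) \<Rightarrow> bool" where
  "orthonormal k n x \<longleftrightarrow> (\<forall>l<k. \<forall>l'<k. (\<Sum>s<n. cnj (x l s) * x l' s) = of_bool (l = l'))"

lemma orthonormal_le:
  assumes "orthonormal k n x"
  shows "k \<le> n"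
proof (rule ccontr)
  assume "\<not> k \<le> n"
  then obtain c where c: "\<exists>l<k. c l \<noteq> 0" "\<And>s. s < n \<Longrightarrow> (\<Sum>l<k. x l s * c l) = 0"
    using exists_null_vector[of n k "\<lambda>s l. x l s"] by auto
  obtain l' where l': "l' < k" "c l' \<noteq> 0" using c(1) by blast
  have "c l' = (\<Sum>l<k. (if l = l' then c l else 0))" using l' by simp
  also have "\<dots> = (\<Sum>l<k. (\<Sum>s<n. cnj (x l' s) * x l s) * c l)"
    using assms l'(1) unfolding orthonormal_def by (intro sum.cong refl) auto
  also have "\<dots> = (\<Sum>s<n. cnj (x l' s) * (\<Sum>l<k. x l s * c l))"
    unfolding sum_distrib_right sum_distrib_left by (subst sum.swap) (simp add: mult_ac)
  also have "\<dots> = 0" using c(2) by simp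
  finally show False using l'(2) by simp
qed

lemma orthonormal_extend:
  assumes "orthonormal k n x" "k < n"
  shows "\<exists>y. orthonormal (Suc k) n (x(k := y))"
proof -
  obtain y where y: "\<exists>s<n. y s \<noteq> 0" "\<And>l. l < k \<Longrightarrow> (\<Sum>s<n. cnj (x l s) * y s) = 0"
    using exists_null_vector[OF assms(2), of "\<lambda>l s. cnj (x l s)"] by auto
  define r where "r = (\<Sum>s<n. (cmod (y s))\<^sup>2)"
  have "0 < r" using y(1) unfolding r_def by (auto intro!: sum_pos2)
  define y' where "y' s = y s / complex_of_real (sqrt r)" for s
  have yy: "(\<Sum>s<n. cnj (y' s) * y' s) = 1"
  proof -
    have "(\<Sum>s<n. cnj (y' s) * y' s) = (\<Sum>s<n. complex_of_real ((cmod (y s))\<^sup>2 / r))"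
    proof (rule sum.cong[OF refl])
      fix s
      have "cnj (y' s) * y' s = complex_of_real ((cmod (y' s))\<^sup>2)"
        by (metis complex_norm_square mult.commute)
      then show "cnj (y' s) * y' s = complex_of_real ((cmod (y s))\<^sup>2 / r)"
        using \<open>0 < r\<close> by (simp add: y'_def norm_divide power_divide)
    qed
    also have "\<dots> = complex_of_real (r / r)"
      by (simp only: of_real_sum[symmetric] sum_divide_distrib[symmetric] r_def)
    finally show ?thesis using \<open>0 < r\<close> by simp
  qed
  have xy: "(\<Sum>s<n. cnj (x l s) * y' s) = 0" if "l < k" for l
    using y(2)[OF that] by (simp add: y'_def sum_divide_distrib[symmetric])
  have yx: "(\<Sum>s<n. cnj (y' s) * x l s) = 0" if "l < k" for l
  proof -
    have "(\<Sum>s<n. cnj (y' s) * x l s) = cnj (\<Sum>s<n. cnj (x l s) * y' s)"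
      by (simp add: mult.commute)
    then show ?thesis using xy[OF that] by simp
  qed
  have "orthonormal (Suc k) n (x(k := y'))"
    unfolding orthonormal_def
  proof (intro allI impI)
    fix l l' assume "l < Suc k" "l' < Suc k"
    then consider "l < k" "l' < k" | "l < k" "l' = k" | "l = k" "l' < k" | "l = k" "l' = k" by linarith
    then show "(\<Sum>s<n. cnj ((x(k := y')) l s) * (x(k := y')) l' s) = of_bool (l = l')"
      using assms(1) xy yx yy by cases (auto simp: orthonormal_def)
  qed
  then show ?thesis by blast
qed

lemma orthonormal_complete:
  assumes "orthonormal k n x" "k \<le> j" "j \<le> n"
  shows "\<exists>x'. orthonormal j n x' \<and> (\<forall>l<k. x' l = x l)"
  using assms(2,3)
proof (induction j rule: dec_induct)
  case base
  then show ?case using assms(1) by blast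
next
  case (step j)
  then obtain x' where x': "orthonormal j n x'" "\<forall>l<k. x' l = x l" by auto
  then obtain y where "orthonormal (Suc j) n (x'(j := y))"
    using orthonormal_extend step by (metis Suc_le_lessD)
  moreover have "\<forall>l<k. (x'(j := y)) l = x l" using x'(2) step by auto
  ultimately show ?case by blast
qed

text \<open>A left inverse of a square matrix is a right inverse, so orthonormality of the
  \<open>n\<close> vectors gives the completeness relation between coordinates.\<close>

lemma orthonormal_square:
  assumes "orthonormal n n x" "s < n" "s' < n"
  shows "(\<Sum>l<n. x l s * cnj (x l s')) = of_bool (s = s')"
proof -
  define A where "A = mat n n (\<lambda>(l, s). cnj (x l s))"
  define B where "B = mat n n (\<lambda>(s, l). x l s)"
  have AB: "A \<in> carrier_mat n n" "B \<in> carrier_mat n n" by (simp_all add: A_def B_def)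
  have "A * B = 1\<^sub>m n"
    using assms(1) by (intro eq_matI) (auto simp: A_def B_def orthonormal_def scalar_prod_def atLeast0LessThan)
  then have "B * A = 1\<^sub>m n" using mat_mult_left_right_inverse[OF AB] by simp
  then have "(B * A) $$ (s, s') = of_bool (s = s')" using assms by simp
  then show ?thesis using assms(2,3) by (simp add: A_def B_def scalar_prod_def atLeast0LessThan)
qed

section \<open>From equal norms to an isometry\<close>

definition linear_fun :: "(('i \<Rightarrow> complex) \<Rightarrow> complex) \<Rightarrow> bool" where
  "linear_fun L \<longleftrightarrow> (\<forall>c d a. L (\<lambda>i. c i + a * d i) = L c + a * L d)"

lemma linear_fun_sum:
  assumes "linear_fun L" "finite S"
  shows "L (\<lambda>i. c i + (\<Sum>s\<in>S. a s * d s i)) = L c + (\<Sum>s\<in>S. a s * L (d s))"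
  using assms(2)
proof (induction S rule: finite_induct)
  case (insert s S)
  have "L (\<lambda>i. c i + (\<Sum>s\<in>insert s S. a s * d s i)) = L (\<lambda>i. (c i + (\<Sum>s\<in>S. a s * d s i)) + a s * d s i)"
    using insert by (simp add: add_ac)
  also have "\<dots> = L (\<lambda>i. c i + (\<Sum>s\<in>S. a s * d s i)) + a s * L (d s)"
    by (rule assms(1)[unfolded linear_fun_def, rule_format])
  finally show ?case using insert by (simp add: add_ac)
qed simp

text \<open>Comparing norms at \<open>c + a d\<close> equates the real parts of \<open>a\<close>
  times the two inner products; \<open>a = 1\<close> and \<open>a = - \<i>\<close> recover real and
  imaginary parts.\<close>

lemma gram_eq_of_norm_eq:
  fixes X Y :: "nat \<Rightarrow> ('i \<Rightarrow> complex) \<Rightarrow> complex"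
  assumes "\<And>s. s < n \<Longrightarrow> linear_fun (X s)" "\<And>t. t < m \<Longrightarrow> linear_fun (Y t)"
    and "\<And>c. (\<Sum>s<n. (cmod (X s c))\<^sup>2) = (\<Sum>t<m. (cmod (Y t c))\<^sup>2)"
  shows "(\<Sum>s<n. cnj (X s c) * X s d) = (\<Sum>t<m. cnj (Y t c) * Y t d)"
proof -
  have expand: "(cmod (x + a * y))\<^sup>2 = (cmod x)\<^sup>2 + (cmod a)\<^sup>2 * (cmod y)\<^sup>2 + 2 * Re (a * (cnj x * y))" for x y a
    unfolding cmod_power2 by (simp add: power2_eq_square algebra_simps)
  have key: "Re (a * (\<Sum>s<n. cnj (X s c) * X s d)) = Re (a * (\<Sum>t<m. cnj (Y t c) * Y t d))" for a
  proof -
    have sumx: "(\<Sum>s<k. (cmod (Z s (\<lambda>i. c i + a * d i)))\<^sup>2)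
        = (\<Sum>s<k. (cmod (Z s c))\<^sup>2) + (cmod a)\<^sup>2 * (\<Sum>s<k. (cmod (Z s d))\<^sup>2)
          + 2 * Re (a * (\<Sum>s<k. cnj (Z s c) * Z s d))"
      if "\<And>s. s < k \<Longrightarrow> linear_fun (Z s)" for k and Z :: "nat \<Rightarrow> ('i \<Rightarrow> complex) \<Rightarrow> complex"
    proof -
      have "(\<Sum>s<k. (cmod (Z s (\<lambda>i. c i + a * d i)))\<^sup>2)
          = (\<Sum>s<k. (cmod (Z s c))\<^sup>2 + (cmod a)\<^sup>2 * (cmod (Z s d))\<^sup>2 + 2 * Re (a * (cnj (Z s c) * Z s d)))"
        using that unfolding linear_fun_def expand[symmetric] by (intro sum.cong refl) auto
      then show ?thesis
        by (simp only: sum.distrib sum_distrib_left[symmetric] Re_sum[symmetric])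
    qed
    show ?thesis
      using assms(3)[of "\<lambda>i. c i + a * d i"] assms(3)[of c] assms(3)[of d] sumx[OF assms(1), of n] sumx[OF assms(2), of m]
      by simp
  qed
  show ?thesis
    using key[of 1] key[of "- \<i>"] by (simp add: complex_eq_iff)
qed

text \<open>Equal norms make \<open>X c \<mapsto> Y c\<close> an isometry between the ranges. By
  \<open>hform_factor\<close> there are vectors \<open>e l\<close> whose images under
  \<open>X\<close>, and hence under \<open>Y\<close>, are orthonormal and span these ranges. Both
  families are completed to \<open>n\<close> vectors, for which \<open>n \<le> m\<close> leaves
  room, and \<open>U\<close> sends one to the other.\<close>

lemma lurking_isometry:
  fixes X Y :: "nat \<Rightarrow> ('i \<Rightarrow> complex) \<Rightarrow> complex"
  assumes "n \<le> m" "finite I" "hform I (\<lambda>c. \<Sum>s<n. (cmod (X s c))\<^sup>2)"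
    and lin: "\<And>s. s < n \<Longrightarrow> linear_fun (X s)" "\<And>t. t < m \<Longrightarrow> linear_fun (Y t)"
    and eq: "\<And>c. (\<Sum>s<n. (cmod (X s c))\<^sup>2) = (\<Sum>t<m. (cmod (Y t c))\<^sup>2)"
  shows "\<exists>U. (\<forall>s<n. \<forall>s'<n. (\<Sum>t<m. cnj (U t s) * U t s') = of_bool (s = s'))
    \<and> (\<forall>c. \<forall>t<m. Y t c = (\<Sum>s<n. U t s * X s c))"
proof -
  obtain r :: nat and f e where f: "\<forall>c. (\<Sum>s<n. (cmod (X s c))\<^sup>2) = (\<Sum>l<r. (cmod (\<Sum>i\<in>I. f l i * c i))\<^sup>2)"
    "\<forall>l<r. \<forall>l'<r. (\<Sum>i\<in>I. f l i * e l' i) = of_bool (l = l')"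
    using hform_factor[OF assms(2,3)] by (auto simp: sum_nonneg)
  define F where "F l c = (\<Sum>i\<in>I. f l i * c i)" for l c
  have linF: "linear_fun (F l)" for l
    unfolding linear_fun_def F_def by (simp add: distrib_left sum.distrib sum_distrib_left mult_ac)
  have q: "(\<Sum>s<n. (cmod (X s c))\<^sup>2) = (\<Sum>l<r. (cmod (F l c))\<^sup>2)" for c
    using f(1) by (simp add: F_def)
  have Fe: "F l (e l') = of_bool (l = l')" if "l < r" "l' < r" for l l'
    using f(2) that by (simp add: F_def)
  define u where "u l s = X s (e l)" for l s
  define v where "v l t = Y t (e l)" for l t
  have gram: "(\<Sum>l<r. cnj (F l (e a)) * F l (e b)) = of_bool (a = b)" if "a < r" "b < r" for a b
  proof -
    have "(\<Sum>l<r. cnj (F l (e a)) * F l (e b)) = (\<Sum>l<r. if l = a then of_bool (a = b) else 0)"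
      using that by (intro sum.cong refl) (auto simp: Fe)
    then show ?thesis using that by simp
  qed
  have ou: "orthonormal r n u"
    unfolding orthonormal_def u_def using gram gram_eq_of_norm_eq[where Y = F, OF lin(1) linF q] by simp
  have ov: "orthonormal r m v"
    unfolding orthonormal_def v_def
    using gram gram_eq_of_norm_eq[where Y = F, OF lin(2) linF] q eq by simp
  have "r \<le> n" using orthonormal_le[OF ou] .
  obtain u' where u': "orthonormal n n u'" "\<forall>l<r. u' l = u l"
    using orthonormal_complete[OF ou \<open>r \<le> n\<close> order_refl] by blast
  obtain v' where v': "orthonormal n m v'" "\<forall>l<r. v' l = v l"
    using orthonormal_complete[OF ov \<open>r \<le> n\<close> assms(1)] by blast
  define U where "U t s = (\<Sum>l<n. v' l t * cnj (u' l s))" for t s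
  have expansion: "(\<forall>s<n. X s c = (\<Sum>l<r. F l c * u l s)) \<and> (\<forall>t<m. Y t c = (\<Sum>l<r. F l c * v l t))" for c
  proof -
    \<comment> \<open>All \<open>F l\<close> vanish on \<open>c\<close> minus its expansion in the
      \<open>e l\<close>, so this difference has norm zero under both \<open>X\<close> and
      \<open>Y\<close>.\<close>
    define c' where "c' = (\<lambda>i. c i + (\<Sum>l<r. (- F l c) * e l i))"
    have "F l c' = 0" if "l < r" for l
    proof -
      have "F l c' = F l c + (\<Sum>l'<r. (- F l' c) * F l (e l'))"
        unfolding c'_def by (rule linear_fun_sum[OF linF]) simp
      also have "(\<Sum>l'<r. (- F l' c) * F l (e l')) = (\<Sum>l'<r. if l' = l then - F l' c else 0)"
        using that by (intro sum.cong refl) (auto simp: Fe)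
      finally show ?thesis using that by simp
    qed
    then have z: "(\<Sum>s<n. (cmod (X s c'))\<^sup>2) = 0" using q by simp
    then have X0: "X s c' = 0" if "s < n" for s
      using that by (simp add: sum_nonneg_eq_0_iff)
    have Y0: "Y t c' = 0" if "t < m" for t
      using that z unfolding eq by (simp add: sum_nonneg_eq_0_iff)
    have "X s c = (\<Sum>l<r. F l c * u l s)" if "s < n" for s
      using X0[OF that] linear_fun_sum[OF lin(1)[OF that], of "{..<r}" c "\<lambda>l. - F l c" e]
      by (simp add: c'_def u_def sum_negf)
    moreover have "Y t c = (\<Sum>l<r. F l c * v l t)" if "t < m" for t
      using Y0[OF that] linear_fun_sum[OF lin(2)[OF that], of "{..<r}" c "\<lambda>l. - F l c" e]
      by (simp add: c'_def v_def sum_negf)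
    ultimately show ?thesis by blast
  qed
  have "(\<Sum>t<m. cnj (U t s) * U t s') = of_bool (s = s')" if "s < n" "s' < n" for s s'
  proof -
    have "(\<Sum>t<m. cnj (U t s) * U t s')
        = (\<Sum>t<m. \<Sum>l<n. \<Sum>l'<n. (u' l s * cnj (u' l' s')) * (cnj (v' l t) * v' l' t))"
      unfolding U_def cnj_sum sum_product by (intro sum.cong refl) simp
    also have "\<dots> = (\<Sum>l<n. \<Sum>l'<n. (u' l s * cnj (u' l' s')) * (\<Sum>t<m. cnj (v' l t) * v' l' t))"
      unfolding sum_distrib_left by (simp only: sum.swap[of _ _ "{..<m}"])
    also have "\<dots> = (\<Sum>l<n. \<Sum>l'<n. if l = l' then u' l s * cnj (u' l' s') else 0)"
      using v'(1) unfolding orthonormal_def by (intro sum.cong refl) auto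
    also have "\<dots> = (\<Sum>l<n. u' l s * cnj (u' l s'))" by simp
    finally show ?thesis using orthonormal_square[OF u'(1) that] by simp
  qed
  moreover have "Y t c = (\<Sum>s<n. U t s * X s c)" if "t < m" for t c
  proof -
    have "(\<Sum>s<n. U t s * X s c) = (\<Sum>s<n. \<Sum>l<n. \<Sum>l'<r. (v' l t * F l' c) * (cnj (u' l s) * u' l' s))"
    proof (rule sum.cong[OF refl])
      fix s assume "s \<in> {..<n}"
      then have "X s c = (\<Sum>l'<r. F l' c * u' l' s)" using expansion u'(2) by simp
      then have "U t s * X s c = (\<Sum>l<n. \<Sum>l'<r. (v' l t * cnj (u' l s)) * (F l' c * u' l' s))"
        by (simp only: U_def sum_product)
      then show "U t s * X s c = (\<Sum>l<n. \<Sum>l'<r. (v' l t * F l' c) * (cnj (u' l s) * u' l' s))"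
        by (simp add: mult_ac)
    qed
    also have "\<dots> = (\<Sum>l<n. \<Sum>l'<r. (v' l t * F l' c) * (\<Sum>s<n. cnj (u' l s) * u' l' s))"
      unfolding sum_distrib_left by (subst sum.swap, rule sum.cong[OF refl], rule sum.swap)
    also have "\<dots> = (\<Sum>l<n. \<Sum>l'<r. if l = l' then v' l t * F l' c else 0)"
      using u'(1) \<open>r \<le> n\<close> unfolding orthonormal_def by (intro sum.cong refl) auto
    also have "\<dots> = (\<Sum>l'<r. \<Sum>l<n. if l = l' then v' l t * F l' c else 0)" by (rule sum.swap)
    also have "\<dots> = (\<Sum>l'<r. v' l' t * F l' c)" using \<open>r \<le> n\<close> by (intro sum.cong refl) auto
    also have "\<dots> = Y t c" using expansion v'(2) that by (simp add: mult.commute)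
    finally show ?thesis by simp
  qed
  ultimately show ?thesis by blast
qed

lemma sum_lessThan_add:
  fixes f :: "nat \<Rightarrow> 'a::comm_monoid_add"
  shows "(\<Sum>s<a + b. f s) = (\<Sum>s<a. f s) + (\<Sum>s<b. f (a + s))"
  by (induction b) (auto simp: add_ac)

lemma linear_fun_lform: "lform I L \<Longrightarrow> linear_fun L"
  unfolding lform_def linear_fun_def by (auto simp: distrib_left sum.distrib sum_distrib_left mult_ac)

section \<open>Equations for the blocks of the isometry\<close>

context torus_isometry
begin

definition pv :: "complex \<Rightarrow> complex \<Rightarrow> complex" where
  "pv z w = (\<Sum>j\<le>d2. \<Sum>i\<le>d1. pc i j * z ^ i * w ^ j)"

definition qv :: "nat \<Rightarrow> nat \<Rightarrow> complex \<Rightarrow> complex \<Rightarrow> complex" where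
  "qv l k z w = (\<Sum>j\<le>d2. \<Sum>i\<le>d1. qc l k i j * z ^ i * w ^ j)"

lemma Pf_wave_wave: "Pf (wave w (wave z v)) k = pv z w * v k"
  by (simp add: Pf_def pv_def wave_def sum_distrib_left sum_distrib_right mult_ac)

lemma Qf_wave_wave: "Qf (wave w (wave z v)) l = (\<Sum>k<N. qv l k z w * v k)"
  by (simp add: Qf_def qv_def wave_def sum_distrib_left sum_distrib_right mult_ac)

text \<open>At a torus point with nonzero denominator, \<open>isometry\<close> makes the numerator
  injective. Such a point exists: avoid the exceptional \<open>w\<close>, then the finitely many
  roots of the slice in \<open>z\<close>.\<close>

lemma N_le_M: "N \<le> M"
proof (rule ccontr)
  assume "\<not> N \<le> M"
  obtain Z where Z: "finite Z" "\<And>w z. cmod w = 1 \<Longrightarrow> w \<notin> Z \<Longrightarrow> cmod z < 1 \<Longrightarrow>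
      (\<Sum>i\<le>d1. (\<Sum>j\<le>d2. pc i j * w ^ j) * z ^ i) \<noteq> 0"
    using stable_slice by blast
  \<comment> \<open>Were the circle contained in \<open>S\<close>,
    \<open>sphere_finite_exception\<close> would apply vacuously to the constant
    \<open>- 1\<close>.\<close>
  have ex: "\<exists>z. cmod z = 1 \<and> z \<notin> S" if "finite S" for S :: "complex set"
    using sphere_finite_exception[OF that, of "\<lambda>_. - 1" 1] by fastforce
  obtain w where w: "cmod w = 1" "w \<notin> Z" using ex[OF Z(1)] by blast
  define \<pi> where "\<pi> = (\<Sum>i\<le>d1. monom (\<Sum>j\<le>d2. pc i j * w ^ j) i)"
  have \<pi>: "poly \<pi> z = (\<Sum>i\<le>d1. (\<Sum>j\<le>d2. pc i j * w ^ j) * z ^ i)" for z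
    by (simp add: \<pi>_def poly_sum poly_monom)
  have "poly \<pi> 0 \<noteq> 0" unfolding \<pi> by (rule Z(2)[OF w]) simp
  then have "\<pi> \<noteq> 0" by auto
  then have "finite {z. poly \<pi> z = 0}" by (rule poly_roots_finite)
  then obtain z where z: "cmod z = 1" "poly \<pi> z \<noteq> 0" using ex by blast
  have "poly \<pi> z = pv z w"
    unfolding \<pi> pv_def sum_distrib_right by (subst sum.swap) (simp add: mult_ac)
  then have p: "pv z w \<noteq> 0" using z by simp
  obtain y where y: "\<exists>k<N. y k \<noteq> 0" "\<forall>l<M. (\<Sum>k<N. qv l k z w * y k) = 0"
    using exists_null_vector[of M N "\<lambda>l k. qv l k z w"] \<open>\<not> N \<le> M\<close> by auto
  have "(\<Sum>k<N. (cmod (y k))\<^sup>2) = 0"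
    using isometry[OF z(1) w(1), of y] y(2) p by (simp add: pv_def qv_def)
  then show False using y(1) by (auto simp: sum_nonneg_eq_0_iff)
qed

text \<open>On a plane wave in two variables the translations become multiplication by
  \<open>z\<close> and \<open>w\<close>, so the isometry reads
  \<open>(Q, F) = U (p, \<Delta> F)\<close>, with \<open>F\<close> the values of the factors of
  \<open>E\<close> and \<open>K\<close>. Column \<open>k\<close> comes from the wave carrying the
  \<open>k\<close>-th unit vector.\<close>

lemma transfer_equations:
  "\<exists>(r1::nat) (r2::nat) U F. (\<forall>s<N + (r1 + r2). \<forall>s'<N + (r1 + r2).
        (\<Sum>t<M + (r1 + r2). cnj (U t s) * U t s') = of_bool (s = s'))
    \<and> (\<forall>z w. \<forall>k<N. \<forall>l<M. qv l k z w
        = pv z w * U l k + (\<Sum>s<r1 + r2. U l (N + s) * ((if s < r1 then z else w) * F z w s k)))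
    \<and> (\<forall>z w. \<forall>k<N. \<forall>t<r1 + r2. F z w t k
        = pv z w * U (M + t) k + (\<Sum>s<r1 + r2. U (M + t) (N + s) * ((if s < r1 then z else w) * F z w s k)))"
proof -
  let ?I = "{0..int d2} \<times> W"
  obtain E K where EK: "hform ({0..int d2} \<times> W') E" "hform ({0..<int d2} \<times> W) K"
    "\<forall>c. 0 \<le> E c" "\<forall>c. 0 \<le> K c" "\<forall>c. D c = E c - E (lift_shift c) + K c - K (shift 1 c)"
    using agler_form_decomposition by blast
  have fin: "finite ({0..int d2} \<times> W')" "finite ({0..<int d2} \<times> W)" by simp_all
  obtain r1 :: nat and g1 e1 where g1: "\<forall>c. E c = (\<Sum>s<r1. (cmod (\<Sum>i\<in>{0..int d2} \<times> W'. g1 s i * c i))\<^sup>2)"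
    "\<forall>s<r1. \<forall>t<r1. (\<Sum>i\<in>{0..int d2} \<times> W'. g1 s i * e1 t i) = of_bool (s = t)"
    using hform_factor[OF fin(1) EK(1) EK(3)[rule_format]] by (elim exE conjE) (rule that; assumption)
  obtain r2 :: nat and g2 e2 where g2: "\<forall>c. K c = (\<Sum>s<r2. (cmod (\<Sum>i\<in>{0..<int d2} \<times> W. g2 s i * c i))\<^sup>2)"
    "\<forall>s<r2. \<forall>t<r2. (\<Sum>i\<in>{0..<int d2} \<times> W. g2 s i * e2 t i) = of_bool (s = t)"
    using hform_factor[OF fin(2) EK(2) EK(4)[rule_format]] by (elim exE conjE) (rule that; assumption)
  define G1 where "G1 s c = (\<Sum>i\<in>{0..int d2} \<times> W'. g1 s i * c i)" for s c
  define G2 where "G2 s c = (\<Sum>i\<in>{0..<int d2} \<times> W. g2 s i * c i)" for s c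
  have E: "E c = (\<Sum>s<r1. (cmod (G1 s c))\<^sup>2)" for c using g1(1) by (simp add: G1_def)
  have K: "K c = (\<Sum>s<r2. (cmod (G2 s c))\<^sup>2)" for c using g2(1) by (simp add: G2_def)
  \<comment> \<open>The translated terms of the decomposition are moved to the side of
    \<open>Pf\<close>, so that both sides are sums of squares.\<close>
  define X where "X s c = (if s < N then Pf c s else if s - N < r1 then G1 (s - N) (lift_shift c)
      else G2 (s - N - r1) (shift 1 c))" for s c
  define Y where "Y t c = (if t < M then Qf c t else if t - M < r1 then G1 (t - M) c
      else G2 (t - M - r1) c)" for t c
  have linG: "linear_fun (G1 s)" "linear_fun (G2 s)" for s
    by (auto intro!: linear_fun_lform simp: lform_def G1_def G2_def)
  have sumX: "(\<Sum>s<N + (r1 + r2). (cmod (X s c))\<^sup>2) = (\<Sum>k<N. (cmod (Pf c k))\<^sup>2) + (E (lift_shift c) + K (shift 1 c))" for c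
    by (simp add: sum_lessThan_add X_def E K)
  have sumY: "(\<Sum>t<M + (r1 + r2). (cmod (Y t c))\<^sup>2) = (\<Sum>l<M. (cmod (Qf c l))\<^sup>2) + (E c + K c)" for c
    by (simp add: sum_lessThan_add Y_def E K)
  have "hform ?I (\<lambda>c. \<Sum>s<N + (r1 + r2). (cmod (X s c))\<^sup>2)"
    unfolding sumX
    by (intro hform_add hform_sum hform_cmod_lform lform_Pf hform_lift_shift[OF EK(1)] hform_shift1[OF EK(2)]) auto
  moreover have "linear_fun (X s)" for s
  proof -
    have "linear_fun (\<lambda>c. Pf c k)" for k
      unfolding linear_fun_def Pf_def
      by (simp add: distrib_left sum.distrib sum_distrib_left mult_ac)
    moreover have "lift_shift (\<lambda>i. c i + a * d i) = (\<lambda>i. lift_shift c i + a * lift_shift d i)"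
      "shift 1 (\<lambda>i. c i + a * d i) = (\<lambda>i. shift 1 c i + a * shift 1 d i)" for c d :: "int \<times> int \<times> nat \<Rightarrow> complex" and a
      by (auto simp: lift_shift_def shift_def)
    ultimately show ?thesis
      using linG by (simp add: linear_fun_def X_def)
  qed
  moreover have "linear_fun (Y t)" for t
  proof -
    have "linear_fun (\<lambda>c. Qf c l)" for l
      unfolding linear_fun_def Qf_def
      by (simp add: distrib_left sum.distrib sum_distrib_left mult_ac)
    then show ?thesis using linG by (simp add: linear_fun_def Y_def)
  qed
  moreover have "(\<Sum>s<N + (r1 + r2). (cmod (X s c))\<^sup>2) = (\<Sum>t<M + (r1 + r2). (cmod (Y t c))\<^sup>2)" for c
    using EK(5)[rule_format, of c] unfolding sumX sumY D_def by linarith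
  moreover have "N + (r1 + r2) \<le> M + (r1 + r2)" using N_le_M by simp
  moreover have "finite ?I" by simp
  ultimately obtain U where U: "\<forall>s<N + (r1 + r2). \<forall>s'<N + (r1 + r2).
        (\<Sum>t<M + (r1 + r2). cnj (U t s) * U t s') = of_bool (s = s')"
    "\<forall>c. \<forall>t<M + (r1 + r2). Y t c = (\<Sum>s<N + (r1 + r2). U t s * X s c)"
    using lurking_isometry[of "N + (r1 + r2)" "M + (r1 + r2)" ?I X Y] by blast
  define mw where "mw z w k = wave w (wave z (\<lambda>k'. of_bool (k' = k)))" for z w and k :: nat
  define F where "F z w s k = Y (M + s) (mw z w k)" for z w s k
  have G1m: "G1 s (lift_shift (mw z w k)) = z * G1 s (mw z w k)" for s z w k
    unfolding G1_def sum_distrib_left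
    by (intro sum.cong refl) (auto simp: mw_def wave_def nat_add_distrib)
  have G2m: "G2 s (shift 1 (mw z w k)) = w * G2 s (mw z w k)" for s z w k
    unfolding G2_def sum_distrib_left
    by (intro sum.cong refl) (auto simp: mw_def wave_def nat_add_distrib)
  have Xm: "(\<Sum>s<N + (r1 + r2). U t s * X s (mw z w k))
      = pv z w * U t k + (\<Sum>s<r1 + r2. U t (N + s) * ((if s < r1 then z else w) * F z w s k))"
    if "k < N" for t z w k
  proof -
    have "(\<Sum>s<N. U t s * X s (mw z w k)) = (\<Sum>s<N. if s = k then pv z w * U t k else 0)"
      by (intro sum.cong refl) (auto simp: X_def mw_def Pf_wave_wave)
    moreover have "(\<Sum>s<r1 + r2. U t (N + s) * X (N + s) (mw z w k))
        = (\<Sum>s<r1 + r2. U t (N + s) * ((if s < r1 then z else w) * F z w s k))"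
      by (intro sum.cong refl) (simp add: X_def F_def Y_def G1m G2m)
    ultimately show ?thesis using that by (simp add: sum_lessThan_add[of _ N])
  qed
  have 1: "qv l k z w = pv z w * U l k + (\<Sum>s<r1 + r2. U l (N + s) * ((if s < r1 then z else w) * F z w s k))"
    if "k < N" "l < M" for l k z w
  proof -
    have "Y l (mw z w k) = (\<Sum>k'<N. if k' = k then qv l k z w else 0)"
      using that by (simp add: Y_def mw_def Qf_wave_wave)
    then have "qv l k z w = Y l (mw z w k)" using that by simp
    also have "\<dots> = (\<Sum>s<N + (r1 + r2). U l s * X s (mw z w k))"
      using U(2) that by simp
    finally show ?thesis using Xm[OF that(1)] by simp
  qed
  have 2: "F z w t k = pv z w * U (M + t) k
      + (\<Sum>s<r1 + r2. U (M + t) (N + s) * ((if s < r1 then z else w) * F z w s k))"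
    if "k < N" "t < r1 + r2" for t k z w
  proof -
    have "F z w t k = (\<Sum>s<N + (r1 + r2). U (M + t) s * X s (mw z w k))"
      unfolding F_def using that by (intro U(2)[rule_format]) simp
    then show ?thesis using Xm[OF that(1)] by simp
  qed
  have 3: "\<forall>z w. \<forall>k<N. \<forall>l<M. qv l k z w
      = pv z w * U l k + (\<Sum>s<r1 + r2. U l (N + s) * ((if s < r1 then z else w) * F z w s k))"
    by (intro allI impI) (rule 1)
  have 4: "\<forall>z w. \<forall>k<N. \<forall>t<r1 + r2. F z w t k = pv z w * U (M + t) k
      + (\<Sum>s<r1 + r2. U (M + t) (N + s) * ((if s < r1 then z else w) * F z w s k))"
    by (intro allI impI) (rule 2)
  show ?thesis
    by (rule exI[of _ r1], rule exI[of _ r2], rule exI[of _ U], rule exI[of _ F], rule conjI)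
      (rule U(1), rule conjI, rule 3, rule 4)
qed

end

section \<open>Realizations by matrices\<close>

lemma isometry_norm_eq:
  fixes U :: "nat \<Rightarrow> nat \<Rightarrow> complex"
  assumes "\<And>s s'. s < n \<Longrightarrow> s' < n \<Longrightarrow> (\<Sum>t<m. cnj (U t s) * U t s') = of_bool (s = s')"
  shows "(\<Sum>t<m. (cmod (\<Sum>s<n. U t s * x s))\<^sup>2) = (\<Sum>s<n. (cmod (x s))\<^sup>2)"
proof -
  have sq: "complex_of_real ((cmod a)\<^sup>2) = cnj a * a" for a
    by (metis complex_norm_square mult.commute)
  have "complex_of_real (\<Sum>t<m. (cmod (\<Sum>s<n. U t s * x s))\<^sup>2)
      = (\<Sum>t<m. \<Sum>s<n. \<Sum>s'<n. (cnj (x s) * x s') * (cnj (U t s) * U t s'))"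
    unfolding of_real_sum sq cnj_sum sum_product by (intro sum.cong refl) simp
  also have "\<dots> = (\<Sum>s<n. \<Sum>s'<n. (cnj (x s) * x s') * (\<Sum>t<m. cnj (U t s) * U t s'))"
    unfolding sum_distrib_left by (subst sum.swap, rule sum.cong[OF refl], rule sum.swap)
  also have "\<dots> = (\<Sum>s<n. \<Sum>s'<n. if s = s' then cnj (x s) * x s' else 0)"
    using assms by (intro sum.cong refl) auto
  also have "\<dots> = (\<Sum>s<n. cnj (x s) * x s)" by simp
  also have "\<dots> = complex_of_real (\<Sum>s<n. (cmod (x s))\<^sup>2)"
    by (simp only: of_real_sum sq)
  finally show ?thesis by (simp only: of_real_eq_iff)
qed

lemma mat_adjoint_index:
  assumes "i < dim_col A" "j < dim_row A"
  shows "mat_adjoint A $$ (i, j) = conjugate (A $$ (j, i))"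
  using assms unfolding mat_adjoint_def by (simp add: mat_of_rows_index)

lemma dim_mat_adjoint [simp]: "dim_row (mat_adjoint A) = dim_col A" "dim_col (mat_adjoint A) = dim_row A"
  by (simp_all add: mat_adjoint_def)

lemma mat_inverse_SomeI:
  assumes "A \<in> carrier_mat n n" "\<And>v. v \<in> carrier_vec n \<Longrightarrow> A *\<^sub>v v = 0\<^sub>v n \<Longrightarrow> v = (0\<^sub>v n :: complex vec)"
  obtains R where "mat_inverse A = Some R" "R * A = 1\<^sub>m n" "R \<in> carrier_mat n n"
proof -
  have "det A \<noteq> 0"
    using det_0_iff_vec_prod_zero_field[OF assms(1)] assms(2) by blast
  then have "A \<in> Units (ring_mat TYPE(complex) n ())"
    by (rule det_non_zero_imp_unit[OF assms(1)])
  then obtain R where "mat_inverse A = Some R"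
    using mat_inverse(1)[OF assms(1), where b = "()"] by (cases "mat_inverse A") auto
  then show thesis using that mat_inverse(2)[OF assms(1)] by blast
qed

text \<open>The equations say \<open>F = p C + D \<Delta> F\<close> and
  \<open>Q = p A + B \<Delta> F\<close>. As \<open>D\<close> is a block of an isometry and
  \<open>\<Delta>\<close> is a strict contraction, \<open>I - D \<Delta>\<close> is injective, hence
  invertible, and \<open>F\<close> can be eliminated.\<close>

lemma realization_of_equations:
  fixes U :: "nat \<Rightarrow> nat \<Rightarrow> complex" and M N r1 r2 :: nat
  defines "r \<equiv> r1 + r2"
  defines "A \<equiv> mat M N (\<lambda>(i, j). U i j)" and "B \<equiv> mat M r (\<lambda>(i, j). U i (N + j))"
    and "C \<equiv> mat r N (\<lambda>(i, j). U (M + i) j)" and "D \<equiv> mat r r (\<lambda>(i, j). U (M + i) (N + j))"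
    and "P1 \<equiv> mat r r (\<lambda>(i, j). of_bool (i = j \<and> i < r1))"
    and "P2 \<equiv> mat r r (\<lambda>(i, j). of_bool (i = j \<and> r1 \<le> i))"
  assumes U: "\<forall>s<N + r. \<forall>s'<N + r. (\<Sum>t<M + r. cnj (U t s) * U t s') = of_bool (s = s')"
  shows "isometric_mat (four_block_mat A B C D)"
    and "orthogonal_projection r P1" "orthogonal_projection r P2" "P1 + P2 = 1\<^sub>m r"
    and "\<lbrakk>cmod z < 1; cmod w < 1; \<Delta> = z \<cdot>\<^sub>m P1 + w \<cdot>\<^sub>m P2;
      p \<noteq> 0; Q \<in> carrier_mat M N;
      \<And>l k. l < M \<Longrightarrow> k < N \<Longrightarrow> Q $$ (l, k)
        = p * U l k + (\<Sum>s<r. U l (N + s) * ((if s < r1 then z else w) * F s k));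
      \<And>t k. t < r \<Longrightarrow> k < N \<Longrightarrow> F t k
        = p * U (M + t) k + (\<Sum>s<r. U (M + t) (N + s) * ((if s < r1 then z else w) * F s k))\<rbrakk>
      \<Longrightarrow> \<exists>R. mat_inverse (1\<^sub>m r - D * \<Delta>) = Some R \<and> inverse p \<cdot>\<^sub>m Q = A + B * \<Delta> * R * C"
proof -
  have car: "A \<in> carrier_mat M N" "B \<in> carrier_mat M r" "C \<in> carrier_mat r N" "D \<in> carrier_mat r r"
    "P1 \<in> carrier_mat r r" "P2 \<in> carrier_mat r r"
    by (simp_all add: A_def B_def C_def D_def P1_def P2_def)
  have blk: "four_block_mat A B C D = mat (M + r) (N + r) (\<lambda>(i, j). U i j)"
    by (intro eq_matI) (auto simp: A_def B_def C_def D_def)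
  show "isometric_mat (four_block_mat A B C D)"
    unfolding isometric_mat_def blk
  proof (rule eq_matI)
    fix i j
    assume "i < dim_row (1\<^sub>m (dim_col (mat (M + r) (N + r) (\<lambda>(i, j). U i j))) :: complex mat)"
      "j < dim_col (1\<^sub>m (dim_col (mat (M + r) (N + r) (\<lambda>(i, j). U i j))) :: complex mat)"
    then have ij: "i < N + r" "j < N + r" by auto
    then have "(mat_adjoint (mat (M + r) (N + r) (\<lambda>(i, j). U i j)) * mat (M + r) (N + r) (\<lambda>(i, j). U i j)) $$ (i, j)
        = (\<Sum>t<M + r. cnj (U t i) * U t j)"
      by (simp add: mat_adjoint_index scalar_prod_def atLeast0LessThan)
    then show "(mat_adjoint (mat (M + r) (N + r) (\<lambda>(i, j). U i j)) * mat (M + r) (N + r) (\<lambda>(i, j). U i j)) $$ (i, j)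
        = 1\<^sub>m (dim_col (mat (M + r) (N + r) (\<lambda>(i, j). U i j))) $$ (i, j)"
      using U[rule_format, OF ij] ij by simp
  qed simp_all
  have diag_mult: "mat r r (\<lambda>(i, j). of_bool (i = j \<and> P i)) * X = mat r n (\<lambda>(i, j). of_bool (P i) * X $$ (i, j))"
    if "X \<in> carrier_mat r n" for P n and X :: "complex mat"
  proof (rule eq_matI)
    fix i j
    assume "i < dim_row (mat r n (\<lambda>(i, j). of_bool (P i) * X $$ (i, j)))"
      "j < dim_col (mat r n (\<lambda>(i, j). of_bool (P i) * X $$ (i, j)))"
    then have ij: "i < r" "j < n" by auto
    then have "(mat r r (\<lambda>(i, j). of_bool (i = j \<and> P i)) * X) $$ (i, j)
        = (\<Sum>s<r. of_bool (i = s \<and> P i) * X $$ (s, j))"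
      using that by (simp add: scalar_prod_def atLeast0LessThan)
    also have "\<dots> = (\<Sum>s<r. if s = i then of_bool (P i) * X $$ (i, j) else 0)"
      by (intro sum.cong refl) auto
    finally show "(mat r r (\<lambda>(i, j). of_bool (i = j \<and> P i)) * X) $$ (i, j)
        = mat r n (\<lambda>(i, j). of_bool (P i) * X $$ (i, j)) $$ (i, j)"
      using ij by simp
  qed (use that in auto)
  have proj: "orthogonal_projection r (mat r r (\<lambda>(i, j). of_bool (i = j \<and> P i)))" for P
    unfolding orthogonal_projection_def
  proof (intro conjI)
    show "mat r r (\<lambda>(i, j). of_bool (i = j \<and> P i)) * mat r r (\<lambda>(i, j). of_bool (i = j \<and> P i))
        = (mat r r (\<lambda>(i, j). of_bool (i = j \<and> P i)) :: complex mat)"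
      by (subst diag_mult[of _ r]) (auto intro!: eq_matI)
    show "mat_adjoint (mat r r (\<lambda>(i, j). of_bool (i = j \<and> P i)))
        = (mat r r (\<lambda>(i, j). of_bool (i = j \<and> P i)) :: complex mat)"
      by (intro eq_matI) (auto simp: mat_adjoint_index)
  qed simp
  show "orthogonal_projection r P1" "orthogonal_projection r P2"
    unfolding P1_def P2_def by (rule proj)+
  show "P1 + P2 = 1\<^sub>m r"
    by (intro eq_matI) (auto simp: P1_def P2_def)
  assume z: "cmod z < 1" and w: "cmod w < 1" and \<Delta>: "\<Delta> = z \<cdot>\<^sub>m P1 + w \<cdot>\<^sub>m P2" and "p \<noteq> 0"
    and Q: "Q \<in> carrier_mat M N"
    and Qeq: "\<And>l k. l < M \<Longrightarrow> k < N \<Longrightarrow> Q $$ (l, k)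
        = p * U l k + (\<Sum>s<r. U l (N + s) * ((if s < r1 then z else w) * F s k))"
    and Feq: "\<And>t k. t < r \<Longrightarrow> k < N \<Longrightarrow> F t k
        = p * U (M + t) k + (\<Sum>s<r. U (M + t) (N + s) * ((if s < r1 then z else w) * F s k))"
  define \<delta> where "\<delta> s = (if s < r1 then z else w)" for s
  have \<Delta>': "\<Delta> = mat r r (\<lambda>(i, j). if i = j then \<delta> i else 0)"
    unfolding \<Delta> by (intro eq_matI) (auto simp: P1_def P2_def \<delta>_def)
  have car\<Delta>: "\<Delta> \<in> carrier_mat r r" by (simp add: \<Delta>')
  have Dd: "(D * \<Delta>) $$ (t, s) = U (M + t) (N + s) * \<delta> s" if "t < r" "s < r" for t s
  proof -
    have "(D * \<Delta>) $$ (t, s) = (\<Sum>i<r. U (M + t) (N + i) * (if i = s then \<delta> i else 0))"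
      using that by (simp add: D_def \<Delta>' scalar_prod_def atLeast0LessThan)
    also have "\<dots> = (\<Sum>i<r. if i = s then U (M + t) (N + s) * \<delta> s else 0)"
      by (intro sum.cong refl) auto
    finally show ?thesis using that by simp
  qed
  have Bd: "(B * \<Delta>) $$ (l, s) = U l (N + s) * \<delta> s" if "l < M" "s < r" for l s
  proof -
    have "(B * \<Delta>) $$ (l, s) = (\<Sum>i<r. U l (N + i) * (if i = s then \<delta> i else 0))"
      using that by (simp add: B_def \<Delta>' scalar_prod_def atLeast0LessThan)
    also have "\<dots> = (\<Sum>i<r. if i = s then U l (N + s) * \<delta> s else 0)"
      by (intro sum.cong refl) auto
    finally show ?thesis using that by simp
  qed
  have carDD: "D * \<Delta> \<in> carrier_mat r r" and carBD: "B * \<Delta> \<in> carrier_mat M r"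
    using car car\<Delta> by auto
  define T where "T = 1\<^sub>m r - D * \<Delta>"
  have dimB: "dim_row (B * \<Delta>) = M" "dim_col (B * \<Delta>) = r" using carBD by auto
  have carT: "T \<in> carrier_mat r r" using carDD by (simp add: T_def minus_carrier_mat)
  have T_index: "T $$ (t, s) = of_bool (t = s) - U (M + t) (N + s) * \<delta> s" if "t < r" "s < r" for t s
  proof -
    have "T $$ (t, s) = 1\<^sub>m r $$ (t, s) - (D * \<Delta>) $$ (t, s)"
      unfolding T_def using that carDD by (intro index_minus_mat) auto
    then show ?thesis using that by (simp add: Dd)
  qed
  have dimT: "dim_row T = r" "dim_col T = r" using carT by auto
  have inj: "v = 0\<^sub>v r" if v: "v \<in> carrier_vec r" and Tv: "T *\<^sub>v v = 0\<^sub>v r" for v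
  proof -
    \<comment> \<open>The vector \<open>(0, \<Delta> v)\<close>: a null vector \<open>v\<close> of
      \<open>T\<close> satisfies \<open>v = D \<Delta> v\<close>, which is the lower part of
      \<open>U x\<close>.\<close>
    define x where "x s = (if s < N then 0 else \<delta> (s - N) * v $ (s - N))" for s
    have vx: "v $ t = (\<Sum>s<N + r. U (M + t) s * x s)" if "t < r" for t
    proof -
      have "(T *\<^sub>v v) $ t = (\<Sum>s<r. (of_bool (t = s) - U (M + t) (N + s) * \<delta> s) * v $ s)"
        using that v by (simp add: dimT scalar_prod_def atLeast0LessThan T_index)
      also have "\<dots> = (\<Sum>s<r. (if s = t then v $ s else 0)) - (\<Sum>s<r. U (M + t) (N + s) * (\<delta> s * v $ s))"
        unfolding sum_subtractf[symmetric] by (intro sum.cong refl) (auto simp: algebra_simps)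
      finally show ?thesis using Tv that by (simp add: sum_lessThan_add x_def)
    qed
    define \<rho> where "\<rho> = (max (cmod z) (cmod w))\<^sup>2"
    have "\<rho> < 1" using z w by (simp add: \<rho>_def power_less_one_iff abs_square_less_1 le_max_iff_disj)
    have "(\<Sum>t<r. (cmod (v $ t))\<^sup>2) = (\<Sum>t<r. (cmod (\<Sum>s<N + r. U (M + t) s * x s))\<^sup>2)"
      using vx by (intro sum.cong refl) auto
    also have "\<dots> \<le> (\<Sum>t<M + r. (cmod (\<Sum>s<N + r. U t s * x s))\<^sup>2)"
      by (simp add: sum_lessThan_add[of _ M] sum_nonneg)
    also have "\<dots> = (\<Sum>s<N + r. (cmod (x s))\<^sup>2)" by (rule isometry_norm_eq) (rule U[rule_format])
    also have "\<dots> = (\<Sum>s<r. (cmod (\<delta> s))\<^sup>2 * (cmod (v $ s))\<^sup>2)"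
      by (simp add: sum_lessThan_add x_def norm_mult power_mult_distrib)
    also have "\<dots> \<le> (\<Sum>s<r. \<rho> * (cmod (v $ s))\<^sup>2)"
      unfolding \<rho>_def by (intro sum_mono mult_right_mono power_mono) (auto simp: \<delta>_def)
    also have "\<dots> = \<rho> * (\<Sum>s<r. (cmod (v $ s))\<^sup>2)" by (simp add: sum_distrib_left)
    finally have "(1 - \<rho>) * (\<Sum>s<r. (cmod (v $ s))\<^sup>2) \<le> 0" by (simp add: algebra_simps)
    then have "(\<Sum>s<r. (cmod (v $ s))\<^sup>2) \<le> 0"
      using \<open>\<rho> < 1\<close> by (simp add: mult_le_0_iff)
    then have "(\<Sum>s<r. (cmod (v $ s))\<^sup>2) = 0" by (simp add: sum_nonneg order.antisym)
    then show "v = 0\<^sub>v r" using v by (intro eq_vecI) (auto simp: sum_nonneg_eq_0_iff)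
  qed
  obtain R where R: "mat_inverse T = Some R" "R * T = 1\<^sub>m r" "R \<in> carrier_mat r r"
    by (rule mat_inverse_SomeI[OF carT inj])
  define FF where "FF = mat r N (\<lambda>(s, k). F s k)"
  have carF: "FF \<in> carrier_mat r N" by (simp add: FF_def)
  have TF: "T * FF = p \<cdot>\<^sub>m C"
  proof (rule eq_matI)
    fix t k assume "t < dim_row (p \<cdot>\<^sub>m C)" "k < dim_col (p \<cdot>\<^sub>m C)"
    then have tk: "t < r" "k < N" using car by auto
    have "(T * FF) $$ (t, k) = (\<Sum>s<r. (of_bool (t = s) - U (M + t) (N + s) * \<delta> s) * F s k)"
      using tk by (simp add: FF_def dimT scalar_prod_def atLeast0LessThan T_index)
    also have "\<dots> = (\<Sum>s<r. (if s = t then F s k else 0)) - (\<Sum>s<r. U (M + t) (N + s) * (\<delta> s * F s k))"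
      unfolding sum_subtractf[symmetric] by (intro sum.cong refl) (auto simp: algebra_simps)
    also have "\<dots> = p * U (M + t) k" using Feq[OF tk] tk by (simp add: \<delta>_def)
    finally show "(T * FF) $$ (t, k) = (p \<cdot>\<^sub>m C) $$ (t, k)" using tk by (simp add: C_def)
  qed (use carT carF car in auto)
  have "FF = (R * T) * FF" using R(2) carF by simp
  also have "\<dots> = R * (T * FF)" by (rule assoc_mult_mat[OF R(3) carT carF])
  also have "\<dots> = p \<cdot>\<^sub>m (R * C)"
    unfolding TF by (rule mult_smult_distrib[OF R(3) car(3)])
  finally have FR: "FF = p \<cdot>\<^sub>m (R * C)" .
  have "Q = p \<cdot>\<^sub>m A + (B * \<Delta>) * FF"
  proof (rule eq_matI)
    fix l k assume "l < dim_row (p \<cdot>\<^sub>m A + (B * \<Delta>) * FF)" "k < dim_col (p \<cdot>\<^sub>m A + (B * \<Delta>) * FF)"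
    then have lk: "l < M" "k < N" using car carF carBD by auto
    have "((B * \<Delta>) * FF) $$ (l, k) = (\<Sum>s<r. U l (N + s) * \<delta> s * F s k)"
      using lk by (simp add: FF_def dimB scalar_prod_def atLeast0LessThan Bd del: assoc_mult_mat index_mult_mat(2,3))
    then show "Q $$ (l, k) = (p \<cdot>\<^sub>m A + (B * \<Delta>) * FF) $$ (l, k)"
      using Qeq[OF lk] lk car carF carBD by (simp add: A_def \<delta>_def mult.assoc)
  qed (use Q car carF carBD in auto)
  also have "\<dots> = p \<cdot>\<^sub>m (A + B * \<Delta> * R * C)"
  proof -
    have carRC: "R * C \<in> carrier_mat r N" using R(3) car by simp
    have "(B * \<Delta>) * FF = p \<cdot>\<^sub>m ((B * \<Delta>) * (R * C))"
      unfolding FR by (rule mult_smult_distrib[OF carBD carRC])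
    also have "(B * \<Delta>) * (R * C) = B * \<Delta> * R * C"
      by (rule assoc_mult_mat[OF carBD R(3) car(3), symmetric])
    finally have "(B * \<Delta>) * FF = p \<cdot>\<^sub>m (B * \<Delta> * R * C)" .
    moreover have "B * \<Delta> * R * C \<in> carrier_mat M N" using carBD R(3) car by auto
    ultimately show ?thesis using add_smult_distrib_left_mat[OF car(1), of "B * \<Delta> * R * C" p] by simp
  qed
  finally have "inverse p \<cdot>\<^sub>m Q = inverse p \<cdot>\<^sub>m (p \<cdot>\<^sub>m (A + B * \<Delta> * R * C))" by simp
  also have "\<dots> = A + B * \<Delta> * R * C"
    using \<open>p \<noteq> 0\<close> by (intro eq_matI) auto
  finally show "\<exists>R. mat_inverse (1\<^sub>m r - D * \<Delta>) = Some R \<and> inverse p \<cdot>\<^sub>m Q = A + B * \<Delta> * R * C"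
    using R(1) unfolding T_def by blast
qed

section \<open>Reduction to lowest terms and the theorem\<close>

lemma eval2_mult: "eval2 (a * b) z = eval2 a z * eval2 b z"
  by (simp add: eval2_def)

lemma eval2_eq_sum:
  assumes "degree q \<le> d2" "\<And>j. degree (coeff q j) \<le> d1"
  shows "eval2 q (z, w) = (\<Sum>j\<le>d2. \<Sum>i\<le>d1. coeff (coeff q j) i * z ^ i * w ^ j)"
proof -
  have alt: "poly r x = (\<Sum>i\<le>d. coeff r i * x ^ i)" if "degree r \<le> d" for r :: "'a::comm_semiring_1 poly" and d x
    unfolding poly_altdef using that by (intro sum.mono_neutral_left) (auto simp: coeff_eq_0)
  have "eval2 q (z, w) = (\<Sum>j\<le>d2. poly (coeff q j) z * w ^ j)"
    by (simp add: eval2_def alt[OF assms(1)] poly_sum)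
  then show ?thesis
    by (simp add: alt[OF assms(2)] sum_distrib_right)
qed

lemma bidegree_bound:
  fixes A :: "complex poly poly set"
  assumes "finite A"
  shows "\<exists>d1 d2. \<forall>q\<in>A. degree q \<le> d2 \<and> (\<forall>j. degree (coeff q j) \<le> d1)"
  using assms
proof (induction A rule: finite_induct)
  case (insert q A)
  then obtain d1 d2 where d: "\<forall>q\<in>A. degree q \<le> d2 \<and> (\<forall>j. degree (coeff q j) \<le> d1)" by blast
  define e where "e = (\<Sum>j\<le>degree q. degree (coeff q j))"
  have e: "degree (coeff q j) \<le> e" for j
  proof (cases "j \<le> degree q")
    case True
    then show ?thesis unfolding e_def by (intro member_le_sum) auto
  next
    case False
    then show ?thesis by (simp add: coeff_eq_0)
  qed
  show ?case
    using d e by (intro exI[of _ "max d1 e"] exI[of _ "max d2 (degree q)"]) (auto simp: le_max_iff_disj)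
qed simp

text \<open>\<open>g\<close> is the gcd of \<open>p\<close> and all entries of \<open>Q\<close>. The
  last clause is Euclid's lemma for the joint coprimality of \<open>p'\<close> and the entries of
  \<open>Q'\<close>, obtained from \<open>Gcd_mult\<close>; it makes \<open>p'\<close> a divisor of
  the denominator of every equal fraction.\<close>

lemma lowest_terms:
  fixes p :: "complex poly poly" and Q :: "complex poly poly mat"
  assumes "p \<noteq> 0"
  shows "\<exists>g p' Q'. p = g * p' \<and> g \<noteq> 0 \<and> Q = map_mat (\<lambda>q. g * q) Q'
    \<and> (\<forall>b. (\<forall>i<dim_row Q. \<forall>j<dim_col Q. p' dvd b * Q' $$ (i, j)) \<longrightarrow> p' dvd b)"
proof -
  define A where "A = insert p (elements_mat Q)"
  define g where "g = Gcd A"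
  have gd: "g dvd a" if "a \<in> A" for a unfolding g_def using that by (rule Gcd_dvd)
  have "g dvd p" by (rule gd) (simp add: A_def)
  then have "g \<noteq> 0" using assms by auto
  define p' where "p' = p div g"
  define Q' where "Q' = map_mat (\<lambda>q. q div g) Q"
  have p: "p = g * p'" using \<open>g dvd p\<close> by (simp add: p'_def)
  have entry: "Q $$ (i, j) = g * Q' $$ (i, j)" if "i < dim_row Q" "j < dim_col Q" for i j
  proof -
    have "Q $$ (i, j) \<in> elements_mat Q" using that by (intro elements_matI[OF carrier_matI]) auto
    then have "Q $$ (i, j) \<in> A" by (simp add: A_def)
    then show ?thesis using gd that by (simp add: Q'_def)
  qed
  have Q: "Q = map_mat (\<lambda>q. g * q) Q'"
  proof (rule eq_matI)
    have dims: "dim_row Q' = dim_row Q" "dim_col Q' = dim_col Q" by (simp_all add: Q'_def)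
    then show "dim_row Q = dim_row (map_mat (\<lambda>q. g * q) Q')" "dim_col Q = dim_col (map_mat (\<lambda>q. g * q) Q')"
      by simp_all
    show "Q $$ (i, j) = map_mat (\<lambda>q. g * q) Q' $$ (i, j)"
      if "i < dim_row (map_mat (\<lambda>q. g * q) Q')" "j < dim_col (map_mat (\<lambda>q. g * q) Q')" for i j
      using that dims entry by simp
  qed
  have "p' dvd b" if b: "\<forall>i<dim_row Q. \<forall>j<dim_col Q. p' dvd b * Q' $$ (i, j)" for b
  proof -
    have "g * p' dvd b * a" if "a \<in> A" for a
    proof (cases "a = p")
      case True
      then show ?thesis using p by simp
    next
      case False
      then have "a \<in> elements_mat Q" using that by (simp add: A_def)
      then obtain i j where ij: "i < dim_row Q" "j < dim_col Q" "a = Q $$ (i, j)"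
        by blast
      have "b * a = g * (b * Q' $$ (i, j))"
        unfolding ij(3) entry[OF ij(1,2)] by (simp only: mult.left_commute)
      moreover have "g * p' dvd g * (b * Q' $$ (i, j))" using b ij by (intro mult_dvd_mono) auto
      ultimately show ?thesis by (simp only:)
    qed
    then have "g * p' dvd Gcd ((*) b ` A)" by (intro Gcd_greatest) auto
    also have "Gcd ((*) b ` A) = normalize (b * g)" by (simp add: Gcd_mult g_def)
    finally have "g * p' dvd g * b" by (simp add: mult.commute)
    then show "p' dvd b" using \<open>g \<noteq> 0\<close> by simp
  qed
  then show ?thesis using p \<open>g \<noteq> 0\<close> Q by blast
qed

section \<open>Zeros of the denominator on slices and on the torus\<close>

text \<open>The bad values are the constant roots of \<open>p\<close>, viewed as a polynomial in
  \<open>z2\<close> over the integral domain of polynomials in \<open>z1\<close>.\<close>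

lemma finite_bad_slices:
  fixes p :: "complex poly poly"
  assumes "p \<noteq> 0"
  shows "finite {w. poly p [:w:] = 0}"
proof -
  have "finite {x. poly p x = 0}" using assms by (rule poly_roots_finite)
  then have "finite ((\<lambda>w. [:w:]) -` {x. poly p x = 0})"
    by (rule finite_vimageI) (simp add: inj_on_def)
  then show ?thesis by (simp add: vimage_def)
qed

lemma continuous_on_eval2:
  assumes "continuous_on S f" "continuous_on S g"
  shows "continuous_on S (\<lambda>x. eval2 q (f x, g x))"
proof -
  obtain d1 d2 where "degree q \<le> d2" "\<And>j. degree (coeff q j) \<le> d1"
    using bidegree_bound[of "{q}"] by auto
  then have "eval2 q (z, w) = (\<Sum>j\<le>d2. \<Sum>i\<le>d1. coeff (coeff q j) i * z ^ i * w ^ j)" for z w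
    by (rule eval2_eq_sum)
  then show ?thesis by (simp only:) (intro continuous_intros assms)
qed

text \<open>Hurwitz: zero-free slices at radius \<open>t < 1\<close> converge to the slice at the boundary point.\<close>

lemma slice_no_zeros:
  assumes "\<And>z. z \<in> bidisk \<Longrightarrow> eval2 p z \<noteq> 0" "cmod w = 1" "poly p [:w:] \<noteq> 0" "cmod z0 < 1"
  shows "eval2 p (z0, w) \<noteq> 0"
proof -
  let ?B = "ball (0 :: complex) 1"
  define g where "g z = eval2 p (z, w)" for z
  define t where "t n = 1 - 1 / (real n + 2)" for n
  define f where "f n z = eval2 p (z, complex_of_real (t n) * w)" for n z
  have g: "g z = poly (poly p [:w:]) z" for z by (simp add: g_def eval2_def)
  have f: "f n z = poly (poly p [:complex_of_real (t n) * w:]) z" for n z by (simp add: f_def eval2_def)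
  have t: "0 \<le> t n" "t n < 1" for n by (simp_all add: t_def field_simps)
  \<comment> \<open>Hurwitz's theorem needs a nonconstant limit. A constant slice is nonzero because
    it does not vanish identically.\<close>
  show ?thesis
  proof (cases "g constant_on ?B")
    case True
    then obtain c where c: "\<And>z. z \<in> ?B \<Longrightarrow> g z = c" by (auto simp: constant_on_def)
    have "c \<noteq> 0"
    proof
      assume "c = 0"
      then have "?B \<subseteq> {z. poly (poly p [:w:]) z = 0}" using c g by auto
      moreover have "finite {z. poly (poly p [:w:]) z = 0}" using assms(3) by (rule poly_roots_finite)
      ultimately have "finite ?B" by (rule finite_subset)
      moreover have "open ?B" "?B \<noteq> {}" by simp_all
      ultimately show False using finite_imp_not_open by blast
    qed
    then show ?thesis using c[of z0] assms(4) by (simp add: g_def)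
  next
    case False
    have "g z0 \<noteq> 0"
    proof (rule Hurwitz_no_zeros[of ?B f g])
      show "f n holomorphic_on ?B" for n unfolding f by (intro holomorphic_intros)
      show "g holomorphic_on ?B" unfolding g by (intro holomorphic_intros)
      show "f n z \<noteq> 0" if "z \<in> ?B" for n z
        unfolding f_def using that t[of n] assms(2)
        by (intro assms(1)) (simp add: bidisk_def norm_mult)
      show "\<not> g constant_on ?B" by (rule False)
      show "uniform_limit K f g sequentially" if "compact K" "K \<subseteq> ?B" for K
      proof (rule uniform_limitI)
        fix e :: real assume "0 < e"
        let ?C = "K \<times> {0..1::real}"
        \<comment> \<open>Uniform continuity on a compact product, with the radius as an extra
          variable, gives convergence uniform in \<open>z\<close>.\<close>
        define \<phi> where "\<phi> x = eval2 p (fst x, complex_of_real (snd x) * w)" for x :: "complex \<times> real"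
        have "continuous_on ?C \<phi>"
          unfolding \<phi>_def by (intro continuous_on_eval2 continuous_intros)
        moreover have "compact ?C" using that by (intro compact_Times) auto
        ultimately have "uniformly_continuous_on ?C \<phi>" by (rule compact_uniformly_continuous)
        then obtain d where d: "0 < d" "\<And>x x'. x \<in> ?C \<Longrightarrow> x' \<in> ?C \<Longrightarrow> dist x' x < d \<Longrightarrow> dist (\<phi> x') (\<phi> x) < e"
          using \<open>0 < e\<close> unfolding uniformly_continuous_on_def by metis
        have "t \<longlonglongrightarrow> 1" unfolding t_def by real_asymp
        then have "\<forall>\<^sub>F n in sequentially. dist (t n) 1 < d" using d(1) by (rule tendstoD)
        then show "\<forall>\<^sub>F n in sequentially. \<forall>z\<in>K. dist (f n z) (g z) < e"
        proof (rule eventually_mono)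
          fix n assume n: "dist (t n) 1 < d"
          show "\<forall>z\<in>K. dist (f n z) (g z) < e"
          proof
            fix z assume "z \<in> K"
            then have "dist (\<phi> (z, t n)) (\<phi> (z, 1)) < e"
              using t[of n] n by (intro d(2)) (auto simp: dist_Pair_Pair)
            then show "dist (f n z) (g z) < e" by (simp add: \<phi>_def f_def g_def)
          qed
        qed
      qed
    qed (use assms(4) in auto)
    then show ?thesis by (simp add: g_def)
  qed
qed

text \<open>For all but finitely many \<open>w\<close> the slice of \<open>p\<close> has finitely
  many zeros in \<open>z\<close>. \<open>sphere_finite_exception\<close> is used first in
  \<open>z\<close> and then in \<open>w\<close>, for \<open>f\<close> and for \<open>- f\<close>;
  separate continuity suffices.\<close>

lemma torus_density:
  fixes f :: "complex \<Rightarrow> complex \<Rightarrow> real"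
  assumes "p \<noteq> 0"
    and "\<And>w. continuous_on UNIV (\<lambda>z. f z w)" "\<And>z. continuous_on UNIV (\<lambda>w. f z w)"
    and "\<And>z w. (z, w) \<in> two_torus \<Longrightarrow> eval2 p (z, w) \<noteq> 0 \<Longrightarrow> f z w = 0"
    and "cmod z = 1" "cmod w = 1"
  shows "f z w = 0"
proof -
  have nonneg: "0 \<le> h z w" if "\<And>w. continuous_on UNIV (\<lambda>z. h z w)" "\<And>z. continuous_on UNIV (\<lambda>w. h z w)"
    "\<And>z w. (z, w) \<in> two_torus \<Longrightarrow> eval2 p (z, w) \<noteq> 0 \<Longrightarrow> h z w = 0" for h :: "complex \<Rightarrow> complex \<Rightarrow> real"
  proof (rule sphere_finite_exception[OF finite_bad_slices[OF assms(1)] that(2) _ assms(6)])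
    fix w assume w: "cmod w = 1" "w \<notin> {w. poly p [:w:] = 0}"
    then have fin: "finite {z. poly (poly p [:w:]) z = 0}" by (intro poly_roots_finite) simp
    show "0 \<le> h z w"
      by (rule sphere_finite_exception[OF fin that(1) _ assms(5)])
        (use w that(3) in \<open>auto simp: two_torus_def eval2_def\<close>)
  qed
  have "0 \<le> f z w" by (rule nonneg) (use assms(2-4) in auto)
  moreover have "0 \<le> - f z w"
    by (rule nonneg[of "\<lambda>z w. - f z w"]) (use assms(2-4) in \<open>auto intro: continuous_on_minus\<close>)
  ultimately show ?thesis by simp
qed

theorem theorem1p1:
  fixes M N :: nat
    and S :: "complex \<times> complex \<Rightarrow> complex mat"
    and Q :: "complex poly poly mat"
    and p :: "complex poly poly"
  assumes "rational_mat_function M N Q p S"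
    and "poles Q p \<inter> bidisk = {}"
    and "\<And>z. z \<in> two_torus \<Longrightarrow> eval2 p z \<noteq> 0 \<Longrightarrow> mat_adjoint (S z) * S z = 1\<^sub>m N"
  shows "\<exists>(r::nat) A B C D P1 P2.
           A \<in> carrier_mat M N \<and> B \<in> carrier_mat M r \<and>
           C \<in> carrier_mat r N \<and> D \<in> carrier_mat r r \<and>
           isometric_mat (four_block_mat A B C D) \<and>
           orthogonal_projection r P1 \<and> orthogonal_projection r P2 \<and> P1 + P2 = 1\<^sub>m r \<and>
           (\<forall>(z1, z2) \<in> bidisk.
              let \<Delta> = z1 \<cdot>\<^sub>m P1 + z2 \<cdot>\<^sub>m P2
              in \<exists>R. mat_inverse (1\<^sub>m r - D * \<Delta>) = Some R \<and>
                     S (z1, z2) = A + B * \<Delta> * R * C)"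
proof -
  have Q: "Q \<in> carrier_mat M N" and "p \<noteq> 0"
    and Sfrac: "\<And>Q' p' z. same_fraction Q p Q' p' \<Longrightarrow> eval2 p' z \<noteq> 0 \<Longrightarrow> S z = quotient_at Q' p' z"
    using assms(1) by (auto simp: rational_mat_function_def)
  obtain g p' Q' where p: "p = g * p'" and "g \<noteq> 0" and Qg: "Q = map_mat (\<lambda>q. g * q) Q'"
    and low: "\<forall>b. (\<forall>i<dim_row Q. \<forall>j<dim_col Q. p' dvd b * Q' $$ (i, j)) \<longrightarrow> p' dvd b"
    using lowest_terms[OF \<open>p \<noteq> 0\<close>, of Q] by (elim exE conjE) (rule that; assumption)
  have Q': "Q' \<in> carrier_mat M N" using Q Qg by auto
  have "p' \<noteq> 0" using \<open>p \<noteq> 0\<close> p by auto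
  have "same_fraction Q p Q' p'"
    unfolding same_fraction_def Qg p by (rule eq_matI) auto
  then have S: "S z = quotient_at Q' p' z" if "eval2 p' z \<noteq> 0" for z using Sfrac that by blast
  \<comment> \<open>Since \<open>z\<close> is not a pole, some equal fraction has a denominator that
    is nonzero at \<open>z\<close>, and the reduced \<open>p'\<close> divides that
    denominator.\<close>
  have nz: "eval2 p' z \<noteq> 0" if z: "z \<in> bidisk" for z
  proof -
    obtain Q'' p'' where frac: "p'' \<cdot>\<^sub>m Q = p \<cdot>\<^sub>m Q''" and nz: "eval2 p'' z \<noteq> 0"
    proof -
      have "z \<notin> poles Q p" using assms(2) z by blast
      then show thesis using that unfolding poles_def same_fraction_def by blast
    qed
    have "p' dvd p'' * Q' $$ (i, j)" if ij: "i < dim_row Q" "j < dim_col Q" for i j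
    proof -
      have dims: "dim_row Q'' = dim_row Q" "dim_col Q'' = dim_col Q"
        using arg_cong[OF frac, of dim_row] arg_cong[OF frac, of dim_col] by simp_all
      have "(p'' \<cdot>\<^sub>m Q) $$ (i, j) = (p \<cdot>\<^sub>m Q'') $$ (i, j)" using frac by simp
      then have "p'' * Q $$ (i, j) = p * Q'' $$ (i, j)" using ij dims by simp
      moreover have "Q $$ (i, j) = g * Q' $$ (i, j)" using ij Q Q' by (simp add: Qg)
      ultimately have "g * (p'' * Q' $$ (i, j)) = g * (p' * Q'' $$ (i, j))" by (simp add: p mult_ac)
      then show ?thesis using \<open>g \<noteq> 0\<close> by simp
    qed
    then have "p' dvd p''" using low by blast
    then show ?thesis using nz by (auto simp: eval2_mult elim!: dvdE)
  qed
  have "finite (insert p' (elements_mat Q'))" by (simp add: elements_mat_def)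
  then obtain d1 d2 where deg: "\<forall>q\<in>insert p' (elements_mat Q'). degree q \<le> d2 \<and> (\<forall>j. degree (coeff q j) \<le> d1)"
    using bidegree_bound by blast
  define pc where "pc i j = coeff (coeff p' j) i" for i j
  define qc where "qc l k i j = coeff (coeff (Q' $$ (l, k)) j) i" for l k i j
  have pe: "(\<Sum>j\<le>d2. \<Sum>i\<le>d1. pc i j * z ^ i * w ^ j) = eval2 p' (z, w)" for z w
    unfolding pc_def using deg by (intro eval2_eq_sum[symmetric]) auto
  have qe: "(\<Sum>j\<le>d2. \<Sum>i\<le>d1. qc l k i j * z ^ i * w ^ j) = eval2 (Q' $$ (l, k)) (z, w)"
    if "l < M" "k < N" for l k z w
  proof -
    have "Q' $$ (l, k) \<in> elements_mat Q'" using that by (intro elements_matI[OF Q']) auto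
    then show ?thesis unfolding qc_def using deg by (intro eval2_eq_sum[symmetric]) auto
  qed
  have pe': "(\<Sum>i\<le>d1. (\<Sum>j\<le>d2. pc i j * w ^ j) * z ^ i) = eval2 p' (z, w)" for z w
    unfolding pe[symmetric] sum_distrib_right by (subst sum.swap) (simp add: mult_ac)
  interpret torus_isometry M N d1 d2 pc qc
  proof
    fix z w :: complex and v :: "nat \<Rightarrow> complex"
    assume zw: "cmod z = 1" "cmod w = 1"
    define f where "f z w = (\<Sum>l<M. (cmod (\<Sum>k<N. (\<Sum>j\<le>d2. \<Sum>i\<le>d1. qc l k i j * z ^ i * w ^ j) * v k))\<^sup>2)
      - (cmod (\<Sum>j\<le>d2. \<Sum>i\<le>d1. pc i j * z ^ i * w ^ j))\<^sup>2 * (\<Sum>k<N. (cmod (v k))\<^sup>2)" for z w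
    \<comment> \<open>The hypothesis on \<open>S\<close> gives this off the zeros of the original
      \<open>p\<close>; cleared of denominators, the identity is continuous and extends to the whole
      torus.\<close>
    have "f z w = 0"
    proof (rule torus_density[OF \<open>p \<noteq> 0\<close> _ _ _ zw])
      show "continuous_on UNIV (\<lambda>z. f z w)" for w unfolding f_def by (intro continuous_intros)
      show "continuous_on UNIV (\<lambda>w. f z w)" for z unfolding f_def by (intro continuous_intros)
      fix z w assume T: "(z, w) \<in> two_torus" and pz: "eval2 p (z, w) \<noteq> 0"
      define e where "e = eval2 p' (z, w)"
      have e: "e \<noteq> 0" using pz by (simp add: p eval2_mult e_def)
      define s where "s l k = inverse e * eval2 (Q' $$ (l, k)) (z, w)" for l k
      have Sz: "S (z, w) = mat M N (\<lambda>(l, k). s l k)"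
        using S[of "(z, w)"] e Q' by (intro eq_matI) (auto simp: quotient_at_def e_def s_def)
      have orth: "(\<Sum>l<M. cnj (s l k) * s l k') = of_bool (k = k')" if "k < N" "k' < N" for k k'
      proof -
        have "(mat_adjoint (S (z, w)) * S (z, w)) $$ (k, k') = (\<Sum>l<M. cnj (s l k) * s l k')"
          using that by (simp add: Sz mat_adjoint_index scalar_prod_def atLeast0LessThan)
        moreover have "1\<^sub>m N $$ (k, k') = (of_bool (k = k') :: complex)" using that by simp
        ultimately show ?thesis using assms(3)[OF T pz] by metis
      qed
      have "(\<Sum>l<M. (cmod (\<Sum>k<N. (\<Sum>j\<le>d2. \<Sum>i\<le>d1. qc l k i j * z ^ i * w ^ j) * v k))\<^sup>2)
          = (\<Sum>l<M. (cmod e)\<^sup>2 * (cmod (\<Sum>k<N. s l k * v k))\<^sup>2)"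
      proof (rule sum.cong[OF refl])
        fix l assume l: "l \<in> {..<M}"
        have "(\<Sum>k<N. (\<Sum>j\<le>d2. \<Sum>i\<le>d1. qc l k i j * z ^ i * w ^ j) * v k) = (\<Sum>k<N. e * (s l k * v k))"
          using l e by (intro sum.cong refl) (simp add: qe s_def)
        then show "(cmod (\<Sum>k<N. (\<Sum>j\<le>d2. \<Sum>i\<le>d1. qc l k i j * z ^ i * w ^ j) * v k))\<^sup>2
            = (cmod e)\<^sup>2 * (cmod (\<Sum>k<N. s l k * v k))\<^sup>2"
          by (simp only: sum_distrib_left[symmetric] norm_mult power_mult_distrib)
      qed
      also have "\<dots> = (cmod e)\<^sup>2 * (\<Sum>k<N. (cmod (v k))\<^sup>2)"
        using isometry_norm_eq[OF orth, where x = v] by (simp add: sum_distrib_left[symmetric])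
      finally show "f z w = 0" by (simp add: f_def pe e_def)
    qed
    then show "(\<Sum>l<M. (cmod (\<Sum>k<N. (\<Sum>j\<le>d2. \<Sum>i\<le>d1. qc l k i j * z ^ i * w ^ j) * v k))\<^sup>2)
      = (cmod (\<Sum>j\<le>d2. \<Sum>i\<le>d1. pc i j * z ^ i * w ^ j))\<^sup>2 * (\<Sum>k<N. (cmod (v k))\<^sup>2)"
      by (simp add: f_def)
  next
    show "\<exists>Z. finite Z \<and> (\<forall>w z. cmod w = 1 \<longrightarrow> w \<notin> Z \<longrightarrow> cmod z < 1 \<longrightarrow>
      (\<Sum>i\<le>d1. (\<Sum>j\<le>d2. pc i j * w ^ j) * z ^ i) \<noteq> 0)"
      using finite_bad_slices[OF \<open>p' \<noteq> 0\<close>] slice_no_zeros[OF nz]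
      unfolding pe' by (intro exI[of _ "{w. poly p' [:w:] = 0}"]) auto
  next
    fix w :: complex assume "cmod w < 1"
    then have "eval2 p' (0, w) \<noteq> 0" by (intro nz) (simp add: bidisk_def)
    moreover have "eval2 p' (0, w) = (\<Sum>j\<le>d2. pc 0 j * w ^ j)"
      unfolding pe[symmetric] by (simp add: sum.atMost_shift)
    ultimately show "(\<Sum>j\<le>d2. pc 0 j * w ^ j) \<noteq> 0" by simp
  qed
  obtain r1 r2 :: nat and U F where
    U: "\<forall>s<N + (r1 + r2). \<forall>s'<N + (r1 + r2). (\<Sum>t<M + (r1 + r2). cnj (U t s) * U t s') = of_bool (s = s')"
    and qF: "\<forall>z w. \<forall>k<N. \<forall>l<M. qv l k z w
        = pv z w * U l k + (\<Sum>s<r1 + r2. U l (N + s) * ((if s < r1 then z else w) * F z w s k))"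
    and FF: "\<forall>z w. \<forall>k<N. \<forall>t<r1 + r2. F z w t k
        = pv z w * U (M + t) k + (\<Sum>s<r1 + r2. U (M + t) (N + s) * ((if s < r1 then z else w) * F z w s k))"
    using transfer_equations by (elim exE conjE) (rule that; assumption)
  note R = realization_of_equations[OF U]
  define r where "r = r1 + r2"
  define A where "A = mat M N (\<lambda>(i, j). U i j)"
  define B where "B = mat M r (\<lambda>(i, j). U i (N + j))"
  define C where "C = mat r N (\<lambda>(i, j). U (M + i) j)"
  define D where "D = mat r r (\<lambda>(i, j). U (M + i) (N + j))"
  define P1 :: "complex mat" where "P1 = mat r r (\<lambda>(i, j). of_bool (i = j \<and> i < r1))"
  define P2 :: "complex mat" where "P2 = mat r r (\<lambda>(i, j). of_bool (i = j \<and> r1 \<le> i))"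
  note R = R[folded r_def, folded A_def B_def C_def D_def P1_def P2_def]
  have main: "\<exists>R. mat_inverse (1\<^sub>m r - D * (z \<cdot>\<^sub>m P1 + w \<cdot>\<^sub>m P2)) = Some R
      \<and> S (z, w) = A + B * (z \<cdot>\<^sub>m P1 + w \<cdot>\<^sub>m P2) * R * C" if zw: "(z, w) \<in> bidisk" for z w
  proof -
    have pv: "pv z w = eval2 p' (z, w)" by (simp add: pv_def pe)
    have "S (z, w) = inverse (pv z w) \<cdot>\<^sub>m map_mat (\<lambda>q. eval2 q (z, w)) Q'"
      using S[OF nz[OF zw]] by (simp add: quotient_at_def pv)
    moreover have "\<exists>R. mat_inverse (1\<^sub>m r - D * (z \<cdot>\<^sub>m P1 + w \<cdot>\<^sub>m P2)) = Some R
      \<and> inverse (pv z w) \<cdot>\<^sub>m map_mat (\<lambda>q. eval2 q (z, w)) Q' = A + B * (z \<cdot>\<^sub>m P1 + w \<cdot>\<^sub>m P2) * R * C"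
    proof (rule R(5)[OF _ _ refl])
      show "cmod z < 1" "cmod w < 1" using zw by (simp_all add: bidisk_def)
      show "pv z w \<noteq> 0" using nz[OF zw] pv by simp
      show "map_mat (\<lambda>q. eval2 q (z, w)) Q' \<in> carrier_mat M N" using Q' by simp
      show "map_mat (\<lambda>q. eval2 q (z, w)) Q' $$ (l, k)
          = pv z w * U l k + (\<Sum>s<r. U l (N + s) * ((if s < r1 then z else w) * F z w s k))"
        if "l < M" "k < N" for l k
        using qF[rule_format, OF that(2,1), of z w] qe[OF that, of z w] that Q' by (simp add: qv_def r_def)
      show "F z w t k = pv z w * U (M + t) k + (\<Sum>s<r. U (M + t) (N + s) * ((if s < r1 then z else w) * F z w s k))"
        if "t < r" "k < N" for t k
        using FF[rule_format, OF that(2), of t z w] that(1) by (simp add: r_def)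
    qed
    ultimately show ?thesis by simp
  qed
  have "\<forall>(z1, z2) \<in> bidisk. let \<Delta> = z1 \<cdot>\<^sub>m P1 + z2 \<cdot>\<^sub>m P2
      in \<exists>R. mat_inverse (1\<^sub>m r - D * \<Delta>) = Some R \<and> S (z1, z2) = A + B * \<Delta> * R * C"
    unfolding Let_def using main by blast
  moreover have "A \<in> carrier_mat M N" "B \<in> carrier_mat M r" "C \<in> carrier_mat r N" "D \<in> carrier_mat r r"
    by (simp_all add: A_def B_def C_def D_def)
  ultimately show ?thesis using R(1-4) by blast
qed

end
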